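(* Let $L>0$, $\kappa_1>0$, $\kappa_2\in\mathbb{R}\setminus\{0\}$, and let $u$ be a dissipative solution (in the sense defined in the context) of the initial boundary value problem $$\begin{cases}\partial_{tt}^2u=-\kappa_1^2\,\partial_{xxxx}^4u-\Phi'(u), & t>0,\ 0<x<L,\\ \partial_xu(t,0)=\partial_xu(t,L)=0, & t>0,\\ \partial_{xxx}^3u(t,0)=\partial_{xxx}^3u(t,L)=0,& t>0,\\ u(0,x)=v_0(x),\quad \partial_tu(0,x)=v_1(x),& 0<x<L.\end{cases}$$ Assume that $v_0$ and $v_1$ are constant functions with $|v_0|<1$, and that there exists a time $\bar t>0$ such that $|u(\bar t,x)|>1$ for every $x\in[0,L]$. Let $A_0$ be the initial amplitude of the zero mode, and let $C_1$ and $B_n$ $(n\ge1)$ be the coefficients of $u$ in the detached regime $|u|>1$ around the time $\bar t$ (all defined in the context). If $u\notin C^1([0,\infty)\times[0,L])$, then $$|C_1|\le|\kappa_2|\sqrt{A_0^2-L},$$ and there is a constant $C>0$, independent of $n$, such that $$B_n\le C\,n^{-5/2}\qquad\text{for all } n>1.$$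
   Context: The potential $\Phi:\mathbb{R}\to\mathbb{R}$ is $\Phi(u)=\kappa_2^2u^2/2$ if $|u|\le1$ and $\Phi(u)=\kappa_2^2/2$ if $|u|>1$; hence $\Phi'(u)=\kappa_2^2u$ for $|u|<1$ and $\Phi'(u)=0$ for $|u|>1$. $\partial\Phi(u)$ denotes the (Clarke) subdifferential of the Lipschitz function $\Phi$: $\partial\Phi(u)=\{\Phi'(u)\}$ for $u\ne\pm1$, $\partial\Phi(1)=[0,\kappa_2^2]$, $\partial\Phi(-1)=[-\kappa_2^2,0]$. The initial data satisfy $v_0\in H^2(0,L)$, $v_1\in L^2(0,L)$. Energy: $E[u](t)=\int_0^L\Big(\tfrac{(\partial_tu(t,x))^2+\kappa_1^2(\partial_{xx}^2u(t,x))^2}{2}+\Phi(u(t,x))\Big)dx$, and $E[u](0)=\int_0^L\Big(\tfrac{v_1^2+\kappa_1^2(\partial_{xx}^2v_0)^2}{2}+\Phi(v_0)\Big)dx$. A function $u:[0,\infty)\times[0,L]\to\mathbb{R}$ is a dissipative solution of the problem if (i) $u\in C([0,\infty)\times[0,L])$; (ii) $\partial_tu,\ \partial_{xx}^2u\in L^\infty(0,\infty;L^2(0,L))$ and $u\in L^\infty(0,T;H^2(0,L))$ for every $T>0$; (iii) $\partial_xu(t,0)=\partial_xu(t,L)=0$ for almost every $t>0$; (iv) $u$ is a weak solution: there is a measurable function $h_u$ with $h_u(t,x)\in\partial\Phi(u(t,x))$ for almost every $(t,x)$ such that for every $\varphi\in C^\infty(\mathbb{R}^2)$ with compact support and $\partial_x\varphi(\cdot,0)=\partial_x\varphi(\cdot,L)=0$,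 $$\int_0^\infty\!\!\int_0^L\big(u\,\partial_{tt}^2\varphi+\kappa_1^2\,\partial_{xx}^2u\,\partial_{xx}^2\varphi+h_u\varphi\big)\,dx\,dt-\int_0^Lv_1(x)\varphi(0,x)\,dx+\int_0^Lv_0(x)\,\partial_t\varphi(0,x)\,dx=0;$$ (v) $E[u](t)\le E[u](0)$ for almost every $t>0$. Spectral decomposition: $u_0=L^{-1/2}$ and $u_n(x)=\sqrt{2/L}\,\cos(n\pi x/L)$ for $n\ge1$, an orthonormal basis of $L^2(0,L)$; write $u(t,x)=\sum_{n=0}^\infty\alpha_n(t)u_n(x)$. Coefficient $A_0$: $A_0\ge0$ and $\varphi_0\in\mathbb{R}$ are such that $v_0=A_0\cos(\varphi_0)L^{-1/2}$ and $v_1=-A_0|\kappa_2|\sin(\varphi_0)L^{-1/2}$, i.e. $A_0^2=L\,(v_0^2+v_1^2/\kappa_2^2)$. Coefficients $C_1,B_n$: by continuity $|u|>1$ on $I\times[0,L]$ for some open interval $I\ni\bar t$, and there the equation reduces to $\partial_{tt}^2u=-\kappa_1^2\partial_{xxxx}^4u$, so that for $t\in I$ one has $\alpha_0(t)=C_0+C_1t$ and $\alpha_n(t)=B_n\cos(\nu_nt+\psi_n)$ for $n\ge1$, with $\nu_n=\kappa_1(n\pi/L)^2$, $C_0,C_1,\psi_n\in\mathbb{R}$ and amplitudes $B_n\ge0$. (Translating time changes only $C_0$ and $\psi_n$.) *)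

theory Defs
  imports "HOL-Analysis.Analysis"
begin

text \<open>Points of the space-time strip are pairs \<open>(t, x)\<close>.  Elements of Lebesgue and Sobolev spaces
  are represented by Borel functions (every almost-everywhere class contains one), of which only the
  values on the domain matter.\<close>

subsection \<open>Test functions\<close>

definition pd_t :: "(real \<times> real \<Rightarrow> real) \<Rightarrow> real \<times> real \<Rightarrow> real" where
  "pd_t f z = deriv (\<lambda>s. f (s, snd z)) (fst z)"

definition pd_x :: "(real \<times> real \<Rightarrow> real) \<Rightarrow> real \<times> real \<Rightarrow> real" where
  "pd_x f z = deriv (\<lambda>y. f (fst z, y)) (snd z)"

primrec C_k :: "nat \<Rightarrow> (real \<times> real \<Rightarrow> real) \<Rightarrow> bool" where
  "C_k 0 f \<longleftrightarrow> continuous_on UNIV f"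
| "C_k (Suc k) f \<longleftrightarrow> f differentiable_on UNIV \<and> C_k k (pd_t f) \<and> C_k k (pd_x f)"

definition test_fun :: "(real \<times> real \<Rightarrow> real) \<Rightarrow> bool" where
  "test_fun \<phi> \<longleftrightarrow> (\<forall>k. C_k k \<phi>) \<and> compact (closure {z. \<phi> z \<noteq> 0})"

definition test_fun1 :: "(real \<Rightarrow> real) \<Rightarrow> bool" where
  "test_fun1 \<eta> \<longleftrightarrow> (\<forall>k. (deriv ^^ k) \<eta> differentiable_on UNIV) \<and> compact (closure {x. \<eta> x \<noteq> 0})"

subsection \<open>Weak derivatives and function spaces\<close>

definition strip :: "real \<Rightarrow> (real \<times> real) set" where
  "strip L = {0<..} \<times> {0<..<L}"

definition weak_dt :: "real \<Rightarrow> (real \<times> real \<Rightarrow> real) \<Rightarrow> (real \<times> real \<Rightarrow> real) \<Rightarrow> bool" where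
  "weak_dt L u w \<longleftrightarrow> (\<forall>\<phi>. test_fun \<phi> \<and> closure {z. \<phi> z \<noteq> 0} \<subseteq> strip L \<longrightarrow>
     (LINT z:strip L|lborel. u z * pd_t \<phi> z) = - (LINT z:strip L|lborel. w z * \<phi> z))"

definition weak_dx :: "real \<Rightarrow> (real \<times> real \<Rightarrow> real) \<Rightarrow> (real \<times> real \<Rightarrow> real) \<Rightarrow> bool" where
  "weak_dx L u w \<longleftrightarrow> (\<forall>\<phi>. test_fun \<phi> \<and> closure {z. \<phi> z \<noteq> 0} \<subseteq> strip L \<longrightarrow>
     (LINT z:strip L|lborel. u z * pd_x \<phi> z) = - (LINT z:strip L|lborel. w z * \<phi> z))"

definition L2 :: "real \<Rightarrow> (real \<Rightarrow> real) \<Rightarrow> bool" where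
  "L2 L v \<longleftrightarrow> set_borel_measurable lborel {0<..<L} v \<and>
     set_integrable lborel {0<..<L} (\<lambda>x. (v x)\<^sup>2)"

definition weak_deriv :: "real \<Rightarrow> (real \<Rightarrow> real) \<Rightarrow> (real \<Rightarrow> real) \<Rightarrow> bool" where
  "weak_deriv L v w \<longleftrightarrow> (\<forall>\<eta>. test_fun1 \<eta> \<and> closure {x. \<eta> x \<noteq> 0} \<subseteq> {0<..<L} \<longrightarrow>
     (LINT x:{0<..<L}|lborel. v x * deriv \<eta> x) = - (LINT x:{0<..<L}|lborel. w x * \<eta> x))"

text \<open>\<open>H2 L v v' v''\<close>: the function \<open>v\<close> is in \<open>H\<^sup>2(0,L)\<close>, with weak derivatives \<open>v'\<close> and \<open>v''\<close>.\<close>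

definition H2 :: "real \<Rightarrow> (real \<Rightarrow> real) \<Rightarrow> (real \<Rightarrow> real) \<Rightarrow> (real \<Rightarrow> real) \<Rightarrow> bool" where
  "H2 L v v' v'' \<longleftrightarrow> L2 L v \<and> L2 L v' \<and> L2 L v'' \<and> weak_deriv L v v' \<and> weak_deriv L v' v''"

text \<open>The space \<open>L\<^sup>\<infinity>(J; L\<^sup>2(0,L))\<close> for a set \<open>J\<close> of times; \<open>M\<close> bounds the squared norm.\<close>

definition Linf_L2 :: "real set \<Rightarrow> real \<Rightarrow> (real \<times> real \<Rightarrow> real) \<Rightarrow> bool" where
  "Linf_L2 J L w \<longleftrightarrow> set_borel_measurable lborel (J \<times> {0<..<L}) w \<and>
     (\<exists>M. AE t in lborel. t \<in> J \<longrightarrow>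
        set_integrable lborel {0<..<L} (\<lambda>x. (w (t, x))\<^sup>2) \<and>
        (LINT x:{0<..<L}|lborel. (w (t, x))\<^sup>2) \<le> M)"

text \<open>\<open>C\<^sup>1([0,\<infinity>) \<times> [0,L])\<close>, differentiability being one-sided on the boundary.\<close>

definition C1_closed_strip :: "real \<Rightarrow> (real \<times> real \<Rightarrow> real) \<Rightarrow> bool" where
  "C1_closed_strip L u \<longleftrightarrow> (\<exists>p q.
     continuous_on ({0..} \<times> {0..L}) p \<and> continuous_on ({0..} \<times> {0..L}) q \<and>
     (\<forall>z \<in> {0..} \<times> {0..L}.
        (u has_derivative (\<lambda>d. p z * fst d + q z * snd d)) (at z within {0..} \<times> {0..L})))"

subsection \<open>The potential and dissipative solutions\<close>

definition Pot :: "real \<Rightarrow> real \<Rightarrow> real" where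
  "Pot \<kappa>2 r = (if \<bar>r\<bar> \<le> 1 then \<kappa>2\<^sup>2 * r\<^sup>2 / 2 else \<kappa>2\<^sup>2 / 2)"

text \<open>The Clarke subdifferential of the potential: at the two kinks it is the interval spanned by
  the one-sided derivatives.\<close>

definition subdiff_Pot :: "real \<Rightarrow> real \<Rightarrow> real set" where
  "subdiff_Pot \<kappa>2 r =
     (if r = 1 then {0..\<kappa>2\<^sup>2} else if r = -1 then {- \<kappa>2\<^sup>2..0} else {deriv (Pot \<kappa>2) r})"

definition energy ::
  "real \<Rightarrow> real \<Rightarrow> real \<Rightarrow> (real \<Rightarrow> real) \<Rightarrow> (real \<Rightarrow> real) \<Rightarrow> (real \<Rightarrow> real) \<Rightarrow> real" where
  "energy L \<kappa>1 \<kappa>2 w wt wxx =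
     (LINT x:{0<..<L}|lborel. ((wt x)\<^sup>2 + \<kappa>1\<^sup>2 * (wxx x)\<^sup>2) / 2 + Pot \<kappa>2 (w x))"

definition weak_solution :: "real \<Rightarrow> real \<Rightarrow> real \<Rightarrow> (real \<Rightarrow> real) \<Rightarrow> (real \<Rightarrow> real) \<Rightarrow>
    (real \<times> real \<Rightarrow> real) \<Rightarrow> (real \<times> real \<Rightarrow> real) \<Rightarrow> bool" where
  "weak_solution L \<kappa>1 \<kappa>2 v0 v1 u uxx \<longleftrightarrow>
     (\<exists>h. set_borel_measurable lborel (strip L) h \<and>
        (AE z in lborel. z \<in> strip L \<longrightarrow> h z \<in> subdiff_Pot \<kappa>2 (u z)) \<and>
        (\<forall>\<phi>. test_fun \<phi> \<and> (\<forall>t. pd_x \<phi> (t, 0) = 0 \<and> pd_x \<phi> (t, L) = 0) \<longrightarrow>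
           (LINT z:strip L|lborel.
              u z * pd_t (pd_t \<phi>) z + \<kappa>1\<^sup>2 * uxx z * pd_x (pd_x \<phi>) z + h z * \<phi> z)
           - (LINT x:{0<..<L}|lborel. v1 x * \<phi> (0, x))
           + (LINT x:{0<..<L}|lborel. v0 x * pd_t \<phi> (0, x)) = 0))"

text \<open>The weak derivatives \<open>ut\<close>, \<open>ux\<close>, \<open>uxx\<close> and \<open>v0''\<close> are unique almost everywhere, so it is
  immaterial which representatives are chosen.  For almost every \<open>t\<close> the continuous function
  \<open>u (t, _)\<close> is in \<open>H\<^sup>2(0,L)\<close>, hence continuously differentiable on \<open>[0,L]\<close>, so the Neumann
  condition is stated with classical one-sided derivatives.\<close>

definition dissipative_solution ::
  "real \<Rightarrow> real \<Rightarrow> real \<Rightarrow> (real \<Rightarrow> real) \<Rightarrow> (real \<Rightarrow> real) \<Rightarrow> (real \<times> real \<Rightarrow> real) \<Rightarrow> bool" where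
  "dissipative_solution L \<kappa>1 \<kappa>2 v0 v1 u \<longleftrightarrow>
     (\<exists>ut ux uxx v0' v0''.
        H2 L v0 v0' v0'' \<and> L2 L v1 \<and>
        continuous_on ({0..} \<times> {0..L}) u \<and>
        weak_dt L u ut \<and> weak_dx L u ux \<and> weak_dx L ux uxx \<and>
        Linf_L2 {0<..} L ut \<and> Linf_L2 {0<..} L uxx \<and>
        (\<forall>T>0. Linf_L2 {0<..<T} L u \<and> Linf_L2 {0<..<T} L ux \<and> Linf_L2 {0<..<T} L uxx) \<and>
        (AE t in lborel. t > 0 \<longrightarrow>
           ((\<lambda>x. u (t, x)) has_real_derivative 0) (at 0 within {0..L}) \<and>
           ((\<lambda>x. u (t, x)) has_real_derivative 0) (at L within {0..L})) \<and>
        weak_solution L \<kappa>1 \<kappa>2 v0 v1 u uxx \<and>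
        (AE t in lborel. t > 0 \<longrightarrow>
           energy L \<kappa>1 \<kappa>2 (\<lambda>x. u (t, x)) (\<lambda>x. ut (t, x)) (\<lambda>x. uxx (t, x))
           \<le> energy L \<kappa>1 \<kappa>2 v0 v1 v0''))"

subsection \<open>Spectral coefficients\<close>

definition neumann_mode :: "real \<Rightarrow> nat \<Rightarrow> real \<Rightarrow> real" where
  "neumann_mode L n x =
     (if n = 0 then 1 / sqrt L else sqrt (2 / L) * cos (real n * pi * x / L))"

definition mode_coeff :: "real \<Rightarrow> (real \<times> real \<Rightarrow> real) \<Rightarrow> nat \<Rightarrow> real \<Rightarrow> real" where
  "mode_coeff L u n t = (LINT x:{0<..<L}|lborel. u (t, x) * neumann_mode L n x)"

definition frequency :: "real \<Rightarrow> real \<Rightarrow> nat \<Rightarrow> real" where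
  "frequency L \<kappa>1 n = \<kappa>1 * (real n * pi / L)\<^sup>2"

text \<open>The numbers \<open>C0\<close>, \<open>C1\<close> and, for \<open>n \<ge> 1\<close>, \<open>B n\<close>, \<open>\<psi> n\<close> describe the modes of \<open>u\<close> on an open
  time interval around \<open>tb\<close> during which \<open>\<bar>u\<bar> > 1\<close>; the value \<open>B 0\<close> is irrelevant.\<close>

definition detached_coeffs :: "real \<Rightarrow> real \<Rightarrow> (real \<times> real \<Rightarrow> real) \<Rightarrow> real \<Rightarrow>
    real \<Rightarrow> real \<Rightarrow> (nat \<Rightarrow> real) \<Rightarrow> (nat \<Rightarrow> real) \<Rightarrow> bool" where
  "detached_coeffs L \<kappa>1 u tb C0 C1 B \<psi> \<longleftrightarrow>
     (\<forall>n\<ge>1. B n \<ge> 0) \<and>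
     (\<exists>a b. 0 \<le> a \<and> a < tb \<and> tb < b \<and>
        (\<forall>t\<in>{a<..<b}. (\<forall>x\<in>{0..L}. \<bar>u (t, x)\<bar> > 1) \<and>
           mode_coeff L u 0 t = C0 + C1 * t \<and>
           (\<forall>n\<ge>1. mode_coeff L u n t = B n * cos (frequency L \<kappa>1 n * t + \<psi> n))))"

end

theory Submission
  imports Defs "HOL-Computational_Algebra.Polynomial" "HOL-Real_Asymp.Real_Asymp"
begin

text \<open>
  Split the energy into that of the spatial mean of \<open>u\<close> and that of the deviation from the mean.
  Apart from the initial value, the weak equation is needed only for the mean, whose acceleration is
  minus the mean of the subgradient \<open>h\<close>; the energy inequality controls the deviation.

  On a detached interval the potential energy is \<open>L \<kappa>2\<^sup>2 / 2\<close>, while the total energy is at most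
  \<open>\<kappa>2\<^sup>2 A0\<^sup>2 / 2\<close>.  Hence \<open>C1\<^sup>2 \<le> \<kappa>2\<^sup>2 (A0\<^sup>2 - L)\<close>, and if \<open>A0\<^sup>2 = L\<close> then there is no
  kinetic energy left and \<open>u\<close> does not move.  If \<open>A0\<^sup>2 > L\<close>, the mean of a flat solution always has
  nonzero velocity and crosses the kinks \<open>\<plusminus>1\<close> of the potential transversally.  This makes the energy
  inequality coercive enough to exclude deviations from flatness, so \<open>u\<close> stays constant in space for
  all times.  In both cases every amplitude \<open>B n\<close> with \<open>n \<ge> 1\<close> is zero, which is stronger than the
  claimed decay.
\<close>

subsection \<open>Smooth functions and test functions\<close>

text \<open>The obstacle is that the subgradient is not Lipschitz in \<open>u\<close>: at the kinks
  the force jumps by \<open>\<kappa>2\<^sup>2\<close>, so no Gronwall estimate compares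
  \<open>u\<close> with a flat solution. A scaling argument replaces it. Let the beam be flat at
  time T, its mean moving with speed a > 0. At time T + s, for small s, the mean is at least a s / 2
  away from the kinks, while a bound M on the squared velocity deviation limits the squared
  deviation of \<open>u\<close> to s^2 M. At distance d from a kink, a squared deviation D changes
  the potential energy by D / d and the force by D / d^2, up to constants, because the terms linear
  in the deviation integrate to zero. The energy inequality then bounds the squared velocity
  deviation by a multiple of s M, hence by M / 2 for s small independently of M; iteration gives
  zero. The equation for the mean comes from test functions constant in x on the strip: they satisfy
  the Neumann condition and annihilate the bending term. The threshold A0^2 = L is where the energy
  per unit length equals \<open>\<kappa>2\<^sup>2 / 2\<close>, the maximum of the potential.\<close>

text \<open>Derivatives enter as witnesses instead of iterates of \<open>deriv\<close>, so that
  closure under sums, products and affine substitution is an induction on \<open>k\<close>.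
  Continuity of each derivative comes from the next order.\<close>

primrec smooth_k :: "nat \<Rightarrow> (real \<Rightarrow> real) \<Rightarrow> bool" where
  "smooth_k 0 f \<longleftrightarrow> True"
| "smooth_k (Suc k) f \<longleftrightarrow> (\<exists>f'. (\<forall>x. (f has_real_derivative f' x) (at x)) \<and> smooth_k k f')"

definition smooth :: "(real \<Rightarrow> real) \<Rightarrow> bool" where
  "smooth f \<longleftrightarrow> (\<forall>k. smooth_k k f)"

lemma smooth_k_Suc_D: "smooth_k (Suc k) f \<Longrightarrow> smooth_k k f"
  by (induction k arbitrary: f) auto

lemma smooth_has_deriv:
  assumes "smooth f" shows "(f has_real_derivative deriv f x) (at x)"
proof -
  have "smooth_k (Suc 0) f" using assms by (simp add: smooth_def del: smooth_k.simps)
  then obtain f' where "\<And>x. (f has_real_derivative f' x) (at x)" by auto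
  then show ?thesis by (metis DERIV_imp_deriv)
qed

lemma smooth_deriv:
  assumes "smooth f" shows "smooth (deriv f)"
  unfolding smooth_def
proof
  fix k
  have "smooth_k (Suc k) f" using assms by (simp add: smooth_def del: smooth_k.simps)
  then obtain f' where f': "\<And>x. (f has_real_derivative f' x) (at x)" "smooth_k k f'" by auto
  have "deriv f = f'" using f' by (auto simp: DERIV_imp_deriv)
  then show "smooth_k k (deriv f)" using f' by simp
qed

lemma smoothI:
  assumes "\<And>x. (f has_real_derivative f' x) (at x)" "smooth f'"
  shows "smooth f"
  unfolding smooth_def
proof
  fix k show "smooth_k k f" using assms by (cases k) (auto simp: smooth_def)
qed

lemma smooth_const: "smooth (\<lambda>x. c)"
proof -
  have "smooth_k k (\<lambda>x. c)" for k
  proof (induction k arbitrary: c)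
    case (Suc k)
    then show ?case by (auto intro!: exI[of _ "\<lambda>x. 0"])
  qed simp
  then show ?thesis by (simp add: smooth_def)
qed

lemma smooth_k_add: "smooth_k k f \<Longrightarrow> smooth_k k g \<Longrightarrow> smooth_k k (\<lambda>x. f x + g x)"
proof (induction k arbitrary: f g)
  case (Suc k)
  then obtain f' g' where "\<forall>x. (f has_real_derivative f' x) (at x)" "smooth_k k f'"
    "\<forall>x. (g has_real_derivative g' x) (at x)" "smooth_k k g'" by auto
  then show ?case using Suc.IH[of f' g']
    by (auto intro!: exI[of _ "\<lambda>x. f' x + g' x"] DERIV_add)
qed simp

lemma smooth_k_mult: "smooth_k k f \<Longrightarrow> smooth_k k g \<Longrightarrow> smooth_k k (\<lambda>x. f x * g x)"
proof (induction k arbitrary: f g)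
  case (Suc k)
  then obtain f' g' where *: "\<forall>x. (f has_real_derivative f' x) (at x)" "smooth_k k f'"
    "\<forall>x. (g has_real_derivative g' x) (at x)" "smooth_k k g'" by auto
  have "smooth_k k f" "smooth_k k g" using Suc.prems smooth_k_Suc_D by blast+
  then have "smooth_k k (\<lambda>x. f' x * g x + g' x * f x)"
    by (intro smooth_k_add Suc.IH) (use * in auto)
  then show ?case using *
    by (auto intro!: exI[of _ "\<lambda>x. f' x * g x + g' x * f x"] DERIV_mult)
qed simp

lemma smooth_k_affine: "smooth_k k f \<Longrightarrow> smooth_k k (\<lambda>x. c * f (a * x + b))"
proof (induction k arbitrary: f c)
  case (Suc k)
  then obtain f' where *: "\<And>x. (f has_real_derivative f' x) (at x)" "smooth_k k f'" by auto
  have "((\<lambda>x. c * f (a * x + b)) has_real_derivative (c * a) * f' (a * x + b)) (at x)" for x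
  proof -
    have "((\<lambda>x. a * x + b) has_real_derivative a) (at x)"
      by (auto intro!: derivative_eq_intros)
    from DERIV_cmult[OF DERIV_chain2[OF *(1) this], of c] show ?thesis by (simp add: mult_ac)
  qed
  then show ?case using Suc.IH[OF *(2), of "c * a"]
    by (auto intro!: exI[of _ "\<lambda>x. c * a * f' (a * x + b)"])
qed simp

lemma smooth_add: "smooth f \<Longrightarrow> smooth g \<Longrightarrow> smooth (\<lambda>x. f x + g x)"
  by (simp add: smooth_def smooth_k_add)

lemma smooth_mult: "smooth f \<Longrightarrow> smooth g \<Longrightarrow> smooth (\<lambda>x. f x * g x)"
  by (simp add: smooth_def smooth_k_mult)

lemma smooth_affine: "smooth f \<Longrightarrow> smooth (\<lambda>x. f (a * x + b))"
  using smooth_k_affine[where c = 1] by (simp add: smooth_def)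

lemma smooth_cmult: "smooth f \<Longrightarrow> smooth (\<lambda>x. c * f x)"
  using smooth_mult[OF smooth_const] .

lemma smooth_diff: "smooth f \<Longrightarrow> smooth g \<Longrightarrow> smooth (\<lambda>x. f x - g x)"
  using smooth_add[of f "\<lambda>x. - 1 * g x"] smooth_cmult[of g "- 1"] by simp

lemma smooth_cont: "smooth f \<Longrightarrow> continuous_on A f"
  using smooth_has_deriv DERIV_isCont continuous_at_imp_continuous_on by blast

lemma smooth_borel: "smooth f \<Longrightarrow> f \<in> borel_measurable borel"
  by (intro borel_measurable_continuous_onI smooth_cont)

lemma smooth_bounded:
  assumes "smooth f" "\<And>x. x \<notin> {a..b} \<Longrightarrow> f x = 0"
  obtains K where "\<And>x. \<bar>f x\<bar> \<le> K"
proof -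
  have "compact (f ` {a..b})" by (intro compact_continuous_image smooth_cont assms) simp
  then obtain K where K: "\<And>x. x \<in> {a..b} \<Longrightarrow> \<bar>f x\<bar> \<le> K"
    using compact_imp_bounded bounded_iff by (metis imageI real_norm_def)
  have "\<bar>f x\<bar> \<le> max K 0" for x
    using K[of x] assms(2)[of x] by (cases "x \<in> {a..b}") auto
  then show ?thesis using that by blast
qed

section \<open>A flat function and a smooth step\<close>

text \<open>The classical exp (- 1 / x), multiplied by a polynomial in 1 / x. With the polynomial as
  an index the family is closed under differentiation, which makes smoothness an induction.\<close>

definition flat :: "real poly \<Rightarrow> real \<Rightarrow> real" where
  "flat p x = (if x > 0 then poly p (1 / x) * exp (- 1 / x) else 0)"

lemma poly_exp_tendsto_0: "((\<lambda>y. poly p y * exp (- y)) \<longlongrightarrow> (0::real)) at_top"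
proof -
  have "((\<lambda>y. \<Sum>i\<le>degree p. coeff p i * (y ^ i / exp y)) \<longlongrightarrow> (\<Sum>i\<le>degree p. coeff p i * 0)) at_top"
    by (intro tendsto_sum tendsto_mult tendsto_const tendsto_power_div_exp_0)
  moreover have "(\<lambda>y. \<Sum>i\<le>degree p. coeff p i * (y ^ i / exp y)) = (\<lambda>y. poly p y * exp (- y))"
    by (simp add: poly_altdef sum_distrib_right exp_minus divide_inverse mult.assoc)
  ultimately show ?thesis by simp
qed

lemma flat_tendsto_0: "(flat p \<longlongrightarrow> 0) (at 0)"
proof -
  have "((\<lambda>x. poly p (1/x) * exp (- (1/x))) \<longlongrightarrow> 0) (at_right 0)"
    by (rule filterlim_compose[OF poly_exp_tendsto_0])
       (simp add: filterlim_inverse_at_top_right inverse_eq_divide[symmetric])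
  then have "(flat p \<longlongrightarrow> 0) (at_right 0)"
    by (rule Lim_transform_eventually)
       (auto simp: flat_def eventually_at_right_less intro!: eventually_at_rightI[of 0 1])
  moreover have "(flat p \<longlongrightarrow> 0) (at_left 0)"
    by (rule Lim_transform_eventually[OF tendsto_const])
       (auto simp: flat_def intro!: eventually_at_leftI[of "-1" 0])
  ultimately show ?thesis by (simp add: filterlim_split_at)
qed

lemma flat_has_deriv:
  "(flat p has_real_derivative flat ([:0, 0, 1:] * (p - pderiv p)) x) (at x)"
proof -
  consider "x < 0" | "x > 0" | "x = 0" by linarith
  then show ?thesis
  proof cases
    case 1
    have "((\<lambda>x. 0) has_real_derivative 0) (at x)" by simp
    then have "(flat p has_real_derivative 0) (at x)"
      by (rule has_field_derivative_transform_within_open[of _ _ _ "{..<0}"])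
         (use 1 in \<open>auto simp: flat_def\<close>)
    then show ?thesis using 1 by (simp add: flat_def)
  next
    case 2
    have "((\<lambda>x. poly p (1/x) * exp (- 1/x)) has_real_derivative
        flat ([:0, 0, 1:] * (p - pderiv p)) x) (at x)"
      using 2 by (auto intro!: derivative_eq_intros DERIV_chain2[OF poly_DERIV] simp: flat_def)
        (simp add: algebra_simps power2_eq_square diff_divide_distrib add_divide_distrib)
    then show ?thesis
      by (rule has_field_derivative_transform_within_open[of _ _ _ "{0<..}"])
         (use 2 in \<open>auto simp: flat_def\<close>)
  next
    case 3
    \<comment> \<open>The difference quotient at 0 lies in the same family, so
      \<open>flat_tendsto_0\<close> gives the derivative there.\<close>
    have "flat p h / h = flat ([:0, 1:] * p) h" for h
      by (auto simp: flat_def)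
    then show ?thesis using 3 flat_tendsto_0[of "[:0, 1:] * p"]
      by (simp add: DERIV_def flat_def[of _ 0])
  qed
qed

lemma smooth_flat: "smooth (flat p)"
proof -
  have "smooth_k k (flat p)" for k
  proof (induction k arbitrary: p)
    case (Suc k)
    have "smooth_k k (flat ([:0, 0, 1:] * (p - pderiv p)))" by (rule Suc)
    then show ?case using flat_has_deriv[of p] unfolding smooth_k.simps by blast
  qed simp
  then show ?thesis by (simp add: smooth_def)
qed

lemma smooth_antideriv:
  assumes "smooth f"
  obtains F where "smooth F" "\<And>x. (F has_real_derivative f x) (at x)" "F 0 = 0"
proof -
  have "\<exists>F. \<forall>x::real. - \<infinity> < ereal x \<longrightarrow> ereal x < \<infinity> \<longrightarrow> (F has_vector_derivative f x) (at x)"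
    by (rule einterval_antiderivative) (use DERIV_isCont[OF smooth_has_deriv[OF assms]] in auto)
  then obtain F where F: "\<And>x. (F has_real_derivative f x) (at x)"
    by (auto simp: has_real_derivative_iff_has_vector_derivative)
  have G: "((\<lambda>x. F x - F 0) has_real_derivative f x) (at x)" for x
    using F[of x] by (auto intro!: derivative_eq_intros)
  show ?thesis using that[OF smoothI[OF G assms] G] by simp
qed

text \<open>A primitive of a nonnegative bump that is positive exactly on (0,1), divided by its
  total mass \<open>F 1\<close>.\<close>

lemma smooth_step_exists:
  "\<exists>S. smooth S \<and> mono S \<and> (\<forall>x\<le>0. S x = 0) \<and> (\<forall>x\<ge>1. S x = 1)"
proof -
  define b where "b x = flat 1 x * flat 1 ((-1) * x + 1)" for x
  have bs: "smooth b" unfolding b_def by (intro smooth_mult smooth_flat smooth_affine)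
  obtain F where F: "smooth F" "\<And>x. (F has_real_derivative b x) (at x)" "F 0 = 0"
    using smooth_antideriv[OF bs] by blast
  have b0: "b x \<ge> 0" for x by (simp add: b_def flat_def)
  have bp: "b x > 0" if "0 < x" "x < 1" for x using that by (simp add: b_def flat_def)
  have bz: "b x = 0" if "x \<le> 0 \<or> x \<ge> 1" for x using that by (auto simp: b_def flat_def)
  have mvt: "\<exists>z>x. z < y \<and> F y - F x = (y - x) * b z" if "x < y" for x y
    using MVT2[OF that F(2)] by blast
  have mono: "F x \<le> F y" if "x \<le> y" for x y
    by (rule DERIV_nonneg_imp_nondecreasing[OF that]) (use F(2) b0 in blast)
  have lo: "F x = 0" if le: "x \<le> 0" for x
  proof (cases "x = 0")
    case False
    then obtain z where "z < 0" "F 0 - F x = (0 - x) * b z"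
      using mvt[of x 0] le False by auto
    then show ?thesis using bz[of z] F(3) by simp
  qed (use F in simp)
  have hi: "F x = F 1" if ge: "x \<ge> 1" for x
  proof (cases "x = 1")
    case False
    then obtain z where "z > 1" "F x - F 1 = (x - 1) * b z"
      using mvt[of 1 x] ge False by auto
    then show ?thesis using bz[of z] by simp
  qed simp
  obtain z where "0 < z" "z < 1" "F 1 - F 0 = (1 - 0) * b z"
    using mvt[of 0 1] by auto
  then have pos: "F 1 > 0" using bp[of z] F(3) by simp
  show ?thesis
  proof (intro exI[of _ "\<lambda>x. (1 / F 1) * F x"] conjI smooth_cmult F(1) allI impI)
    show "mono (\<lambda>x. (1 / F 1) * F x)"
      using mono pos by (auto intro!: monoI divide_right_mono)
    show "(1 / F 1) * F x = 0" if "x \<le> 0" for x using lo[OF that] by simp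
    show "(1 / F 1) * F x = 1" if "1 \<le> x" for x using hi[OF that] pos by simp
  qed
qed

definition stepf :: "real \<Rightarrow> real" where
  "stepf = (SOME S. smooth S \<and> mono S \<and> (\<forall>x\<le>0. S x = 0) \<and> (\<forall>x\<ge>1. S x = 1))"

lemma stepf_props:
  "smooth stepf \<and> mono stepf \<and> (\<forall>x\<le>0. stepf x = 0) \<and> (\<forall>x\<ge>1. stepf x = 1)"
  unfolding stepf_def by (rule someI_ex[OF smooth_step_exists])

lemma stepf: "smooth stepf" "mono stepf" "x \<le> 0 \<Longrightarrow> stepf x = 0" "x \<ge> 1 \<Longrightarrow> stepf x = 1"
  using stepf_props by simp_all

lemma stepf_bounds: "0 \<le> stepf x" "stepf x \<le> 1"
proof -
  have "stepf (min x 0) \<le> stepf x" "stepf x \<le> stepf (max x 1)"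
    by (rule stepf(2)[THEN monoD], simp)+
  then show "0 \<le> stepf x" "stepf x \<le> 1" by (simp_all add: stepf)
qed

section \<open>Products of a function of time and a function of space as test functions\<close>

lemma pd_t_prod:
  "smooth f \<Longrightarrow> pd_t (\<lambda>z. f (fst z) * g (snd z)) = (\<lambda>z. deriv f (fst z) * g (snd z))"
  unfolding pd_t_def fst_conv snd_conv by (intro ext DERIV_imp_deriv DERIV_cmult_right smooth_has_deriv)

lemma pd_x_prod:
  "smooth g \<Longrightarrow> pd_x (\<lambda>z. f (fst z) * g (snd z)) = (\<lambda>z. f (fst z) * deriv g (snd z))"
  unfolding pd_x_def fst_conv snd_conv by (intro ext DERIV_imp_deriv DERIV_cmult smooth_has_deriv)

text \<open>Both partial derivatives of a product f(t) g(x) are products of the same kind, with one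
  factor differentiated.\<close>

lemma C_k_prod:
  assumes "smooth f" "smooth g" shows "C_k k (\<lambda>z. f (fst z) * g (snd z))"
  using assms
proof (induction k arbitrary: f g)
  case 0
  have "continuous_on UNIV (\<lambda>z::real \<times> real. f (fst z))" "continuous_on UNIV (\<lambda>z::real \<times> real. g (snd z))"
    by (rule continuous_on_compose2[OF smooth_cont[of _ UNIV]];
        use 0 in \<open>auto intro: continuous_intros\<close>)+
  then show ?case by (simp add: continuous_on_mult)
next
  case (Suc k)
  have d: "(\<lambda>z. h (fst z)) differentiable (at z)" "(\<lambda>z. h (snd z)) differentiable (at z)"
    if "smooth h" for h and z :: "real \<times> real"
  proof -
    have h: "(h has_derivative (*) (deriv h x)) (at x)" for x
      using smooth_has_deriv[OF that] by (simp add: has_field_derivative_def)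
    show "(\<lambda>z. h (fst z)) differentiable (at z)"
      using has_derivative_compose[OF has_derivative_fst[OF has_derivative_ident] h]
      unfolding differentiable_def by blast
    show "(\<lambda>z. h (snd z)) differentiable (at z)"
      using has_derivative_compose[OF has_derivative_snd[OF has_derivative_ident] h]
      unfolding differentiable_def by blast
  qed
  have "(\<lambda>z. f (fst z) * g (snd z)) differentiable_on UNIV"
    unfolding differentiable_on_def
    using differentiable_mult[OF d(1)[OF Suc.prems(1)] d(2)[OF Suc.prems(2)]] by auto
  then show ?case using Suc.IH Suc.prems by (simp add: pd_t_prod pd_x_prod smooth_deriv)
qed

lemma support_prod:
  fixes f g :: "real \<Rightarrow> real"
  assumes "\<And>t. t \<notin> {a..b} \<Longrightarrow> f t = (0::real)" "\<And>x. x \<notin> {c..d} \<Longrightarrow> g x = (0::real)"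
  shows "closure {z. f (fst z) * g (snd z) \<noteq> 0} \<subseteq> {a..b} \<times> {c..d}"
proof (rule closure_minimal)
  show "{z. f (fst z) * g (snd z) \<noteq> 0} \<subseteq> {a..b} \<times> {c..d}"
  proof
    fix z assume "z \<in> {z. f (fst z) * g (snd z) \<noteq> 0}"
    then have "f (fst z) \<noteq> 0" "g (snd z) \<noteq> 0" by auto
    then have "fst z \<in> {a..b}" "snd z \<in> {c..d}" using assms by blast+
    then show "z \<in> {a..b} \<times> {c..d}" by (simp add: mem_Times_iff)
  qed
qed (intro closed_Times closed_atLeastAtMost)

lemma test_fun_prod:
  assumes "smooth f" "smooth g"
    "\<And>t. t \<notin> {a..b} \<Longrightarrow> f t = 0" "\<And>x. x \<notin> {c..d} \<Longrightarrow> g x = 0"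
  shows "test_fun (\<lambda>z. f (fst z) * g (snd z))"
  unfolding test_fun_def
proof (intro conjI allI C_k_prod assms)
  show "compact (closure {z. f (fst z) * g (snd z) \<noteq> 0})"
    by (rule compact_closure[THEN iffD2], rule bounded_subset[OF _ order_trans[OF closure_subset support_prod]])
       (use assms in \<open>auto intro: bounded_Times\<close>)
qed

lemma test_fun1_smooth:
  assumes "smooth f" "\<And>t. t \<notin> {a..b} \<Longrightarrow> f t = 0"
  shows "test_fun1 f" "closure {x. f x \<noteq> 0} \<subseteq> {a..b}"
proof -
  have "smooth ((deriv ^^ k) f)" for k
    by (induction k) (auto intro: assms smooth_deriv)
  then have "(deriv ^^ k) f differentiable_on UNIV" for k
    unfolding differentiable_on_def
    using smooth_has_deriv real_differentiable_def by blast
  moreover show cl: "closure {x. f x \<noteq> 0} \<subseteq> {a..b}"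
    by (rule closure_minimal) (use assms(2) in blast, simp)
  moreover have "bounded {x. f x \<noteq> 0}"
    by (rule bounded_subset[OF bounded_closed_interval[of a b]]) (use assms(2) in blast)
  ultimately show "test_fun1 f" by (auto simp: test_fun1_def)
qed

section \<open>Smooth approximations of interval indicators\<close>

text \<open>The ramps of width 1 / n start at \<open>a\<close> and at \<open>b\<close> and lie to
  the right of these points. Hence the limit for large n is the indicator of the half-open interval
  \<open>{a<..b}\<close>, and the support reaches 1 / n beyond \<open>b\<close>.\<close>

definition cutoff :: "real \<Rightarrow> real \<Rightarrow> real \<Rightarrow> real \<Rightarrow> real" where
  "cutoff n a b x = stepf (n * x + (- n * a)) - stepf (n * x + (- n * b))"

lemma smooth_cutoff: "smooth (cutoff n a b)"
  unfolding cutoff_def by (intro smooth_diff smooth_affine stepf)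

lemma cutoff_outside:
  assumes "n > 0" "a \<le> b" "x \<notin> {a..b + 1 / n}" shows "cutoff n a b x = 0"
proof -
  consider "x < a" | "x > b + 1 / n" using assms(3) by fastforce
  then show ?thesis
  proof cases
    case 1
    then have "n * x \<le> n * a" "n * x \<le> n * b" using assms by auto
    then show ?thesis by (simp add: cutoff_def stepf)
  next
    case 2
    then have "n * x \<ge> n * b + 1" using assms by (simp add: field_simps)
    moreover have "n * b \<ge> n * a" using assms by auto
    ultimately show ?thesis by (simp add: cutoff_def stepf)
  qed
qed

lemma cutoff_bounds: "n > 0 \<Longrightarrow> a \<le> b \<Longrightarrow> 0 \<le> cutoff n a b x" "cutoff n a b x \<le> 1"
  using stepf_bounds stepf(2)[THEN monoD, of "n * x + (- n * b)" "n * x + (- n * a)"]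
  by (auto simp: cutoff_def add_increasing2 diff_le_eq)

lemma stepf_tendsto:
  "(\<lambda>n. stepf (real (Suc n) * x + (- real (Suc n) * a))) \<longlonglongrightarrow> (if x > a then 1 else 0)"
proof (cases "x > a")
  case True
  have "eventually (\<lambda>n. real (Suc n) > 1 / (x - a)) sequentially"
    using filterlim_real_sequentially[THEN filterlim_sequentially_Suc[THEN iffD2]]
    by (simp add: filterlim_at_top_dense)
  then have "eventually (\<lambda>n. stepf (real (Suc n) * x + (- real (Suc n) * a)) = 1) sequentially"
    by eventually_elim (use True in \<open>auto intro!: stepf simp: field_simps\<close>)
  then show ?thesis using True by (simp add: tendsto_eventually)
next
  case False
  then have "stepf (real (Suc n) * x + (- real (Suc n) * a)) = 0" for n

    by (intro stepf) (use False mult_left_mono[of x a "real (Suc n)"] in \<open>simp add: algebra_simps\<close>)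
  then show ?thesis using False by simp
qed

lemma cutoff_tendsto:
  assumes "a \<le> b"
  shows "(\<lambda>n. cutoff (real (Suc n)) a b x) \<longlonglongrightarrow> indicator {a<..b} x"
proof -
  have "(\<lambda>n. cutoff (real (Suc n)) a b x) \<longlonglongrightarrow> (if x > a then 1 else 0) - (if x > b then 1 else 0)"
    unfolding cutoff_def by (intro tendsto_diff stepf_tendsto)
  also have "(if x > a then 1 else 0) - (if x > b then 1 else 0) = (indicator {a<..b} x :: real)"
    using assms by (auto simp: indicator_def)
  finally show ?thesis .
qed

subsection \<open>Integrals over the strip\<close>

text \<open>The positive and the negative part of \<open>f\<close>, taken as densities, give
  measures that agree on all rays and so coincide. Since \<open>ennreal\<close> truncates negative
  numbers to 0, equality of \<open>ennreal (f x)\<close> and \<open>ennreal (- f x)\<close> forces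
  \<open>f x = 0\<close>.\<close>

lemma AE_eq_0_of_tail_integrals:
  fixes f :: "real \<Rightarrow> real"
  assumes f: "integrable lborel f" and z: "\<And>a. (LINT x:{a<..}|lborel. f x) = 0"
  shows "AE x in lborel. f x = 0"
proof -
  have [measurable]: "f \<in> borel_measurable lborel" using f by simp
  let ?M = "density lborel (\<lambda>x. ennreal (f x))" and ?N = "density lborel (\<lambda>x. ennreal (- f x))"
  have e: "emeasure ?M {a<..} < \<infinity> \<and> emeasure ?M {a<..} = emeasure ?N {a<..}" for a
  proof -
    let ?g = "\<lambda>x. indicator {a<..} x *\<^sub>R f x"
    have g: "integrable lborel ?g" using f by (intro integrable_mult_indicator) auto
    have i: "enn2real (\<integral>\<^sup>+x. ?g x \<partial>lborel) - enn2real (\<integral>\<^sup>+x. ennreal (- ?g x) \<partial>lborel) = 0"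
      using z[of a] real_lebesgue_integral_def[OF g] by (simp add: set_lebesgue_integral_def)
    have fin: "(\<integral>\<^sup>+x. ?g x \<partial>lborel) < \<infinity>" "(\<integral>\<^sup>+x. ennreal (- ?g x) \<partial>lborel) < \<infinity>"
      using real_integrable_def[THEN iffD1, OF g] by (auto simp: less_top)
    have "(\<integral>\<^sup>+x. ?g x \<partial>lborel) = (\<integral>\<^sup>+x. ennreal (- ?g x) \<partial>lborel)"
      using i fin by (metis enn2real_eq_0_iff eq_iff_diff_eq_0 ennreal_enn2real infinity_ennreal_def)
    moreover have "emeasure ?M {a<..} = (\<integral>\<^sup>+x. ?g x \<partial>lborel)"
      by (subst emeasure_density) (auto intro!: nn_integral_cong split: split_indicator)
    moreover have "emeasure ?N {a<..} = (\<integral>\<^sup>+x. ennreal (- ?g x) \<partial>lborel)"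
      by (subst emeasure_density) (auto intro!: nn_integral_cong split: split_indicator)
    ultimately show ?thesis using fin by simp
  qed
  have "?M = ?N"
    by (rule measure_eqI_lessThan) (simp, simp, use e in blast, use e in blast)
  then have "AE x in lborel. ennreal (f x) = ennreal (- f x)"
    by (intro sigma_finite_measure.density_unique[OF sigma_finite_lborel]) auto
  then show ?thesis
    by eventually_elim (metis add.inverse_inverse ennreal_eq_0_iff linorder_linear neg_0_le_iff_le order_antisym)
qed

text \<open>Extended by zero, \<open>f\<close> has vanishing integrals over all rays, because a ray
  meets the open interval in an interval exhausted by admissible half-open ones.\<close>

lemma AE_eq_0_of_interval_integrals:
  fixes f :: "real \<Rightarrow> real"
  assumes f: "set_integrable lborel {a<..<b} f"
    and z: "\<And>c d. a < c \<Longrightarrow> c < d \<Longrightarrow> d < b \<Longrightarrow> (LINT x:{c<..d}|lborel. f x) = 0"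
  shows "AE x in lborel. x \<in> {a<..<b} \<longrightarrow> f x = 0"
proof -
  let ?g = "\<lambda>x. indicator {a<..<b} x *\<^sub>R f x"
  have g: "integrable lborel ?g" using f by (simp add: set_integrable_def)
  have [measurable]: "?g \<in> borel_measurable lborel" using g by (rule borel_measurable_integrable)
  have "(LINT x:{y<..}|lborel. ?g x) = 0" for y
  proof (cases "max a y < b")
    case False
    then have nz: "(\<lambda>x. indicator {y<..} x *\<^sub>R ?g x) = (\<lambda>x. 0)" by (auto split: split_indicator)
    show ?thesis unfolding set_lebesgue_integral_def nz by simp
  next
    case True
    define c where "c = max a y"
    \<comment> \<open>The 3 makes \<open>e n\<close> at most a third of the length, so that
      \<open>c + e n < b - e n\<close> for every \<open>n\<close>.\<close>
    define e where "e n = (b - c) / (real n + 3)" for n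
    have c: "a \<le> c" "y \<le> c" "c < b" using True by (auto simp: c_def)
    have e: "0 < e n" "e n \<le> (b - c) / 3" for n
    proof -
      show "0 < e n" using c unfolding e_def by simp
      show "e n \<le> (b - c) / 3" using c unfolding e_def by (intro divide_left_mono) auto
    qed
    have e0: "e \<longlonglongrightarrow> 0" unfolding e_def
      by real_asymp
    have ind: "(\<lambda>n. indicator {c + e n<..b - e n} x :: real) \<longlonglongrightarrow> indicator {c<..<b} x" for x
    proof (cases "x \<in> {c<..<b}")
      case True
      have "eventually (\<lambda>n. e n < min (x - c) (b - x)) sequentially"
        using order_tendstoD(2)[OF e0, of "min (x - c) (b - x)"] True by auto
      then have "eventually (\<lambda>n. indicator {c + e n<..b - e n} x = (1::real)) sequentially"
        by eventually_elim (auto simp: indicator_def)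
      then show ?thesis using True by (simp add: tendsto_eventually)
    next
      case False
      then have "indicator {c + e n<..b - e n} x = (0::real)" for n
        using e(1)[of n] by (auto simp: indicator_def)
      then show ?thesis using False by simp
    qed
    have "(\<lambda>n. LINT x|lborel. indicator {c + e n<..b - e n} x *\<^sub>R ?g x)
        \<longlonglongrightarrow> (LINT x|lborel. indicator {c<..<b} x *\<^sub>R ?g x)"
    proof (rule integral_dominated_convergence[where w = "\<lambda>x. norm (?g x)"])
      show "AE x in lborel. (\<lambda>n. indicator {c + e n<..b - e n} x *\<^sub>R ?g x)
          \<longlonglongrightarrow> indicator {c<..<b} x *\<^sub>R ?g x"
        by (intro AE_I2 tendsto_scaleR tendsto_const ind)
      show "AE x in lborel. norm (indicator {c + e n<..b - e n} x *\<^sub>R ?g x) \<le> norm (?g x)" for n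
        by (intro AE_I2) (simp split: split_indicator)
      show "(\<lambda>x. indicator {c<..<b} x *\<^sub>R ?g x) \<in> borel_measurable lborel"
        by (intro borel_measurable_scaleR borel_measurable_indicator borel_measurable_integrable[OF g]) simp
      show "(\<lambda>x. indicator {c + e n<..b - e n} x *\<^sub>R ?g x) \<in> borel_measurable lborel" for n
        by (intro borel_measurable_scaleR borel_measurable_indicator borel_measurable_integrable[OF g]) simp
      show "integrable lborel (\<lambda>x. norm (?g x))" using g by (rule integrable_norm)
    qed
    moreover have "(LINT x|lborel. indicator {c + e n<..b - e n} x *\<^sub>R ?g x) = 0" for n
    proof -
      have "(LINT x|lborel. indicator {c + e n<..b - e n} x *\<^sub>R ?g x)
        = (LINT x:{c + e n<..b - e n}|lborel. f x)"
        unfolding set_lebesgue_integral_def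
        using e(1)[of n] c by (intro Bochner_Integration.integral_cong) (auto split: split_indicator)
      also have "\<dots> = 0"
        using e[of n] c by (intro z) (auto simp: field_simps)
      finally show ?thesis .
    qed
    ultimately have "(LINT x|lborel. indicator {c<..<b} x *\<^sub>R ?g x) = 0"
      by (simp add: LIMSEQ_const_iff)
    moreover have "(LINT x:{y<..}|lborel. ?g x) = (LINT x|lborel. indicator {c<..<b} x *\<^sub>R ?g x)"
      unfolding set_lebesgue_integral_def
      by (intro Bochner_Integration.integral_cong) (auto simp: c_def split: split_indicator)
    ultimately show ?thesis by simp
  qed
  from AE_eq_0_of_tail_integrals[OF g this] show ?thesis
    by eventually_elim (auto simp: indicator_def)
qed

section \<open>One-sided mollifiers\<close>

lemma stepf_deriv:
  "deriv stepf x \<ge> 0" "x \<le> 0 \<Longrightarrow> deriv stepf x = 0" "x \<ge> 1 \<Longrightarrow> deriv stepf x = 0"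
proof -
  note D = smooth_has_deriv[OF stepf(1), of x]
  show "deriv stepf x \<ge> 0"
    by (rule mono_on_imp_deriv_nonneg[OF _ D, of UNIV]) (use stepf(2) in auto)
  show "deriv stepf x = 0" if "x \<le> 0"
    by (rule DERIV_local_min[OF D, of 1]) (use that stepf_bounds in \<open>auto simp: stepf\<close>)
  show "deriv stepf x = 0" if "x \<ge> 1"
    by (rule DERIV_local_max[OF D, of 1]) (use that stepf_bounds in \<open>auto simp: stepf\<close>)
qed

text \<open>The derivative of the ramp occurring in \<open>cutoff\<close>: a unit mass spread over
  [s, s + 1 / n]. Lying to the right of \<open>s\<close>, it can be used at the initial time s =
  0.\<close>

definition moll :: "real \<Rightarrow> real \<Rightarrow> real \<Rightarrow> real" where
  "moll n s x = n * deriv stepf (n * x + (- n * s))"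

lemma moll_has_deriv: "((\<lambda>x. stepf (n * x + (- n * s))) has_real_derivative moll n s x) (at x)"
proof -
  have "((\<lambda>x. n * x + (- n * s)) has_real_derivative n) (at x)"
    by (auto intro!: derivative_eq_intros)
  from DERIV_chain2[OF smooth_has_deriv[OF stepf(1)] this] show ?thesis
    by (simp add: moll_def mult_ac)
qed

lemma smooth_moll: "smooth (moll n s)"
  unfolding moll_def by (intro smooth_cmult smooth_affine smooth_deriv stepf)

lemma moll_outside: "n > 0 \<Longrightarrow> x \<notin> {s<..<s + 1 / n} \<Longrightarrow> moll n s x = 0"
proof -
  assume n: "n > 0" and "x \<notin> {s<..<s + 1 / n}"
  then consider "x \<le> s" | "x \<ge> s + 1 / n" by fastforce
  then show ?thesis
  proof cases
    case 1
    then show ?thesis using n by (simp add: moll_def stepf_deriv)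
  next
    case 2
    then have "n * x + (- n * s) \<ge> 1" using n by (simp add: field_simps)
    then show ?thesis by (simp add: moll_def stepf_deriv)
  qed
qed

lemma moll_nonneg: "n > 0 \<Longrightarrow> moll n s x \<ge> 0"
  by (simp add: moll_def stepf_deriv)

lemma cutoff_has_deriv: "(cutoff n a b has_real_derivative moll n a x - moll n b x) (at x)"
  unfolding cutoff_def by (intro DERIV_diff moll_has_deriv)

lemma integral_moll:
  assumes "n > 0" shows "(LINT x:{s..s + 1 / n}|lborel. moll n s x) = 1"
proof -
  have "(LINT x:{s..s + 1 / n}|lborel. moll n s x)
      = stepf (n * (s + 1 / n) + (- n * s)) - stepf (n * s + (- n * s))"
    unfolding set_lebesgue_integral_def
    by (rule integral_FTC_atLeastAtMost)
       (use assms moll_has_deriv in \<open>auto simp: has_real_derivative_iff_has_vector_derivative[symmetric]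
          intro: has_field_derivative_at_within smooth_cont smooth_moll\<close>)
  also have "n * (s + 1 / n) + (- n * s) = 1" using assms by (simp add: field_simps)
  finally show ?thesis by (simp add: stepf)
qed

text \<open>All mollifiers live on (s, s + 1), so any time window \<open>A\<close> containing
  \<open>{s<..s + 1}\<close> gives the same integrals.\<close>

lemma moll_tendsto:
  fixes g :: "real \<Rightarrow> real"
  assumes g: "continuous_on {s..} g" and A: "{s<..s + 1} \<subseteq> A"
  shows "(\<lambda>n. LINT x:A|lborel. g x * moll (real (Suc n)) s x) \<longlonglongrightarrow> g s"
proof (rule LIMSEQ_I)
  fix e :: real assume "e > 0"
  obtain d where d: "d > 0" "\<And>x. x \<in> {s..} \<Longrightarrow> dist x s < d \<Longrightarrow> dist (g x) (g s) < e / 2"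
    using g \<open>e > 0\<close> unfolding continuous_on_iff
    by (metis atLeast_iff half_gt_zero order_refl)
  obtain N where N: "1 / real (Suc N) < d" using d(1) nat_approx_posE by blast
  show "\<exists>N. \<forall>n\<ge>N. norm ((LINT x:A|lborel. g x * moll (real (Suc n)) s x) - g s) < e"
  proof (intro exI[of _ N] allI impI)
    fix n assume "n \<ge> N"
    define k where "k = real (Suc n)"
    have k1: "1 / k \<le> 1" by (simp add: k_def)
    have "1 / k \<le> 1 / real (Suc N)" using \<open>n \<ge> N\<close> by (simp add: k_def frac_le)
    then have k: "k > 0" "1 / k < d" using N by (auto simp: k_def)
    let ?I = "{s..s + 1 / k}"
    have cg: "continuous_on ?I g" by (rule continuous_on_subset[OF g]) auto
    have cm: "continuous_on ?I (moll k s)" by (intro smooth_cont smooth_moll)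
    have i1: "set_integrable lborel ?I (\<lambda>x. g x * moll k s x)"
      and i2: "set_integrable lborel ?I (\<lambda>x. g s * moll k s x)"
      and i3: "set_integrable lborel ?I (\<lambda>x. e / 2 * moll k s x)"
      and i4: "set_integrable lborel ?I (\<lambda>x. g x * moll k s x - g s * moll k s x)"
      by (intro borel_integrable_atLeastAtMost' continuous_intros cg cm)+
    have "(LINT x:A|lborel. g x * moll k s x) = (LINT x:?I|lborel. g x * moll k s x)"
      unfolding set_lebesgue_integral_def
    proof (intro Bochner_Integration.integral_cong refl)
      fix x show "indicator A x *\<^sub>R (g x * moll k s x) = indicator ?I x *\<^sub>R (g x * moll k s x)"
      proof (cases "x \<in> {s<..<s + 1 / k}")
        case True
        then show ?thesis using A k1 by (auto simp: indicator_def subset_iff)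
      qed (use moll_outside[OF k(1)] in simp)
    qed
    then have "(LINT x:A|lborel. g x * moll k s x) - g s
        = (LINT x:?I|lborel. g x * moll k s x) - (LINT x:?I|lborel. g s * moll k s x)"
      using integral_moll[OF k(1), of s] by simp
    also have "\<dots> = (LINT x:?I|lborel. g x * moll k s x - g s * moll k s x)"
      using i1 i2 by simp
    finally have eq: "(LINT x:A|lborel. g x * moll k s x) - g s = \<dots>" .
    have pt: "\<bar>g x * moll k s x - g s * moll k s x\<bar> \<le> e / 2 * moll k s x" if "x \<in> ?I" for x
    proof -
      have "dist x s < d" using that k by (auto simp: dist_real_def)
      then have "\<bar>g x - g s\<bar> \<le> e / 2" using d(2)[of x] that by (auto simp: dist_real_def)
      then have "\<bar>g x - g s\<bar> * moll k s x \<le> e / 2 * moll k s x"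
        by (intro mult_right_mono moll_nonneg k)
      then show ?thesis
        using moll_nonneg[OF k(1), of s x] by (simp add: abs_mult left_diff_distrib[symmetric])
    qed
    have "\<bar>LINT x:?I|lborel. g x * moll k s x - g s * moll k s x\<bar>
        \<le> (LINT x:?I|lborel. \<bar>g x * moll k s x - g s * moll k s x\<bar>)"
      using set_integral_norm_bound[OF i4] by simp
    also have "\<dots> \<le> (LINT x:?I|lborel. e / 2 * moll k s x)"
      by (rule set_integral_mono[OF set_integrable_abs[OF i4] i3 pt])
    also have "\<dots> = e / 2" using integral_moll[OF k(1), of s] by simp
    finally show "norm ((LINT x:A|lborel. g x * moll (real (Suc n)) s x) - g s) < e"
      using eq \<open>e > 0\<close> by (simp add: k_def)
  qed
qed

section \<open>Slices at fixed time and Fubini on the strip\<close>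

text \<open>A finite measure instead of set integrals over (0,L): constants are integrable, and the
  general lemmas on integrals apply to slices without indicator functions.\<close>

definition space_measure :: "real \<Rightarrow> real measure" where
  "space_measure L = restrict_space lborel {0<..<L}"

lemma space_space_measure [simp]: "space (space_measure L) = {0<..<L}"
  by (simp add: space_measure_def space_restrict_space)

lemma finite_measure_space_measure: "finite_measure (space_measure L)"
  unfolding space_measure_def
  by (rule finite_measureI, cases "0 \<le> L") (auto simp: space_restrict_space emeasure_restrict_space)

lemma measure_space_measure: "L > 0 \<Longrightarrow> measure (space_measure L) {0<..<L} = L"
  by (simp add: space_measure_def measure_restrict_space)

lemma integral_space_measure:
  fixes f :: "real \<Rightarrow> real"
  shows "integral\<^sup>L (space_measure L) f = (LINT x:{0<..<L}|lborel. f x)"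
  unfolding space_measure_def set_lebesgue_integral_def by (rule integral_restrict_space) simp

lemma integrable_space_measure:
  fixes f :: "real \<Rightarrow> real"
  shows "integrable (space_measure L) f \<longleftrightarrow> set_integrable lborel {0<..<L} f"
  unfolding space_measure_def set_integrable_def by (rule integrable_restrict_space) simp

lemma AE_space_measure:
  "(AE x in space_measure L. P x) \<longleftrightarrow> (AE x in lborel. x \<in> {0<..<L} \<longrightarrow> P x)"
  unfolding space_measure_def by (rule AE_restrict_space_iff) simp

lemma indicator_Times_mult: "indicator (A \<times> B) (t, x) = (indicator A t * indicator B x :: real)"
  by (simp add: indicator_times)

lemma strip_Fubini:
  fixes F :: "real \<times> real \<Rightarrow> real"
  assumes F: "set_integrable lborel (A \<times> {0<..<L}) F" and A: "A \<in> sets borel"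
  shows "set_integrable lborel A (\<lambda>t. \<integral>x. F (t, x) \<partial>space_measure L)" (is ?a)
    and "(LINT z:A \<times> {0<..<L}|lborel. F z) = (LINT t:A|lborel. \<integral>x. F (t, x) \<partial>space_measure L)" (is ?b)
    and "AE t in lborel. t \<in> A \<longrightarrow> integrable (space_measure L) (\<lambda>x. F (t, x))" (is ?c)
    and "integrable (space_measure L) (\<lambda>x. LINT t:A|lborel. F (t, x))" (is ?d)
    and "(LINT z:A \<times> {0<..<L}|lborel. F z) = (\<integral>x. (LINT t:A|lborel. F (t, x)) \<partial>space_measure L)" (is ?e)
proof -
  let ?G = "\<lambda>z. indicator (A \<times> {0<..<L}) z *\<^sub>R F z"
  have G: "integrable (lborel \<Otimes>\<^sub>M lborel) ?G"
    using F unfolding set_integrable_def lborel_prod .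
  have eta: "(\<lambda>(t, x). ?G (t, x)) = ?G" by auto
  have G': "integrable (lborel \<Otimes>\<^sub>M lborel) (\<lambda>(t, x). ?G (t, x))"
    unfolding eta using G .
  have 1: "(LINT x|lborel. ?G (t, x)) = indicator A t *\<^sub>R (\<integral>x. F (t, x) \<partial>space_measure L)" for t
    by (simp add: indicator_Times_mult integral_space_measure set_lebesgue_integral_def mult.assoc)
  have 2: "(LINT t|lborel. ?G (t, x)) = indicator {0<..<L} x *\<^sub>R (LINT t:A|lborel. F (t, x))" for x
  proof -
    have "?G (t, x) = indicator {0<..<L} x * (indicator A t * F (t, x))" for t
      by (simp add: indicator_Times_mult)
    then have "(LINT t|lborel. ?G (t, x)) = (LINT t|lborel. indicator {0<..<L} x * (indicator A t * F (t, x)))"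
      by (intro Bochner_Integration.integral_cong) auto
    then show ?thesis by (simp add: set_lebesgue_integral_def)
  qed
  show ?a using lborel_pair.integrable_fst'[OF G] unfolding 1 set_integrable_def .
  show ?b using lborel_pair.integral_fst'[OF G] unfolding 1 set_lebesgue_integral_def lborel_prod by simp
  show ?c using lborel_pair.AE_integrable_fst'[OF G]
    by eventually_elim (auto simp: indicator_Times_mult integrable_space_measure set_integrable_def mult.assoc)
  show ?d using lborel_pair.integrable_snd[OF G'] unfolding 2 integrable_space_measure set_integrable_def .
  show ?e using lborel_pair.integral_snd[OF G'] unfolding 2 eta integral_space_measure set_lebesgue_integral_def lborel_prod
    by simp
qed

lemma slice_measurable:
  fixes w :: "real \<times> real \<Rightarrow> real"
  assumes w: "set_borel_measurable lborel (A \<times> {0<..<L}) w" and t: "t \<in> A"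
  shows "(\<lambda>x. w (t, x)) \<in> borel_measurable (space_measure L)"
proof -
  have "(\<lambda>z. indicator (A \<times> {0<..<L}) z *\<^sub>R w z) \<in> borel_measurable (borel \<Otimes>\<^sub>M borel)"
    using w by (simp add: set_borel_measurable_def borel_prod)
  then have "(\<lambda>x. indicator (A \<times> {0<..<L}) (t, x) *\<^sub>R w (t, x)) \<in> borel_measurable borel"
    by (rule measurable_compose[rotated]) simp
  then have "(\<lambda>x. indicator {0<..<L} x *\<^sub>R w (t, x)) \<in> borel_measurable lborel"
    using t by (simp add: indicator_Times_mult)
  then show ?thesis
    unfolding space_measure_def by (subst borel_measurable_restrict_space_iff) auto
qed

lemma continuous_space_measure:
  fixes f :: "real \<Rightarrow> real"
  assumes "continuous_on {0..L} f"
  shows "f \<in> borel_measurable (space_measure L)" "integrable (space_measure L) f"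
proof -
  have "set_integrable lborel {0<..<L} f"
    by (rule set_integrable_subset[OF borel_integrable_atLeastAtMost'[OF assms]]) auto
  then show "integrable (space_measure L) f" by (simp add: integrable_space_measure)
  then show "f \<in> borel_measurable (space_measure L)" by (rule borel_measurable_integrable)
qed

lemma strip_integrable_bounded:
  fixes F :: "real \<times> real \<Rightarrow> real"
  assumes F: "set_borel_measurable lborel (A \<times> {0<..<L}) F"
    and A: "A \<in> sets borel" "emeasure lborel A < \<infinity>"
    and b: "AE z in lborel. z \<in> A \<times> {0<..<L} \<longrightarrow> \<bar>F z\<bar> \<le> K"
  shows "set_integrable lborel (A \<times> {0<..<L}) F"
  unfolding set_integrable_def
proof (rule integrableI_bounded_set[where A = "A \<times> {0<..<L}" and B = K])
  have s: "A \<times> {0<..<L} \<in> sets (borel \<Otimes>\<^sub>M borel)" using A by (intro pair_measureI) auto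
  then show "A \<times> {0<..<L} \<in> sets lborel" unfolding borel_prod by simp
  show "(\<lambda>z. indicator (A \<times> {0<..<L}) z *\<^sub>R F z) \<in> borel_measurable lborel"
    using F by (simp add: set_borel_measurable_def)
  have "emeasure (lborel \<Otimes>\<^sub>M lborel) (A \<times> {0<..<L}) = emeasure lborel A * emeasure lborel {0<..<L}"
    using A by (intro lborel.emeasure_pair_measure_Times) auto
  then show "emeasure lborel (A \<times> {0<..<L}) < \<infinity>"
    using A by (cases "0 \<le> L") (auto simp: lborel_prod ennreal_mult_less_top)
  show "AE z in lborel. z \<in> A \<times> {0<..<L} \<longrightarrow> norm (indicator (A \<times> {0<..<L}) z *\<^sub>R F z) \<le> K"
    using b by eventually_elim auto
  show "AE z in lborel. z \<notin> A \<times> {0<..<L} \<longrightarrow> indicator (A \<times> {0<..<L}) z *\<^sub>R F z = 0" by auto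
qed

lemma AE_strip:
  assumes "AE z in lborel. z \<in> A \<times> {0<..<L} \<longrightarrow> P z"
  shows "AE t in lborel. t \<in> A \<longrightarrow> (AE x in space_measure L. P (t, x))"
proof -
  have "AE t in lborel. AE x in lborel. (t, x) \<in> A \<times> {0<..<L} \<longrightarrow> P (t, x)"
    by (rule lborel_pair.AE_pair) (unfold lborel_prod, rule assms)
  then show ?thesis by eventually_elim (auto simp: AE_space_measure)
qed

section \<open>The potential and its subgradients\<close>

text \<open>The value 0 at the kinks is a convention; as a derivative of \<open>Pot\<close> it is
  used only where \<bar>m\<bar> differs from 1.\<close>

definition dPot :: "real \<Rightarrow> real \<Rightarrow> real" where
  "dPot k m = (if \<bar>m\<bar> < 1 then k\<^sup>2 * m else 0)"

lemma Pot_has_deriv: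
  assumes "\<bar>m\<bar> \<noteq> 1" shows "(Pot k has_real_derivative dPot k m) (at m)"
proof (cases "\<bar>m\<bar> < 1")
  case True
  have "((\<lambda>r. k\<^sup>2 * r\<^sup>2 / 2) has_real_derivative dPot k m) (at m)"
    using True by (auto intro!: derivative_eq_intros simp: dPot_def)
  then show ?thesis
    by (rule has_field_derivative_transform_within_open[of _ _ _ "{-1<..<1}"])
       (use True in \<open>auto simp: Pot_def\<close>)
next
  case False
  have "((\<lambda>r. k\<^sup>2 / 2) has_real_derivative dPot k m) (at m)" using False by (simp add: dPot_def)
  then show ?thesis
    by (rule has_field_derivative_transform_within_open[of _ _ _ "- {-1..1}"])
       (use False assms in \<open>auto simp: Pot_def\<close>)
qed

lemma deriv_Pot: "\<bar>r\<bar> \<noteq> 1 \<Longrightarrow> deriv (Pot k) r = dPot k r"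
  by (rule DERIV_imp_deriv[OF Pot_has_deriv])

lemma subdiff_Pot_cases:
  assumes "h \<in> subdiff_Pot k r"
  shows "\<bar>r\<bar> < 1 \<Longrightarrow> h = k\<^sup>2 * r" "\<bar>r\<bar> > 1 \<Longrightarrow> h = 0" "\<bar>h\<bar> \<le> k\<^sup>2"
proof -
  show 1: "h = k\<^sup>2 * r" if "\<bar>r\<bar> < 1"
    using assms that by (auto simp: subdiff_Pot_def deriv_Pot dPot_def split: if_splits)
  show 2: "h = 0" if "\<bar>r\<bar> > 1"
    using assms that by (auto simp: subdiff_Pot_def deriv_Pot dPot_def split: if_splits)
  consider "\<bar>r\<bar> < 1" | "\<bar>r\<bar> > 1" | "r = 1" | "r = -1" by linarith
  then show "\<bar>h\<bar> \<le> k\<^sup>2"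
  proof cases
    case 1
    then have "k\<^sup>2 * \<bar>r\<bar> \<le> k\<^sup>2 * 1" by (intro mult_left_mono) auto
    then show ?thesis using \<open>\<bar>r\<bar> < 1 \<Longrightarrow> h = k\<^sup>2 * r\<close>[OF 1] by (simp add: abs_mult)
  qed (use assms 2 in \<open>auto simp: subdiff_Pot_def\<close>)
qed

lemma continuous_Pot: "continuous_on A (Pot k)"
proof -
  have "Pot k = (\<lambda>r. k\<^sup>2 * min (r\<^sup>2) 1 / 2)"
    by (auto simp: Pot_def fun_eq_iff min_def abs_square_le_1)
  then show ?thesis by (auto intro!: continuous_intros)
qed

lemma Pot_le: "Pot k r \<le> k\<^sup>2 / 2" and Pot_nonneg: "0 \<le> Pot k r"
  using mult_left_mono[of "r\<^sup>2" 1 "k\<^sup>2"] by (auto simp: Pot_def abs_square_le_1)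

section \<open>Tools for testing the weak equation\<close>

text \<open>\<open>deriv stepf\<close> is nonnegative, so each of its zeros is a minimum.\<close>

lemma stepf_deriv2:
  assumes "x \<ge> 1" shows "deriv (deriv stepf) x = 0"
proof -
  have "(deriv stepf has_real_derivative deriv (deriv stepf) x) (at x)"
    by (intro smooth_has_deriv smooth_deriv stepf)
  then show ?thesis
    by (rule DERIV_local_min[of _ _ _ 1]) (use assms stepf_deriv in auto)
qed

text \<open>The primitive of \<open>stepf\<close> is a smooth version of max x 0. The constant
  \<open>c\<close> is the height lost while the slope grows from 0 to 1.\<close>

lemma ramp_exists:
  obtains R c where "smooth R" "\<And>x. (R has_real_derivative stepf x) (at x)"
    "\<And>x. x \<le> 0 \<Longrightarrow> R x = 0" "\<And>x. x \<ge> 1 \<Longrightarrow> R x = x - c" "\<And>x. \<bar>R x - max x 0\<bar> \<le> 1"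
proof -
  obtain R where R: "smooth R" "\<And>x. (R has_real_derivative stepf x) (at x)" "R 0 = 0"
    using smooth_antideriv[OF stepf(1)] by blast
  have mvt: "\<exists>z>x. z < y \<and> R y - R x = (y - x) * stepf z" if "x < y" for x y
    using MVT2[OF that R(2)] by blast
  have lo: "R x = 0" if le: "x \<le> 0" for x
    using mvt[of x 0] le R(3) by (cases "x = 0") (auto simp: stepf)
  have hi: "R x = x - (1 - R 1)" if ge: "x \<ge> 1" for x
    using mvt[of 1 x] ge by (cases "x = 1") (auto simp: stepf)
  have mid: "0 \<le> R x" "R x \<le> x" if x: "0 \<le> x" for x
  proof -
    have "0 \<le> R x \<and> R x \<le> x"
    proof (cases "x = 0")
      case False
      then obtain z where "R x = x * stepf z" using mvt[of 0 x] x R(3) by auto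
      then show ?thesis using stepf_bounds[of z] x by (simp add: mult_left_le)
    qed (use R in simp)
    then show "0 \<le> R x" "R x \<le> x" by auto
  qed
  have "\<bar>R x - max x 0\<bar> \<le> 1" for x
  proof -
    consider "x \<le> 0" | "0 \<le> x" "x \<le> 1" | "x \<ge> 1" by linarith
    then show ?thesis
      by cases (use lo[of x] mid[of x] hi[of x] mid[of 1] in \<open>auto simp: max_def\<close>)
  qed
  then show ?thesis using that[OF R(1,2) lo hi] by blast
qed

lemma set_integrable_mult_bounded:
  fixes F g :: "'a \<Rightarrow> real"
  assumes F: "set_integrable M A F" and g: "g \<in> borel_measurable M" and K: "\<And>x. \<bar>g x\<bar> \<le> K"
  shows "set_integrable M A (\<lambda>x. F x * g x)"
proof -
  have "integrable M (\<lambda>x. (indicator A x *\<^sub>R F x) * g x)"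
  proof (rule Bochner_Integration.integrable_bound)
    show "integrable M (\<lambda>x. K * (indicator A x *\<^sub>R F x))"
      using F by (simp add: set_integrable_def)
    show "(\<lambda>x. (indicator A x *\<^sub>R F x) * g x) \<in> borel_measurable M"
      using F g by (intro borel_measurable_times) (auto simp: set_integrable_def)
    have "\<bar>indicator A x *\<^sub>R F x\<bar> * \<bar>g x\<bar> \<le> \<bar>indicator A x *\<^sub>R F x\<bar> * \<bar>K\<bar>" for x
      by (intro mult_left_mono) (use K[of x] in auto)
    then show "AE x in M. norm ((indicator A x *\<^sub>R F x) * g x) \<le> norm (K * (indicator A x *\<^sub>R F x))"
      by (auto simp: abs_mult mult_ac)
  qed
  then show ?thesis by (simp add: set_integrable_def mult.assoc)
qed

lemma set_integral_dominated_convergence: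
  fixes f :: "'a \<Rightarrow> real" and g :: "nat \<Rightarrow> 'a \<Rightarrow> real"
  assumes f: "set_integrable M A f" and g: "\<And>n. g n \<in> borel_measurable M"
    and l: "\<And>x. x \<in> A \<Longrightarrow> (\<lambda>n. g n x) \<longlonglongrightarrow> l x" "l \<in> borel_measurable M"
    and b: "\<And>n x. x \<in> A \<Longrightarrow> \<bar>g n x\<bar> \<le> K"
  shows "(\<lambda>n. LINT x:A|M. f x * g n x) \<longlonglongrightarrow> (LINT x:A|M. f x * l x)"
  unfolding set_lebesgue_integral_def
proof (rule integral_dominated_convergence[where w = "\<lambda>x. norm (K * (indicator A x *\<^sub>R f x))"])
  have fm: "(\<lambda>x. indicator A x *\<^sub>R f x) \<in> borel_measurable M"
    using f by (simp add: set_integrable_def)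
  have "(\<lambda>x. (indicator A x *\<^sub>R f x) * l x) \<in> borel_measurable M"
    by (intro borel_measurable_times fm l)
  then show "(\<lambda>x. indicator A x *\<^sub>R (f x * l x)) \<in> borel_measurable M" by (simp add: mult.assoc)
  have "(\<lambda>x. (indicator A x *\<^sub>R f x) * g n x) \<in> borel_measurable M" for n
    by (intro borel_measurable_times fm g)
  then show "(\<lambda>x. indicator A x *\<^sub>R (f x * g n x)) \<in> borel_measurable M" for n by (simp add: mult.assoc)
  show "integrable M (\<lambda>x. norm (K * (indicator A x *\<^sub>R f x)))"
    using f by (intro integrable_norm) (simp add: set_integrable_def)
  show "AE x in M. (\<lambda>n. indicator A x *\<^sub>R (f x * g n x)) \<longlonglongrightarrow> indicator A x *\<^sub>R (f x * l x)"
  proof (intro AE_I2)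
    fix x show "(\<lambda>n. indicator A x *\<^sub>R (f x * g n x)) \<longlonglongrightarrow> indicator A x *\<^sub>R (f x * l x)"
      by (cases "x \<in> A") (auto intro!: tendsto_intros l)
  qed
  show "AE x in M. norm (indicator A x *\<^sub>R (f x * g n x)) \<le> norm (K * (indicator A x *\<^sub>R f x))" for n
  proof (intro AE_I2)
    fix x show "norm (indicator A x *\<^sub>R (f x * g n x)) \<le> norm (K * (indicator A x *\<^sub>R f x))"
    proof (cases "x \<in> A")
      case True
      have "\<bar>g n x\<bar> * \<bar>f x\<bar> \<le> \<bar>K\<bar> * \<bar>f x\<bar>"
        using b[OF True, of n] by (intro mult_right_mono) auto
      then show ?thesis using True by (simp add: abs_mult mult_ac)
    qed simp
  qed
qed

text \<open>The fundamental lemma of the calculus of variations: cutoffs converge boundedly to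
  indicators of intervals, which reduces it to \<open>AE_eq_0_of_interval_integrals\<close>.\<close>

lemma AE_eq_0_of_smooth_tests:
  fixes w :: "real \<Rightarrow> real"
  assumes w: "set_integrable lborel {0<..<L} w"
    and z: "\<And>a b \<eta>. 0 < a \<Longrightarrow> a \<le> b \<Longrightarrow> b < L \<Longrightarrow> smooth \<eta> \<Longrightarrow> (\<And>x. x \<notin> {a..b} \<Longrightarrow> \<eta> x = 0) \<Longrightarrow>
      (LINT x:{0<..<L}|lborel. w x * \<eta> x) = 0"
  shows "AE x in space_measure L. w x = 0"
proof -
  have "AE x in lborel. x \<in> {0<..<L} \<longrightarrow> w x = 0"
  proof (rule AE_eq_0_of_interval_integrals[OF w])
    fix a b assume ab: "0 < a" "a < b" "b < L"
    let ?b = "\<lambda>n x. cutoff (real (Suc n)) a b x"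
    have bm: "?b n \<in> borel_measurable lborel" for n using smooth_borel[OF smooth_cutoff] by simp
    have l1: "(\<lambda>n. LINT x:{0<..<L}|lborel. w x * ?b n x) \<longlonglongrightarrow> (LINT x:{0<..<L}|lborel. w x * indicator {a<..b} x)"
    proof (rule set_integral_dominated_convergence[OF w bm, where K = 1])
      show "(\<lambda>n. ?b n x) \<longlonglongrightarrow> indicator {a<..b} x" for x using ab by (intro cutoff_tendsto) auto
      show "\<bar>?b n x\<bar> \<le> 1" for n x using cutoff_bounds[of "real (Suc n)" a b x] ab by simp
    qed simp
    \<comment> \<open>The support of the cutoff extends to b + 1 / Suc n, so it stays inside (0,L)
      only for large n.\<close>
    obtain N where N: "1 / real (Suc N) < L - b" using ab nat_approx_posE[of "L - b"] by auto
    have ev: "eventually (\<lambda>n. (LINT x:{0<..<L}|lborel. w x * ?b n x) = 0) sequentially"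
    proof (rule eventually_sequentiallyI[of N])
      fix n assume "n \<ge> N"
      then have "1 / real (Suc n) \<le> 1 / real (Suc N)" by (simp add: frac_le)
      then have n: "b + 1 / real (Suc n) < L" using N by linarith
      show "(LINT x:{0<..<L}|lborel. w x * ?b n x) = 0"
      proof (rule z[OF ab(1) _ n smooth_cutoff])
        show "a \<le> b + 1 / real (Suc n)" using ab by (simp add: add_increasing2)
        show "?b n x = 0" if "x \<notin> {a..b + 1 / real (Suc n)}" for x
          using cutoff_outside[OF _ _ that] ab by simp
      qed
    qed
    have "(LINT x:{0<..<L}|lborel. w x * indicator {a<..b} x) = 0"
      using LIMSEQ_unique[OF l1 tendsto_eventually[OF ev]] .
    moreover have "indicator {a<..b} x *\<^sub>R w x = indicator {0<..<L} x *\<^sub>R (w x * indicator {a<..b} x)" for x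
      using ab by (auto simp: indicator_def)
    ultimately show "(LINT x:{a<..b}|lborel. w x) = 0"
      by (simp only: set_lebesgue_integral_def)
  qed
  then show ?thesis by (simp add: AE_space_measure)
qed

lemma borel_measurable_fst_snd:
  fixes f :: "real \<Rightarrow> real"
  assumes "f \<in> borel_measurable borel"
  shows "(\<lambda>z :: real \<times> real. f (fst z)) \<in> borel_measurable lborel"
    and "(\<lambda>z :: real \<times> real. f (snd z)) \<in> borel_measurable lborel"
proof -
  have "fst \<in> borel_measurable (borel :: (real \<times> real) measure)"
    "snd \<in> borel_measurable (borel :: (real \<times> real) measure)"
    by (intro borel_measurable_continuous_onI continuous_intros)+
  then show "(\<lambda>z :: real \<times> real. f (fst z)) \<in> borel_measurable lborel"
    "(\<lambda>z :: real \<times> real. f (snd z)) \<in> borel_measurable lborel"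
    using measurable_compose[OF _ assms] by auto
qed

lemma integral_space_measure_eq_integral:
  fixes f :: "real \<Rightarrow> real"
  assumes "continuous_on {0..L} f"
  shows "integral\<^sup>L (space_measure L) f = integral {0..L} f"
proof -
  have "(LINT x:{0<..<L}|lborel. f x) = integral {0<..<L} f"
    by (rule set_borel_integral_eq_integral)
       (rule set_integrable_subset[OF borel_integrable_atLeastAtMost'[OF assms]], auto)
  then show ?thesis by (simp add: integral_space_measure integral_open_interval_real)
qed

lemma strip_part:
  assumes "A \<in> sets borel" "A \<subseteq> {0<..}"
  shows "A \<times> {0<..<L} \<subseteq> strip L" "A \<times> {0<..<L} \<in> sets lborel"
proof -
  show "A \<times> {0<..<L} \<subseteq> strip L" using assms by (auto simp: strip_def)
  have "A \<times> {0<..<L} \<in> sets (borel \<Otimes>\<^sub>M borel)" using assms by (intro pair_measureI) auto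
  then show "A \<times> {0<..<L} \<in> sets lborel" unfolding borel_prod by simp
qed

lemma finite_time: "emeasure lborel {a<..b::real} < \<infinity>"
  by (cases "a \<le> b") auto

text \<open>Passage to a window of finite length, the only kind on which \<open>u\<close>,
  \<open>ut\<close>, \<open>uxx\<close> and \<open>h\<close> are shown to be integrable.\<close>

lemma LINT_strip_cut:
  fixes T :: real
  assumes "\<And>t x. t > T \<Longrightarrow> F (t, x) = (0::real)"
  shows "(LINT z:strip L|lborel. F z) = (LINT z:{0<..T} \<times> {0<..<L}|lborel. F z)"
proof -
  have "indicator (strip L) z *\<^sub>R F z = indicator ({0<..T} \<times> {0<..<L}) z *\<^sub>R F z" for z
    using assms[of "fst z" "snd z"]
    by (cases "fst z > T") (auto simp: indicator_def strip_def mem_Times_iff)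
  then show ?thesis by (simp only: set_lebesgue_integral_def)
qed

lemma L2_space_measure_integrable:
  fixes f :: "real \<Rightarrow> real"
  assumes L: "L > 0" and f: "f \<in> borel_measurable (space_measure L)"
    "integrable (space_measure L) (\<lambda>x. (f x)\<^sup>2)"
  shows "integrable (space_measure L) f"
    and "(\<integral>x. \<bar>f x\<bar> \<partial>space_measure L) \<le> L + (\<integral>x. (f x)\<^sup>2 \<partial>space_measure L)"
proof -
  interpret X: finite_measure "space_measure L" by (rule finite_measure_space_measure)
  have b: "\<bar>f x\<bar> \<le> 1 + (f x)\<^sup>2" for x
    using sum_squares_bound[of 1 "\<bar>f x\<bar>"] by (simp add: power2_eq_square)
  have i: "integrable (space_measure L) (\<lambda>x. 1 + (f x)\<^sup>2)" using f by simp
  show 1: "integrable (space_measure L) f"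
    by (rule Bochner_Integration.integrable_bound[OF i f(1)]) (use b in auto)
  have "(\<integral>x. \<bar>f x\<bar> \<partial>space_measure L) \<le> (\<integral>x. 1 + (f x)\<^sup>2 \<partial>space_measure L)"
    by (rule integral_mono) (use 1 i b in auto)
  also have "\<dots> = L + (\<integral>x. (f x)\<^sup>2 \<partial>space_measure L)"
    using f L by (simp add: measure_space_measure)
  finally show "(\<integral>x. \<bar>f x\<bar> \<partial>space_measure L) \<le> L + (\<integral>x. (f x)\<^sup>2 \<partial>space_measure L)" .
qed

text \<open>By \<bar>w\<bar> \<le> 1 + w^2 almost every slice has L1 norm at most L + M, and the
  time window has finite length; Fubini does the rest.\<close>

lemma Linf_L2_integrable:
  assumes L: "L > 0" and w: "Linf_L2 {0<..} L w" and a: "a \<ge> 0"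
  shows "set_integrable lborel ({a<..b} \<times> {0<..<L}) w"
proof -
  let ?A = "{a<..b}"
  let ?X = "space_measure L"
  let ?G = "\<lambda>z. indicator (?A \<times> {0<..<L}) z *\<^sub>R w z"
  have wm: "set_borel_measurable lborel ({0<..} \<times> {0<..<L}) w" using w by (simp add: Linf_L2_def)
  obtain M where M: "AE t in lborel. t > 0 \<longrightarrow>
      integrable ?X (\<lambda>x. (w (t, x))\<^sup>2) \<and> (\<integral>x. (w (t, x))\<^sup>2 \<partial>?X) \<le> M"
    using w by (auto simp: Linf_L2_def integrable_space_measure integral_space_measure)
  have A: "?A \<subseteq> {0<..}" using a by auto
  have "set_borel_measurable lborel (?A \<times> {0<..<L}) w"
    by (rule set_borel_measurable_subset[OF wm strip_part(2)]) (use A in auto)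
  then have Gm: "?G \<in> borel_measurable (lborel \<Otimes>\<^sub>M lborel)"
    unfolding lborel_prod set_borel_measurable_def .
  have si: "integrable ?X (\<lambda>x. w (t, x)) \<and> (\<integral>x. \<bar>w (t, x)\<bar> \<partial>?X) \<le> L + M"
    if "t \<in> ?A" "t > 0 \<longrightarrow> integrable ?X (\<lambda>x. (w (t, x))\<^sup>2) \<and> (\<integral>x. (w (t, x))\<^sup>2 \<partial>?X) \<le> M" for t
    using L2_space_measure_integrable[OF L slice_measurable[OF wm, of t]] that a by force
  have eq: "(LINT x|lborel. norm (?G (t, x))) = indicator ?A t * (\<integral>x. \<bar>w (t, x)\<bar> \<partial>?X)" for t
    by (simp add: indicator_Times_mult integral_space_measure set_lebesgue_integral_def abs_mult mult.assoc)
  have "integrable (lborel \<Otimes>\<^sub>M lborel) ?G"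
  proof (rule lborel_pair.Fubini_integrable[OF Gm])
    show "integrable lborel (\<lambda>t. LINT x|lborel. norm (?G (t, x)))"
    proof (rule integrableI_bounded_set[where A = ?A and B = "L + M"])
      show "(\<lambda>t. LINT x|lborel. norm (?G (t, x))) \<in> borel_measurable lborel"
        using Gm by (intro lborel.borel_measurable_lebesgue_integral) (simp add: split_beta')
      show "AE t in lborel. t \<in> ?A \<longrightarrow> norm (LINT x|lborel. norm (?G (t, x))) \<le> L + M"
        unfolding eq using M
      proof eventually_elim
        case (elim t)
        then show ?case using si[of t] by auto
      qed
      show "AE t in lborel. t \<notin> ?A \<longrightarrow> (LINT x|lborel. norm (?G (t, x))) = 0"
        unfolding eq by simp
    qed (use finite_time in auto)
    show "AE t in lborel. integrable lborel (\<lambda>x. ?G (t, x))"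
      using M
    proof eventually_elim
      case (elim t)
      show ?case
      proof (cases "t \<in> ?A")
        case True
        then have "integrable ?X (\<lambda>x. w (t, x))" using si elim by blast
        then show ?thesis
          using True by (simp add: integrable_space_measure set_integrable_def indicator_Times_mult)
      qed (simp add: indicator_Times_mult)
    qed
  qed
  then show ?thesis unfolding set_integrable_def lborel_prod .
qed

text \<open>Smooth versions of r \<mapsto> max 0 (t - r), whose second derivative is a unit mass at
  \<open>t\<close>. Testing an equation of second order in time with them therefore returns the
  value at time \<open>t\<close>, with the initial velocity multiplied by approximately t and the
  initial value by 1. On r \<ge> 0 they arise from max 0 (t - r) = max 0 (r - t) - r + t; on [-1,0],
  outside the strip, they are switched off smoothly.\<close>

lemma time_tests:
  assumes t: "t \<ge> 0"
  obtains \<theta> c where "\<And>n. smooth (\<theta> n)"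
    "\<And>n r. r \<notin> {-1..t + 1 / real (Suc n)} \<Longrightarrow> \<theta> n r = 0"
    "\<And>n r. r > 0 \<Longrightarrow> deriv (deriv (\<theta> n)) r = moll (real (Suc n)) t r"
    "\<And>n r. r \<ge> 0 \<Longrightarrow> \<bar>\<theta> n r - max 0 (t - r)\<bar> \<le> 2 / real (Suc n)"
    "\<And>n. \<theta> n 0 = t + c / real (Suc n)" "\<And>n. deriv (\<theta> n) 0 = -1"
proof -
  obtain R c where R: "smooth R" "\<And>x. (R has_real_derivative stepf x) (at x)"
    "\<And>x. x \<le> 0 \<Longrightarrow> R x = 0" "\<And>x. x \<ge> 1 \<Longrightarrow> R x = x - c" "\<And>x. \<bar>R x - max x 0\<bar> \<le> 1"
    using ramp_exists by blast
  have c: "\<bar>c\<bar> \<le> 1" using R(4)[of 1] R(5)[of 1] by simp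
  define \<theta> where "\<theta> n r = (1 / real (Suc n)) * R (real (Suc n) * r + (- real (Suc n) * t))
    - R (1 * r + 1) + (t + 1 + c / real (Suc n) - c) * stepf (1 * r + 1)" for n r
  \<comment> \<open>the coefficient of the last term is chosen so that \<open>\<theta> n\<close> vanishes beyond \<open>t + 1 / Suc n\<close>\<close>
  have \<theta>s: "smooth (\<theta> n)" for n
    unfolding \<theta>_def by (intro smooth_add smooth_diff smooth_cmult smooth_affine R(1) stepf)
  have ND: "((\<lambda>x. a * x + b) has_real_derivative a) (at x)" for a b x :: real
    by (auto intro!: derivative_eq_intros)
  have \<theta>0: "\<theta> n r = 0" if r: "r \<notin> {-1..t + 1 / real (Suc n)}" for n r
  proof -
    define N where "N = real (Suc n)"
    have N: "N > 0" by (simp add: N_def)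
    consider "r < -1" | "r > t + 1 / N" using r unfolding N_def by fastforce
    then show ?thesis
    proof cases
      case 1
      then have "N * r \<le> N * t" using N t by (intro mult_left_mono) auto
      then show ?thesis using 1 unfolding \<theta>_def N_def[symmetric] by (simp add: R stepf)
    next
      case 2
      have "1 / N > 0" using N by simp
      then have r0: "r \<ge> 0" using 2 t by linarith
      have "N * r + (- N * t) \<ge> 1" using 2 N by (simp add: field_simps)
      note 2 = this r0
      show ?thesis
        unfolding \<theta>_def N_def[symmetric] using 2 N by (simp add: R(4) stepf field_simps)
    qed
  qed
  have \<theta>1: "deriv (\<theta> n) = (\<lambda>r. stepf (real (Suc n) * r + (- real (Suc n) * t)) - stepf (1 * r + 1)
      + (t + 1 + c / real (Suc n) - c) * deriv stepf (1 * r + 1))" for n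
  proof (intro ext DERIV_imp_deriv)
    fix r
    have "((\<lambda>r. (1 / real (Suc n)) * R (real (Suc n) * r + (- real (Suc n) * t))) has_real_derivative
      (1 / real (Suc n)) * (stepf (real (Suc n) * r + (- real (Suc n) * t)) * real (Suc n))) (at r)"
      by (intro DERIV_cmult DERIV_chain2[OF R(2) ND])
    then have "((\<lambda>r. (1 / real (Suc n)) * R (real (Suc n) * r + (- real (Suc n) * t))) has_real_derivative
      stepf (real (Suc n) * r + (- real (Suc n) * t))) (at r)" by simp
    moreover have "((\<lambda>r. R (1 * r + 1)) has_real_derivative stepf (1 * r + 1) * 1) (at r)"
      by (rule DERIV_chain2[OF R(2) ND])
    moreover have "((\<lambda>r. stepf (1 * r + 1)) has_real_derivative deriv stepf (1 * r + 1) * 1) (at r)"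
      by (rule DERIV_chain2[OF smooth_has_deriv[OF stepf(1)] ND])
    ultimately show "(\<theta> n has_real_derivative stepf (real (Suc n) * r + (- real (Suc n) * t)) - stepf (1 * r + 1)
      + (t + 1 + c / real (Suc n) - c) * deriv stepf (1 * r + 1)) (at r)"
      unfolding \<theta>_def mult_1_right by (intro DERIV_add DERIV_diff DERIV_cmult)
  qed
  have \<theta>2: "deriv (deriv (\<theta> n)) r = moll (real (Suc n)) t r" if "r > 0" for n r
  proof (rule DERIV_imp_deriv)
    have "((\<lambda>r. stepf (1 * r + 1)) has_real_derivative deriv stepf (1 * r + 1) * 1) (at r)"
      by (rule DERIV_chain2[OF smooth_has_deriv[OF stepf(1)] ND])
    moreover have "((\<lambda>r. deriv stepf (1 * r + 1)) has_real_derivative deriv (deriv stepf) (1 * r + 1) * 1) (at r)"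
      by (rule DERIV_chain2[OF smooth_has_deriv[OF smooth_deriv[OF stepf(1)]] ND])
    ultimately have "((\<lambda>r. stepf (real (Suc n) * r + (- real (Suc n) * t)) - stepf (1 * r + 1)
      + (t + 1 + c / real (Suc n) - c) * deriv stepf (1 * r + 1)) has_real_derivative
      moll (real (Suc n)) t r - deriv stepf (1 * r + 1) * 1
      + (t + 1 + c / real (Suc n) - c) * (deriv (deriv stepf) (1 * r + 1) * 1)) (at r)"
      by (intro DERIV_add DERIV_diff DERIV_cmult moll_has_deriv)
    then show "(deriv (\<theta> n) has_real_derivative moll (real (Suc n)) t r) (at r)"
      unfolding \<theta>1 using that by (simp add: stepf_deriv stepf_deriv2)
  qed
  \<comment> \<open>For r \<ge> 0 the terms \<open>R (1 * r + 1)\<close> and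
    \<open>stepf (1 * r + 1)\<close> have become r + 1 - c and 1, and the two unscaled constants c
    cancel.\<close>
  have \<theta>val: "\<theta> n r = R (real (Suc n) * (r - t)) / real (Suc n) - r + t + c / real (Suc n)" if "r \<ge> 0" for n r
    unfolding \<theta>_def using that by (simp add: R(4) stepf algebra_simps)
  have \<theta>err: "\<bar>\<theta> n r - max 0 (t - r)\<bar> \<le> 2 / real (Suc n)" if "r \<ge> 0" for n r
  proof -
    define N where "N = real (Suc n)"
    have N: "N > 0" by (simp add: N_def)
    define y where "y = R (N * (r - t)) - max (N * (r - t)) 0"
    have mx: "max (N * (r - t)) 0 = N * (max 0 (t - r) - (t - r))"
      using N by (auto simp: max_def mult_le_0_iff algebra_simps zero_le_mult_iff)
    have "R (N * (r - t)) / N = y / N + (max 0 (t - r) - (t - r))"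
      using N unfolding y_def mx by (simp add: field_simps)
    then have "\<theta> n r - max 0 (t - r) = (y + c) / N"
      unfolding \<theta>val[OF that] N_def[symmetric] by (simp add: add_divide_distrib)
    moreover have "\<bar>y + c\<bar> \<le> 2" using R(5)[of "N * (r - t)"] c unfolding y_def by linarith
    ultimately show ?thesis using N unfolding N_def[symmetric] by (simp add: divide_right_mono)
  qed
  have "\<theta> n 0 = t + c / real (Suc n)" for n
    using \<theta>val[of 0 n] t by (simp add: R(3) mult_nonneg_nonpos)
  moreover have "deriv (\<theta> n) 0 = -1" for n
    unfolding \<theta>1 using t by (simp add: stepf stepf_deriv mult_nonpos_nonneg)
  ultimately show ?thesis using that[OF \<theta>s \<theta>0 \<theta>2 \<theta>err] by blast
qed

lemma zero_of_integral_square: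
  fixes f :: "real \<Rightarrow> real"
  assumes L: "L > 0" and f: "continuous_on {0..L} f" "x \<in> {0..L}" and z: "(\<integral>x. (f x)\<^sup>2 \<partial>space_measure L) = 0"
  shows "f x = 0"
proof -
  have c: "continuous_on (cbox 0 L) (\<lambda>x. (f x)\<^sup>2)" using f(1) by (auto intro!: continuous_intros)
  have "integral {0..L} (\<lambda>x. (f x)\<^sup>2) = 0"
    using z integral_space_measure_eq_integral c by simp
  then have "((\<lambda>x. (f x)\<^sup>2) has_integral 0) (cbox 0 L)"
    using integrable_integral[OF integrable_continuous[OF c]] by simp
  then have "(f x)\<^sup>2 = 0"
    using has_integral_0_cbox_imp_0[OF c, of x] f(2) L by simp
  then show ?thesis by simp
qed

subsection \<open>Solutions in energy form\<close>

text \<open>Fixes representatives \<open>ut\<close>, \<open>uxx\<close> and a selection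
  \<open>h\<close> for constant initial data. The energy inequality appears after the nonnegative
  bending energy has been dropped on the left, with the energy of the constant data evaluated on the
  right.\<close>

locale beam =
  fixes L \<kappa>1 \<kappa> v0 v1 :: real and u ut uxx h :: "real \<times> real \<Rightarrow> real"
  assumes L: "L > 0"
    and u_cont: "continuous_on ({0..} \<times> {0..L}) u"
    and ut_Linf: "Linf_L2 {0<..} L ut"
    and uxx_Linf: "Linf_L2 {0<..} L uxx"
    and h_meas: "set_borel_measurable lborel (strip L) h"
    and ut_weak: "weak_dt L u ut"
    and h_subdiff: "AE z in lborel. z \<in> strip L \<longrightarrow> h z \<in> subdiff_Pot \<kappa> (u z)"
    and weak: "test_fun \<phi> \<Longrightarrow> \<forall>t. pd_x \<phi> (t, 0) = 0 \<and> pd_x \<phi> (t, L) = 0 \<Longrightarrow>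
      (LINT z:strip L|lborel.
         u z * pd_t (pd_t \<phi>) z + \<kappa>1\<^sup>2 * uxx z * pd_x (pd_x \<phi>) z + h z * \<phi> z)
      - (LINT x:{0<..<L}|lborel. v1 * \<phi> (0, x))
      + (LINT x:{0<..<L}|lborel. v0 * pd_t \<phi> (0, x)) = 0"
    and energy: "AE t in lborel. t > 0 \<longrightarrow>
      (\<integral>x. (ut (t, x))\<^sup>2 / 2 + Pot \<kappa> (u (t, x)) \<partial>space_measure L) \<le> L * (v1\<^sup>2 / 2 + Pot \<kappa> v0)"
begin

abbreviation "X \<equiv> space_measure L"

sublocale X: finite_measure X
  by (rule finite_measure_space_measure)

lemma integral_X_const: "(\<integral>x. c \<partial>X) = c * L" for c :: real
  using measure_space_measure[OF L] by simp

lemma ut_meas: "set_borel_measurable lborel (strip L) ut"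
  using ut_Linf by (simp add: Linf_L2_def strip_def)

lemma ut_L2: "\<exists>M. AE t in lborel. t > 0 \<longrightarrow>
    integrable X (\<lambda>x. (ut (t, x))\<^sup>2) \<and> (\<integral>x. (ut (t, x))\<^sup>2 \<partial>X) \<le> M"
  using ut_Linf by (simp add: Linf_L2_def integrable_space_measure integral_space_measure)

lemma slice_cont: "t \<ge> 0 \<Longrightarrow> continuous_on {0..L} (\<lambda>x. u (t, x))"
  by (rule continuous_on_compose2[OF u_cont]) (auto intro!: continuous_intros)

lemma param_cont:
  assumes "continuous_on {0..L} \<zeta>"
  shows "continuous_on {0..} (\<lambda>t. \<integral>x. u (t, x) * \<zeta> x \<partial>X)"
proof -
  have "continuous_on ({0..} \<times> cbox 0 L) (\<lambda>(t, x). u (t, x) * \<zeta> x)"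
    unfolding case_prod_beta
    by (intro continuous_on_mult continuous_on_compose2[OF u_cont] continuous_on_compose2[OF assms])
       (auto intro!: continuous_intros)
  then have "continuous_on {0..} (\<lambda>t. integral (cbox 0 L) (\<lambda>x. u (t, x) * \<zeta> x))"
    by (rule integral_continuous_on_param)
  moreover have "(\<integral>x. u (t, x) * \<zeta> x \<partial>X) = integral (cbox 0 L) (\<lambda>x. u (t, x) * \<zeta> x)" if "t \<ge> 0" for t
    using integral_space_measure_eq_integral[OF continuous_on_mult[OF slice_cont[OF that] assms]] by simp
  ultimately show ?thesis by (simp cong: continuous_on_cong_simp)
qed

lemma u_meas:
  assumes "A \<in> sets borel" "A \<subseteq> {0<..}"
  shows "set_borel_measurable lborel (A \<times> {0<..<L}) u"
proof -
  have "A \<times> {0<..<L} \<in> sets borel" using strip_part[OF assms] by simp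
  moreover have "continuous_on (A \<times> {0<..<L}) u"
    by (rule continuous_on_subset[OF u_cont]) (use assms in auto)
  ultimately show ?thesis
    unfolding set_borel_measurable_def
    by (simp add: borel_measurable_continuous_on_indicator del: real_scaleR_def)
qed

lemma h_meas_part:
  assumes "A \<in> sets borel" "A \<subseteq> {0<..}"
  shows "set_borel_measurable lborel (A \<times> {0<..<L}) h"
  using set_borel_measurable_subset[OF h_meas] strip_part[OF assms] by auto

lemma u_bounded: "\<exists>K. \<forall>t\<in>{0..T}. \<forall>x\<in>{0..L}. \<bar>u (t, x)\<bar> \<le> K"
proof -
  have "compact (u ` ({0..T} \<times> {0..L}))"
    by (intro compact_continuous_image continuous_on_subset[OF u_cont] compact_Times) auto
  then obtain K where "\<forall>y\<in>u ` ({0..T} \<times> {0..L}). norm y \<le> K"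
    using compact_imp_bounded bounded_iff by blast
  then show ?thesis by (intro exI[of _ K]) auto
qed

lemma u_integrable: "a \<ge> 0 \<Longrightarrow> set_integrable lborel ({a<..b} \<times> {0<..<L}) u"
proof -
  assume a: "a \<ge> 0"
  obtain K where K: "\<forall>t\<in>{0..b}. \<forall>x\<in>{0..L}. \<bar>u (t, x)\<bar> \<le> K" using u_bounded by blast
  show ?thesis
    by (rule strip_integrable_bounded[OF u_meas _ finite_time, where K = K]) (use a K in auto)
qed

lemma h_bounded: "AE z in lborel. z \<in> strip L \<longrightarrow> \<bar>h z\<bar> \<le> \<kappa>\<^sup>2"
  using h_subdiff by eventually_elim (use subdiff_Pot_cases(3) in blast)

lemma h_integrable: "a \<ge> 0 \<Longrightarrow> set_integrable lborel ({a<..b} \<times> {0<..<L}) h"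
proof -
  assume a: "a \<ge> 0"
  have "AE z in lborel. z \<in> {a<..b} \<times> {0<..<L} \<longrightarrow> \<bar>h z\<bar> \<le> \<kappa>\<^sup>2"
    using h_bounded by eventually_elim (use a in \<open>auto simp: strip_def\<close>)
  then show ?thesis
    by (intro strip_integrable_bounded[OF h_meas_part _ finite_time]) (use a in auto)
qed

lemma ut_slice_meas: "t > 0 \<Longrightarrow> (\<lambda>x. ut (t, x)) \<in> borel_measurable X"
  by (rule slice_measurable[of "{0<..}"]) (use ut_meas in \<open>auto simp: strip_def\<close>)

lemma h_slice_meas: "t > 0 \<Longrightarrow> (\<lambda>x. h (t, x)) \<in> borel_measurable X"
  by (rule slice_measurable[of "{0<..}"]) (use h_meas in \<open>auto simp: strip_def\<close>)

lemma ut_slice_integrable: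
  assumes "t > 0" "integrable X (\<lambda>x. (ut (t, x))\<^sup>2)"
  shows "integrable X (\<lambda>x. ut (t, x))"
  by (rule L2_space_measure_integrable(1)[OF L ut_slice_meas[OF assms(1)] assms(2)])

lemma ut_integrable: "a \<ge> 0 \<Longrightarrow> set_integrable lborel ({a<..b} \<times> {0<..<L}) ut"
  by (rule Linf_L2_integrable[OF L ut_Linf])

lemma uxx_integrable: "a \<ge> 0 \<Longrightarrow> set_integrable lborel ({a<..b} \<times> {0<..<L}) uxx"
  by (rule Linf_L2_integrable[OF L uxx_Linf])


section \<open>Increments of the solution in time\<close>

text \<open>The weak time derivative is tested with a cutoff of \<open>{s<..t}\<close> in time
  multiplied by \<open>\<eta>\<close>. The time derivative of the cutoff is a difference of
  mollifiers at \<open>s\<close> and \<open>t\<close>, which picks out the two slices in the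
  limit.\<close>

lemma weak_increment_smooth:
  assumes st: "0 < s" "s < t" and ab: "0 < a" "a \<le> b" "b < L"
    and \<eta>: "smooth \<eta>" "\<And>x. x \<notin> {a..b} \<Longrightarrow> \<eta> x = 0"
  shows "(\<integral>x. u (t, x) * \<eta> x \<partial>X) - (\<integral>x. u (s, x) * \<eta> x \<partial>X)
    = (LINT z:{s<..t} \<times> {0<..<L}|lborel. ut z * \<eta> (snd z))"
proof -
  define \<psi> where "\<psi> r = (\<integral>x. u (r, x) * \<eta> x \<partial>X)" for r
  \<comment> \<open>The cutoffs reach up to t + 1 / Suc n, so one window of finite length serves all
    n.\<close>
  define T where "T = t + 1"
  let ?A = "{0<..T}"
  have \<psi>: "continuous_on {0..} \<psi>"
    unfolding \<psi>_def by (intro param_cont smooth_cont \<eta>)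
  obtain K where K: "\<And>x. \<bar>\<eta> x\<bar> \<le> K" using smooth_bounded[OF \<eta>] by blast
  have \<eta>m[measurable]: "\<eta> \<in> borel_measurable borel" by (intro smooth_borel \<eta>)
  have id: "(LINT r:?A|lborel. \<psi> r * moll (real (Suc n)) s r) - (LINT r:?A|lborel. \<psi> r * moll (real (Suc n)) t r)
     = - (LINT z:?A \<times> {0<..<L}|lborel. ut z * (cutoff (real (Suc n)) s t (fst z) * \<eta> (snd z)))" for n
  proof -
    define N where "N = real (Suc n)"
    have N: "N > 0" "1 / N \<le> 1" by (auto simp: N_def)
    define m where "m r = moll N s r - moll N t r" for r
    have m: "smooth m" unfolding m_def by (intro smooth_diff smooth_moll)
    have m0: "m r = 0" if "r \<notin> {s..t + 1 / N}" for r
      using moll_outside[OF N(1), of r s] moll_outside[OF N(1), of r t] that st N unfolding m_def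
      by (smt (verit) atLeastAtMost_iff greaterThanLessThan_iff)
    have nT: "t + 1 / N \<le> T" using N(2) unfolding T_def by linarith
    have mT: "m r = 0" if "r > T" for r
      using that nT by (intro m0) auto
    obtain Km where Km: "\<And>r. \<bar>m r\<bar> \<le> Km" using smooth_bounded[OF m m0] by blast
    have mm[measurable]: "m \<in> borel_measurable borel" by (intro smooth_borel m)
    let ?\<phi> = "\<lambda>z. cutoff N s t (fst z) * \<eta> (snd z)"
    have b0: "cutoff N s t r = 0" if "r \<notin> {s..t + 1 / N}" for r
      using cutoff_outside[OF N(1) _ that] st by simp
    have bT: "cutoff N s t r = 0" if "r > T" for r
      using that nT by (intro b0) auto
    have d: "deriv (cutoff N s t) = m"
      by (auto simp: m_def intro!: DERIV_imp_deriv cutoff_has_deriv)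
    have "test_fun ?\<phi>" by (rule test_fun_prod[OF smooth_cutoff \<eta>(1) b0 \<eta>(2)])
    moreover have "closure {z. ?\<phi> z \<noteq> 0} \<subseteq> strip L"
      using support_prod[OF b0 \<eta>(2)] by (rule order_trans) (use st ab in \<open>auto simp: strip_def\<close>)
    ultimately have "(LINT z:strip L|lborel. u z * pd_t ?\<phi> z) = - (LINT z:strip L|lborel. ut z * ?\<phi> z)"
      using ut_weak unfolding weak_dt_def by blast
    moreover have "pd_t ?\<phi> = (\<lambda>z. m (fst z) * \<eta> (snd z))"
      using pd_t_prod[OF smooth_cutoff, of N s t \<eta>] unfolding d .
    moreover have "(LINT z:strip L|lborel. u z * (m (fst z) * \<eta> (snd z)))
        = (LINT z:?A \<times> {0<..<L}|lborel. u z * (m (fst z) * \<eta> (snd z)))"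
      by (rule LINT_strip_cut) (use mT in auto)
    moreover have "(LINT z:strip L|lborel. ut z * ?\<phi> z) = (LINT z:?A \<times> {0<..<L}|lborel. ut z * ?\<phi> z)"
      by (rule LINT_strip_cut) (use bT in auto)
    moreover have "(LINT z:?A \<times> {0<..<L}|lborel. u z * (m (fst z) * \<eta> (snd z)))
        = (LINT r:?A|lborel. \<integral>x. u (r, x) * (m r * \<eta> x) \<partial>X)"
    proof -
      have "set_integrable lborel (?A \<times> {0<..<L}) (\<lambda>z. u z * (m (fst z) * \<eta> (snd z)))"
      proof (rule set_integrable_mult_bounded[OF u_integrable, where K = "Km * K"])
        show "(\<lambda>z. m (fst z) * \<eta> (snd z)) \<in> borel_measurable lborel"
          by (intro borel_measurable_times borel_measurable_fst_snd mm \<eta>m)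
        show "\<bar>m (fst z) * \<eta> (snd z)\<bar> \<le> Km * K" for z
          unfolding abs_mult using Km[of "fst z"] K[of "snd z"]
          by (intro mult_mono) auto
      qed simp
      from strip_Fubini(2)[OF this] show ?thesis by simp
    qed
    moreover have "(\<integral>x. u (r, x) * (m r * \<eta> x) \<partial>X) = \<psi> r * moll N s r - \<psi> r * moll N t r" for r
    proof -
      have "(\<integral>x. u (r, x) * (m r * \<eta> x) \<partial>X) = (\<integral>x. m r * (u (r, x) * \<eta> x) \<partial>X)"
        by (simp add: mult_ac)
      also have "\<dots> = m r * \<psi> r" by (simp add: \<psi>_def)
      finally show ?thesis by (simp add: m_def algebra_simps)
    qed
    moreover have i: "set_integrable lborel ?A (\<lambda>r. \<psi> r * moll N c r)" for c
    proof (rule set_integrable_subset)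
      show "set_integrable lborel {0..T} (\<lambda>r. \<psi> r * moll N c r)"
        by (intro borel_integrable_atLeastAtMost' continuous_on_mult smooth_cont smooth_moll
            continuous_on_subset[OF \<psi>]) auto
    qed auto
    ultimately show ?thesis using set_integral_diff(2)[OF i i] by (simp add: N_def)
  qed
  have "(\<lambda>n. (LINT r:?A|lborel. \<psi> r * moll (real (Suc n)) s r) - (LINT r:?A|lborel. \<psi> r * moll (real (Suc n)) t r))
      \<longlonglongrightarrow> \<psi> s - \<psi> t"
    by (intro tendsto_diff moll_tendsto continuous_on_subset[OF \<psi>]) (use st in \<open>auto simp: T_def\<close>)
  moreover have "(\<lambda>n. - (LINT z:?A \<times> {0<..<L}|lborel. ut z * (cutoff (real (Suc n)) s t (fst z) * \<eta> (snd z))))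
     \<longlonglongrightarrow> - (LINT z:?A \<times> {0<..<L}|lborel. ut z * (indicator {s<..t} (fst z) * \<eta> (snd z)))"
  proof (intro tendsto_minus set_integral_dominated_convergence[OF ut_integrable, where K = K])
    show "(\<lambda>n. cutoff (real (Suc n)) s t (fst z) * \<eta> (snd z)) \<longlonglongrightarrow> indicator {s<..t} (fst z) * \<eta> (snd z)" for z
      by (intro tendsto_mult tendsto_const cutoff_tendsto) (use st in auto)
    show "(\<lambda>z. cutoff (real (Suc n)) s t (fst z) * \<eta> (snd z)) \<in> borel_measurable lborel" for n
    proof -
      have "cutoff (real (Suc n)) s t \<in> borel_measurable borel" by (intro smooth_borel smooth_cutoff)
      then show ?thesis by (intro borel_measurable_times borel_measurable_fst_snd \<eta>m)
    qed
    show "\<bar>cutoff (real (Suc n)) s t (fst z) * \<eta> (snd z)\<bar> \<le> K" for n z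
    proof -
      have "\<bar>cutoff (real (Suc n)) s t (fst z)\<bar> * \<bar>\<eta> (snd z)\<bar> \<le> 1 * K"
        using cutoff_bounds[of "real (Suc n)" s t "fst z"] st K[of "snd z"] by (intro mult_mono) auto
      then show ?thesis by (simp add: abs_mult)
    qed
    show "(\<lambda>z. indicator {s<..t} (fst z) * \<eta> (snd z)) \<in> borel_measurable lborel"
      by (intro borel_measurable_times borel_measurable_fst_snd \<eta>m) simp
  qed simp
  ultimately have eq: "\<psi> s - \<psi> t = - (LINT z:?A \<times> {0<..<L}|lborel. ut z * (indicator {s<..t} (fst z) * \<eta> (snd z)))"
    unfolding id using LIMSEQ_unique by blast
  have "indicator (?A \<times> {0<..<L}) z *\<^sub>R (ut z * (indicator {s<..t} (fst z) * \<eta> (snd z)))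
      = indicator ({s<..t} \<times> {0<..<L}) z *\<^sub>R (ut z * \<eta> (snd z))" for z
    using st by (cases z) (auto simp: indicator_def T_def)
  then have "(LINT z:?A \<times> {0<..<L}|lborel. ut z * (indicator {s<..t} (fst z) * \<eta> (snd z)))
      = (LINT z:{s<..t} \<times> {0<..<L}|lborel. ut z * \<eta> (snd z))"
    by (simp only: set_lebesgue_integral_def)
  then show ?thesis using eq unfolding \<psi>_def by linarith
qed

lemma ut_mult_integrable:
  assumes "s \<ge> 0" "\<zeta> \<in> borel_measurable borel" "\<And>x. \<bar>\<zeta> x\<bar> \<le> K"
  shows "set_integrable lborel ({s<..t} \<times> {0<..<L}) (\<lambda>z. ut z * \<zeta> (snd z))"
proof (rule set_integrable_mult_bounded[OF ut_integrable[OF assms(1)]])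
  show "(\<lambda>z :: real \<times> real. \<zeta> (snd z)) \<in> borel_measurable lborel"
    by (rule borel_measurable_fst_snd(2)[OF assms(2)])
qed (rule assms(3))

text \<open>Turning the tested identity into one for almost every x frees it from smooth test
  functions supported inside (0,L): afterwards any bounded Borel weight may be integrated against
  it, constants and cosines included.\<close>

lemma AE_increment:
  assumes st: "0 < s" "s < t"
  shows "AE x in X. u (t, x) - u (s, x) = (LINT r:{s<..t}|lborel. ut (r, x))"
proof -
  let ?G = "\<lambda>x. LINT r:{s<..t}|lborel. ut (r, x)"
  have G: "integrable X ?G" using strip_Fubini(4)[OF ut_integrable[of s t]] st by simp
  have "AE x in X. u (t, x) - u (s, x) - ?G x = 0"
  proof (rule AE_eq_0_of_smooth_tests)
    have "integrable X (\<lambda>x. u (r, x))" if "r \<ge> 0" for r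
      by (rule continuous_space_measure(2)[OF slice_cont[OF that]])
    then show "set_integrable lborel {0<..<L} (\<lambda>x. u (t, x) - u (s, x) - ?G x)"
      unfolding integrable_space_measure[symmetric]
      using G st by (intro Bochner_Integration.integrable_diff) auto
    fix a b \<eta> assume ab: "0 < a" "a \<le> b" "b < L" and \<eta>: "smooth \<eta>" "\<And>x. x \<notin> {a..b} \<Longrightarrow> \<eta> x = (0::real)"
    obtain K where K: "\<And>x. \<bar>\<eta> x\<bar> \<le> K" using smooth_bounded[OF \<eta>] by blast
    have iu: "integrable X (\<lambda>x. u (r, x) * \<eta> x)" if "r \<ge> 0" for r
      by (rule continuous_space_measure(2)[OF continuous_on_mult[OF slice_cont[OF that] smooth_cont[OF \<eta>(1)]]])
    note F = strip_Fubini[OF ut_mult_integrable[OF less_imp_le[OF st(1)] smooth_borel[OF \<eta>(1)] K, of t]]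
    have iG: "integrable X (\<lambda>x. ?G x * \<eta> x)" using F(4) by simp
    have "(\<integral>x. (u (t, x) - u (s, x) - ?G x) * \<eta> x \<partial>X)
        = (\<integral>x. u (t, x) * \<eta> x \<partial>X) - (\<integral>x. u (s, x) * \<eta> x \<partial>X) - (\<integral>x. ?G x * \<eta> x \<partial>X)"
      using iu[of t] iu[of s] iG st by (simp add: left_diff_distrib)
    then show "(LINT x:{0<..<L}|lborel. (u (t, x) - u (s, x) - ?G x) * \<eta> x) = 0"
      using weak_increment_smooth[OF st ab \<eta>] F(5) by (simp add: integral_space_measure)
  qed
  then show ?thesis by eventually_elim simp
qed

lemma increment_bounded_pos:
  assumes st: "0 < s" "s < t" and \<zeta>: "\<zeta> \<in> borel_measurable borel" "\<And>x. \<bar>\<zeta> x\<bar> \<le> K"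
  shows "(\<integral>x. (u (t, x) - u (s, x)) * \<zeta> x \<partial>X) = (LINT z:{s<..t} \<times> {0<..<L}|lborel. ut z * \<zeta> (snd z))"
proof -
  note F = strip_Fubini[OF ut_mult_integrable[OF _ \<zeta>, of s t]]
  have \<zeta>m: "\<zeta> \<in> borel_measurable X" using \<zeta>(1) by (simp add: space_measure_def measurable_restrict_space1)
  have "(\<integral>x. (u (t, x) - u (s, x)) * \<zeta> x \<partial>X) = (\<integral>x. (LINT r:{s<..t}|lborel. ut (r, x) * \<zeta> x) \<partial>X)"
  proof (rule integral_cong_AE)
    have "(\<lambda>x. u (r, x)) \<in> borel_measurable X" if "r \<ge> 0" for r
      by (rule continuous_space_measure(1)[OF slice_cont[OF that]])
    then show "(\<lambda>x. (u (t, x) - u (s, x)) * \<zeta> x) \<in> borel_measurable X" using st \<zeta>m by simp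
    show "(\<lambda>x. LINT r:{s<..t}|lborel. ut (r, x) * \<zeta> x) \<in> borel_measurable X"
      using F(4) st by (auto intro: borel_measurable_integrable)
    show "AE x in X. (u (t, x) - u (s, x)) * \<zeta> x = (LINT r:{s<..t}|lborel. ut (r, x) * \<zeta> x)"
      using AE_increment[OF st] by eventually_elim simp
  qed
  also have "\<dots> = (LINT z:{s<..t} \<times> {0<..<L}|lborel. ut z * \<zeta> (snd z))" using F(5) st by simp
  finally show ?thesis .
qed

lemma increment_bounded:
  assumes st: "0 \<le> s" "s \<le> t" and \<zeta>: "\<zeta> \<in> borel_measurable borel" "\<And>x. \<bar>\<zeta> x\<bar> \<le> K"
    and \<zeta>c: "continuous_on {0..L} \<zeta>"
  shows "(\<integral>x. (u (t, x) - u (s, x)) * \<zeta> x \<partial>X) = (LINT z:{s<..t} \<times> {0<..<L}|lborel. ut z * \<zeta> (snd z))"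
proof -
  consider "s = t" | "0 < s" "s < t" | "s = 0" "0 < t" using st by linarith
  then show ?thesis
  proof cases
    case 3
    \<comment> \<open>The weak derivative only sees positive times, so s = 0 is reached as a limit;
      the 2 keeps \<open>e n\<close> strictly below \<open>t\<close>.\<close>
    define e where "e n = t / (real n + 2)" for n
    have e: "0 < e n" "e n < t" for n using 3 by (auto simp: e_def field_simps add_pos_nonneg)
    have e0: "e \<longlonglongrightarrow> 0" unfolding e_def by real_asymp
    have c: "continuous_on {0..} (\<lambda>r. \<integral>x. u (r, x) * \<zeta> x \<partial>X)" by (rule param_cont[OF \<zeta>c])
    have split: "(\<integral>x. (u (t, x) - u (r, x)) * \<zeta> x \<partial>X) = (\<integral>x. u (t, x) * \<zeta> x \<partial>X) - (\<integral>x. u (r, x) * \<zeta> x \<partial>X)"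
      if "r \<ge> 0" for r
    proof -
      have "integrable X (\<lambda>x. u (r, x) * \<zeta> x)" if "r \<ge> 0" for r
        by (rule continuous_space_measure(2)[OF continuous_on_mult[OF slice_cont[OF that] \<zeta>c]])
      then show ?thesis using that 3 by (simp add: left_diff_distrib)
    qed
    have "(\<lambda>n. \<integral>x. u (e n, x) * \<zeta> x \<partial>X) \<longlonglongrightarrow> (\<integral>x. u (0, x) * \<zeta> x \<partial>X)"
      by (rule continuous_on_tendsto_compose[OF c e0]) (use e in \<open>auto simp: less_imp_le\<close>)
    then have "(\<lambda>n. \<integral>x. (u (t, x) - u (e n, x)) * \<zeta> x \<partial>X) \<longlonglongrightarrow> (\<integral>x. (u (t, x) - u (0, x)) * \<zeta> x \<partial>X)"
      using e by (simp add: split less_imp_le tendsto_diff)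
    moreover have "(\<lambda>n. LINT z:{0<..t} \<times> {0<..<L}|lborel. ut z * \<zeta> (snd z) * indicator {e n<..t} (fst z))
      \<longlonglongrightarrow> (LINT z:{0<..t} \<times> {0<..<L}|lborel. ut z * \<zeta> (snd z) * 1)"
    proof (rule set_integral_dominated_convergence[OF ut_mult_integrable[OF _ \<zeta>], where K = 1])
      fix z :: "real \<times> real" assume z: "z \<in> {0<..t} \<times> {0<..<L}"
      then have "eventually (\<lambda>n. e n < fst z) sequentially"
        by (intro order_tendstoD(2)[OF e0]) auto
      then have "eventually (\<lambda>n. indicator {e n<..t} (fst z) = (1::real)) sequentially"
        by eventually_elim (use z in auto)
      then show "(\<lambda>n. indicator {e n<..t} (fst z) :: real) \<longlonglongrightarrow> 1" by (rule tendsto_eventually)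
    qed (use borel_measurable_fst_snd(1)[of "indicator {e _<..t}"] in \<open>auto split: split_indicator\<close>)
    moreover have "(LINT z:{0<..t} \<times> {0<..<L}|lborel. ut z * \<zeta> (snd z) * indicator {e n<..t} (fst z))
        = (\<integral>x. (u (t, x) - u (e n, x)) * \<zeta> x \<partial>X)" for n
    proof -
      have "indicator ({0<..t} \<times> {0<..<L}) z *\<^sub>R (ut z * \<zeta> (snd z) * indicator {e n<..t} (fst z))
          = indicator ({e n<..t} \<times> {0<..<L}) z *\<^sub>R (ut z * \<zeta> (snd z))" for z
        using e(1)[of n] by (cases z) (auto simp: indicator_def)
      then show ?thesis
        unfolding increment_bounded_pos[OF e \<zeta>] by (simp only: set_lebesgue_integral_def)
    qed
    ultimately show ?thesis using 3 LIMSEQ_unique by fastforce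
  qed (use increment_bounded_pos[OF _ _ \<zeta>] in \<open>auto simp: set_lebesgue_integral_def\<close>)
qed

lemma u_increment:
  assumes st: "0 \<le> s" "s \<le> t" and \<zeta>: "continuous_on {0..L} \<zeta>"
  shows "(\<integral>x. (u (t, x) - u (s, x)) * \<zeta> x \<partial>X) = (LINT r:{s<..t}|lborel. \<integral>x. ut (r, x) * \<zeta> x \<partial>X)"
    and "set_integrable lborel {s<..t} (\<lambda>r. \<integral>x. ut (r, x) * \<zeta> x \<partial>X)"
proof -
  \<comment> \<open>Extension by zero makes the weight bounded and Borel on the whole line without
    changing the integrals over (0,L).\<close>
  define z where "z x = indicator {0..L} x *\<^sub>R \<zeta> x" for x
  have zm: "z \<in> borel_measurable borel"
    unfolding z_def by (rule borel_measurable_continuous_on_indicator) (use \<zeta> in auto)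
  have "compact (\<zeta> ` {0..L})" by (intro compact_continuous_image \<zeta>) simp
  then obtain K where K: "\<And>x. x \<in> {0..L} \<Longrightarrow> \<bar>\<zeta> x\<bar> \<le> K"
    using compact_imp_bounded bounded_iff by (metis imageI real_norm_def)
  have zK: "\<bar>z x\<bar> \<le> max K 0" for x using K[of x] by (auto simp: z_def indicator_def)
  have zc: "continuous_on {0..L} z" using \<zeta> by (simp add: z_def cong: continuous_on_cong_simp)
  have eq: "(\<integral>x. g x * z x \<partial>X) = (\<integral>x. g x * \<zeta> x \<partial>X)" for g
    by (rule Bochner_Integration.integral_cong) (auto simp: z_def)
  note F = strip_Fubini[OF ut_mult_integrable[OF st(1) zm zK, of t]]
  show "(\<integral>x. (u (t, x) - u (s, x)) * \<zeta> x \<partial>X) = (LINT r:{s<..t}|lborel. \<integral>x. ut (r, x) * \<zeta> x \<partial>X)"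
    using increment_bounded[OF st zm zK zc] F(2) by (simp add: eq)
  show "set_integrable lborel {s<..t} (\<lambda>r. \<integral>x. ut (r, x) * \<zeta> x \<partial>X)"
    using F(1) by (simp add: eq)
qed

end

subsection \<open>The zero mode\<close>

context beam
begin

definition mean :: "real \<Rightarrow> real" where
  "mean t = (\<integral>x. u (t, x) \<partial>X) / L"

definition force :: "real \<Rightarrow> real" where
  "force t = (\<integral>x. h (t, x) \<partial>X) / L"

text \<open>Defined by integrating the acceleration, so that it exists and is Lipschitz at every
  time. It turns out to be the derivative of \<open>mean\<close> (\<open>mean_has_deriv\<close>)
  and, for almost every time, the spatial mean of \<open>ut\<close>
  (\<open>ut_mean\<close>).\<close>

definition vel :: "real \<Rightarrow> real" where
  "vel t = v1 - (LINT r:{0<..t}|lborel. force r)"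

lemma mean_cont: "continuous_on {0..} mean"
  unfolding mean_def using param_cont[of "\<lambda>x. 1"] L by (auto intro!: continuous_intros)

lemma force_integrable: "a \<ge> 0 \<Longrightarrow> set_integrable lborel {a<..b} force"
  using strip_Fubini(1)[OF h_integrable] unfolding force_def by simp

lemma h_slice_AE:
  "AE t in lborel. t > 0 \<longrightarrow> (AE x in X. h (t, x) \<in> subdiff_Pot \<kappa> (u (t, x)))"
  using AE_strip[of "{0<..}" L] h_subdiff unfolding strip_def by fastforce

lemma h_slice_integrable:
  assumes "t > 0" "AE x in X. h (t, x) \<in> subdiff_Pot \<kappa> (u (t, x))"
  shows "integrable X (\<lambda>x. h (t, x))"
proof (rule X.integrable_const_bound[where B = "\<kappa>\<^sup>2"])
  show "AE x in X. norm (h (t, x)) \<le> \<kappa>\<^sup>2"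
    using assms(2) by eventually_elim (use subdiff_Pot_cases(3) in auto)
qed (rule h_slice_meas[OF assms(1)])

lemma force_bound: "AE t in lborel. t > 0 \<longrightarrow> \<bar>force t\<bar> \<le> \<kappa>\<^sup>2"
  using h_slice_AE
proof eventually_elim
  case (elim t)
  show ?case
  proof
    assume t: "t > 0"
    have hb: "AE x in X. \<bar>h (t, x)\<bar> \<le> \<kappa>\<^sup>2"
      using elim t subdiff_Pot_cases(3) by (auto elim!: eventually_mono)
    have hi: "integrable X (\<lambda>x. h (t, x))" using h_slice_integrable t elim by blast
    have "\<bar>\<integral>x. h (t, x) \<partial>X\<bar> \<le> (\<integral>x. \<bar>h (t, x)\<bar> \<partial>X)" by (rule integral_abs_bound)
    also have "\<dots> \<le> (\<integral>x. \<kappa>\<^sup>2 \<partial>X)"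
      using hi hb by (intro integral_mono_AE) auto
    also have "\<dots> = \<kappa>\<^sup>2 * L" by (rule integral_X_const)
    finally show "\<bar>force t\<bar> \<le> \<kappa>\<^sup>2"
      using L by (simp add: force_def divide_le_eq)
  qed
qed

section \<open>The equation of the mean\<close>

text \<open>A stand-in for the constant 1, which lacks compact support. The plateau extends beyond
  [0,L] on both sides, so both derivatives vanish at the end points as well.\<close>

lemma space_cutoff_exists:
  obtains \<eta> where "smooth \<eta>" "\<And>x. x \<in> {0..L} \<Longrightarrow> \<eta> x = 1" "\<And>x. x \<in> {0..L} \<Longrightarrow> deriv \<eta> x = 0"
    "\<And>x. x \<in> {0..L} \<Longrightarrow> deriv (deriv \<eta>) x = 0" "\<And>x. x \<notin> {-2..L + 2} \<Longrightarrow> \<eta> x = 0"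
proof -
  let ?\<eta> = "cutoff 1 (-2) (L + 1)"
  have one: "?\<eta> x = 1" if "x \<in> {-1..L + 1}" for x
    using that L by (simp add: cutoff_def stepf)
  have d: "(?\<eta> has_real_derivative 0) (at x)" if "x \<in> {-1<..<L + 1}" for x
    by (rule has_field_derivative_transform_within_open[of "\<lambda>_. 1" _ _ "{-1<..<L + 1}"])
       (use that one in auto)
  then have d1: "deriv ?\<eta> x = 0" if "x \<in> {-1<..<L + 1}" for x
    using that by (blast intro: DERIV_imp_deriv)
  have "(deriv ?\<eta> has_real_derivative 0) (at x)" if "x \<in> {-1<..<L + 1}" for x
    by (rule has_field_derivative_transform_within_open[of "\<lambda>_. 0" _ _ "{-1<..<L + 1}"])
       (use that d1 in auto)
  then have d2: "deriv (deriv ?\<eta>) x = 0" if "x \<in> {-1<..<L + 1}" for x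
    using that by (blast intro: DERIV_imp_deriv)
  have z: "?\<eta> x = 0" if "x \<notin> {-2..L + 2}" for x
    by (rule cutoff_outside) (use that L in auto)
  show ?thesis
    by (rule that[OF smooth_cutoff]) (use one d1 d2 z L in auto)
qed

text \<open>The space factor of the test function is 1 on [0,L]: the Neumann condition holds, and
  the factor of \<open>uxx\<close> vanishes on the strip.\<close>

lemma zero_mode:
  assumes \<theta>: "smooth \<theta>" "\<And>t. t \<notin> {a..b} \<Longrightarrow> \<theta> t = 0"
  shows "(LINT z:strip L|lborel. u z * deriv (deriv \<theta>) (fst z) + h z * \<theta> (fst z))
    = L * v1 * \<theta> 0 - L * v0 * deriv \<theta> 0"
proof -
  obtain \<eta> where \<eta>: "smooth \<eta>" "\<And>x. x \<in> {0..L} \<Longrightarrow> \<eta> x = 1" "\<And>x. x \<in> {0..L} \<Longrightarrow> deriv \<eta> x = 0"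
    "\<And>x. x \<in> {0..L} \<Longrightarrow> deriv (deriv \<eta>) x = 0" "\<And>x. x \<notin> {-2..L + 2} \<Longrightarrow> \<eta> x = 0"
    using space_cutoff_exists by blast
  let ?\<phi> = "\<lambda>z. \<theta> (fst z) * \<eta> (snd z)"
  note pd = pd_t_prod[OF \<theta>(1)] pd_x_prod[OF \<eta>(1)] pd_t_prod[OF smooth_deriv[OF \<theta>(1)]]
    pd_x_prod[OF smooth_deriv[OF \<eta>(1)]]
  have "test_fun ?\<phi>" by (rule test_fun_prod[OF \<theta>(1) \<eta>(1) \<theta>(2) \<eta>(5)])
  moreover have "\<forall>t. pd_x ?\<phi> (t, 0) = 0 \<and> pd_x ?\<phi> (t, L) = 0"
    using \<eta>(3)[of 0] \<eta>(3)[of L] L by (simp add: pd)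
  ultimately have w: "(LINT z:strip L|lborel.
         u z * pd_t (pd_t ?\<phi>) z + \<kappa>1\<^sup>2 * uxx z * pd_x (pd_x ?\<phi>) z + h z * ?\<phi> z)
      - (LINT x:{0<..<L}|lborel. v1 * ?\<phi> (0, x))
      + (LINT x:{0<..<L}|lborel. v0 * pd_t ?\<phi> (0, x)) = 0"
    by (rule weak)
  have "indicator (strip L) z *\<^sub>R (u z * pd_t (pd_t ?\<phi>) z + \<kappa>1\<^sup>2 * uxx z * pd_x (pd_x ?\<phi>) z + h z * ?\<phi> z)
      = indicator (strip L) z *\<^sub>R (u z * deriv (deriv \<theta>) (fst z) + h z * \<theta> (fst z))" for z
    using \<eta>(2)[of "snd z"] \<eta>(4)[of "snd z"] by (auto simp: pd indicator_def strip_def mem_Times_iff)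
  then have 1: "(LINT z:strip L|lborel.
         u z * pd_t (pd_t ?\<phi>) z + \<kappa>1\<^sup>2 * uxx z * pd_x (pd_x ?\<phi>) z + h z * ?\<phi> z)
      = (LINT z:strip L|lborel. u z * deriv (deriv \<theta>) (fst z) + h z * \<theta> (fst z))"
    by (simp only: set_lebesgue_integral_def)
  have 2: "(LINT x:{0<..<L}|lborel. \<eta> x) = L"
  proof -
    have "(LINT x:{0<..<L}|lborel. \<eta> x) = (LINT x:{0<..<L}|lborel. 1)"
      by (rule set_lebesgue_integral_cong) (use \<eta>(2) in auto)
    also have "\<dots> = L" using integral_X_const[of 1] unfolding integral_space_measure by simp
    finally show ?thesis .
  qed
  have 3: "(LINT x:{0<..<L}|lborel. v1 * ?\<phi> (0, x)) = v1 * (\<theta> 0 * L)"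
    "(LINT x:{0<..<L}|lborel. v0 * pd_t ?\<phi> (0, x)) = v0 * (deriv \<theta> 0 * L)"
    by (simp_all add: pd 2)
  show ?thesis using w unfolding 1 3 by (simp add: algebra_simps)
qed

text \<open>The twice integrated form of mean'' = - force with initial data \<open>v0\<close> and
  \<open>v1\<close>, obtained from \<open>zero_mode\<close> with the functions of
  \<open>time_tests\<close>. It holds at every time because \<open>mean\<close> is
  continuous.\<close>

lemma mean_identity:
  assumes t: "t \<ge> 0"
  shows "mean t = v0 + v1 * t - (LINT r:{0<..t}|lborel. force r * (t - r))"
proof -
  obtain \<theta> c where \<theta>s: "\<And>n. smooth (\<theta> n)"
    and \<theta>0: "\<And>n r. r \<notin> {-1..t + 1 / real (Suc n)} \<Longrightarrow> \<theta> n r = 0"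
    and \<theta>2: "\<And>n r. r > 0 \<Longrightarrow> deriv (deriv (\<theta> n)) r = moll (real (Suc n)) t r"
    and \<theta>err: "\<And>n r. r \<ge> 0 \<Longrightarrow> \<bar>\<theta> n r - max 0 (t - r)\<bar> \<le> 2 / real (Suc n)"
    and \<theta>z: "\<And>n. \<theta> n 0 = t + c / real (Suc n)" "\<And>n. deriv (\<theta> n) 0 = -1"
    using time_tests[OF t] by blast
  define T where "T = t + 1"
  let ?A = "{0<..T}"
  let ?g = "\<lambda>n. LINT r:?A|lborel. (L * mean r) * moll (real (Suc n)) t r"
  let ?f = "\<lambda>n. LINT r:?A|lborel. L * force r * \<theta> n r"
  have id: "?g n + ?f n = L * v1 * (t + c / real (Suc n)) + L * v0" for n
  proof -
    define N where "N = real (Suc n)"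
    have N: "N > 0" "1 / N \<le> 1" by (auto simp: N_def)
    have nT: "t + 1 / N \<le> T" using N(2) unfolding T_def by linarith
    let ?m = "moll N t"
    have m: "smooth ?m" by (rule smooth_moll)
    have m0: "?m r = 0" if "r \<notin> {t..t + 1 / N}" for r
      using that by (intro moll_outside N) auto
    obtain Km where Km: "\<And>r. \<bar>?m r\<bar> \<le> Km" using smooth_bounded[OF m m0] by blast
    obtain Kt where Kt: "\<And>r. \<bar>\<theta> n r\<bar> \<le> Kt" using smooth_bounded[OF \<theta>s \<theta>0] by blast
    have i1: "set_integrable lborel (?A \<times> {0<..<L}) (\<lambda>z. u z * ?m (fst z))"
      by (rule set_integrable_mult_bounded[OF u_integrable borel_measurable_fst_snd(1)[OF smooth_borel[OF m]] Km]) simp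
    have i2: "set_integrable lborel (?A \<times> {0<..<L}) (\<lambda>z. h z * \<theta> n (fst z))"
      by (rule set_integrable_mult_bounded[OF h_integrable borel_measurable_fst_snd(1)[OF smooth_borel[OF \<theta>s]] Kt]) simp
    have "(LINT z:strip L|lborel. u z * deriv (deriv (\<theta> n)) (fst z) + h z * \<theta> n (fst z))
        = L * v1 * \<theta> n 0 - L * v0 * deriv (\<theta> n) 0"
      by (rule zero_mode[OF \<theta>s \<theta>0])
    also have "(LINT z:strip L|lborel. u z * deriv (deriv (\<theta> n)) (fst z) + h z * \<theta> n (fst z))
        = (LINT z:strip L|lborel. u z * ?m (fst z) + h z * \<theta> n (fst z))"
    proof -
      have "indicator (strip L) z *\<^sub>R (u z * deriv (deriv (\<theta> n)) (fst z) + h z * \<theta> n (fst z))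
         = indicator (strip L) z *\<^sub>R (u z * ?m (fst z) + h z * \<theta> n (fst z))" for z
        using \<theta>2[of "fst z" n] unfolding N_def by (auto simp: indicator_def strip_def)
      then show ?thesis by (simp only: set_lebesgue_integral_def)
    qed
    also have "\<dots> = (LINT z:?A \<times> {0<..<L}|lborel. u z * ?m (fst z) + h z * \<theta> n (fst z))"
      by (rule LINT_strip_cut) (use m0 \<theta>0[of _ n] nT t in \<open>auto simp: N_def\<close>)
    also have "\<dots> = (LINT z:?A \<times> {0<..<L}|lborel. u z * ?m (fst z)) + (LINT z:?A \<times> {0<..<L}|lborel. h z * \<theta> n (fst z))"
      by (rule set_integral_add(2)[OF i1 i2])
    also have "(LINT z:?A \<times> {0<..<L}|lborel. u z * ?m (fst z)) = ?g n"
      using strip_Fubini(2)[OF i1] L by (simp add: mean_def N_def)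
    also have "(LINT z:?A \<times> {0<..<L}|lborel. h z * \<theta> n (fst z)) = ?f n"
      using strip_Fubini(2)[OF i2] L by (simp add: force_def)
    finally show ?thesis by (simp add: \<theta>z)
  qed
  have "?g \<longlonglongrightarrow> L * mean t"
    by (intro moll_tendsto continuous_on_mult continuous_on_const continuous_on_subset[OF mean_cont])
       (use t in \<open>auto simp: T_def\<close>)
  moreover have "?f \<longlonglongrightarrow> (LINT r:?A|lborel. L * force r * max 0 (t - r))"
  proof (rule set_integral_dominated_convergence[where K = "t + 2"])
    show "set_integrable lborel ?A (\<lambda>r. L * force r)"
      using force_integrable[of 0 T] by simp
    show "\<theta> n \<in> borel_measurable lborel" for n using smooth_borel[OF \<theta>s] by simp
    show "(\<lambda>n. \<theta> n r) \<longlonglongrightarrow> max 0 (t - r)" if "r \<in> ?A" for r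
    proof (rule LIM_zero_cancel, rule Lim_null_comparison)
      show "eventually (\<lambda>n. norm (\<theta> n r - max 0 (t - r)) \<le> 2 / real (Suc n)) sequentially"
        using \<theta>err[of r] that by simp
      show "(\<lambda>n. 2 / real (Suc n)) \<longlonglongrightarrow> 0" by real_asymp
    qed
    show "\<bar>\<theta> n r\<bar> \<le> t + 2" if "r \<in> ?A" for n r
    proof -
      have "2 / real (Suc n) \<le> 2" by (simp add: divide_le_eq)
      then show ?thesis using \<theta>err[of r n] that t by (auto simp: max_def split: if_splits)
    qed
  qed simp
  ultimately have "(\<lambda>n. ?g n + ?f n) \<longlonglongrightarrow> L * mean t + (LINT r:?A|lborel. L * force r * max 0 (t - r))"
    by (rule tendsto_add)
  moreover have "(\<lambda>n. ?g n + ?f n) \<longlonglongrightarrow> L * v1 * (t + 0) + L * v0"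
    unfolding id
  proof (intro tendsto_intros)
    show "(\<lambda>n. c / real (Suc n)) \<longlonglongrightarrow> 0" by real_asymp
  qed
  ultimately have e1: "L * mean t + (LINT r:?A|lborel. L * force r * max 0 (t - r)) = L * v1 * (t + 0) + L * v0"
    by (rule LIMSEQ_unique)
  define J where "J = (LINT r:{0<..t}|lborel. force r * (t - r))"
  have eqJ: "(LINT r:?A|lborel. L * force r * max 0 (t - r)) = L * J"
  proof -
    have "indicator ?A r *\<^sub>R (L * force r * max 0 (t - r)) = indicator {0<..t} r *\<^sub>R (L * (force r * (t - r)))" for r
      by (auto simp: indicator_def T_def max_def)
    then have "(LINT r:?A|lborel. L * force r * max 0 (t - r)) = (LINT r:{0<..t}|lborel. L * (force r * (t - r)))"
      by (simp only: set_lebesgue_integral_def)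
    then show ?thesis by (simp add: J_def)
  qed
  have "L * mean t = L * (v0 + v1 * t - J)"
    using e1[unfolded eqJ] by (simp add: algebra_simps)
  then show ?thesis using L by (simp add: J_def)
qed

section \<open>The initial value\<close>

text \<open>The functions of \<open>time_tests\<close> at t = 0 tend to 0 on positive times, so the
  bending and force terms disappear in the limit. Their second derivatives concentrate at time 0 and
  their slope there is -1, which leaves \<open>u\<close> at time 0 against
  \<open>v0\<close>.\<close>

lemma initial_smooth:
  assumes ab: "0 < a" "a \<le> b" "b < L" and \<eta>: "smooth \<eta>" "\<And>x. x \<notin> {a..b} \<Longrightarrow> \<eta> x = 0"
  shows "(\<integral>x. u (0, x) * \<eta> x \<partial>X) = v0 * (\<integral>x. \<eta> x \<partial>X)"
proof -
  obtain \<theta> c where \<theta>s: "\<And>n. smooth (\<theta> n)"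
    and \<theta>0: "\<And>n r. r \<notin> {-1..0 + 1 / real (Suc n)} \<Longrightarrow> \<theta> n r = 0"
    and \<theta>2: "\<And>n r. r > 0 \<Longrightarrow> deriv (deriv (\<theta> n)) r = moll (real (Suc n)) 0 r"
    and \<theta>err: "\<And>n r. r \<ge> 0 \<Longrightarrow> \<bar>\<theta> n r - max 0 (0 - r)\<bar> \<le> 2 / real (Suc n)"
    and \<theta>z: "\<And>n. \<theta> n 0 = 0 + c / real (Suc n)" "\<And>n. deriv (\<theta> n) 0 = -1"
    using time_tests[of 0] by (metis order_refl)
  let ?A = "{0<..1::real}"
  define J where "J = (\<integral>x. \<eta> x \<partial>X)"
  have out: "deriv \<eta> x = 0" if "x \<notin> {a..b}" for x
  proof (rule DERIV_imp_deriv, rule has_field_derivative_transform_within_open[of "\<lambda>_. 0" _ _ "- {a..b}"])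
    show "open (- {a..b})" by (intro open_Compl) simp
  qed (use that \<eta>(2) in auto)
  have out2: "deriv (deriv \<eta>) x = 0" if "x \<notin> {a..b}" for x
  proof (rule DERIV_imp_deriv, rule has_field_derivative_transform_within_open[of "\<lambda>_. 0" _ _ "- {a..b}"])
    show "open (- {a..b})" by (intro open_Compl) simp
  qed (use that out in auto)
  have \<eta>d: "smooth (deriv \<eta>)" "smooth (deriv (deriv \<eta>))" by (intro smooth_deriv \<eta>)+
  obtain K where K: "\<And>x. \<bar>\<eta> x\<bar> \<le> K" using smooth_bounded[OF \<eta>] by blast
  obtain K2 where K2: "\<And>x. \<bar>deriv (deriv \<eta>) x\<bar> \<le> K2" using smooth_bounded[OF \<eta>d(2) out2] by blast
  let ?g = "\<lambda>n. LINT r:?A|lborel. (\<integral>x. u (r, x) * \<eta> x \<partial>X) * moll (real (Suc n)) 0 r"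
  let ?f = "\<lambda>n. LINT z:?A \<times> {0<..<L}|lborel. \<kappa>1\<^sup>2 * uxx z * (\<theta> n (fst z) * deriv (deriv \<eta>) (snd z))"
  let ?h = "\<lambda>n. LINT z:?A \<times> {0<..<L}|lborel. h z * (\<theta> n (fst z) * \<eta> (snd z))"
  have \<theta>m: "\<theta> n \<in> borel_measurable borel" for n using smooth_borel[OF \<theta>s] .
  have m: "(\<lambda>z. \<theta> n (fst z) * \<eta> (snd z)) \<in> borel_measurable lborel"
    "(\<lambda>z. \<theta> n (fst z) * deriv (deriv \<eta>) (snd z)) \<in> borel_measurable lborel" for n
    by (intro borel_measurable_times borel_measurable_fst_snd \<theta>m smooth_borel \<eta> \<eta>d)+
  have id: "?g n + (?f n + ?h n) - v1 * (c / real (Suc n)) * J - v0 * J = 0" for n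
  proof -
    define N where "N = real (Suc n)"
    have N: "N > 0" "1 / N \<le> 1" by (auto simp: N_def)
    let ?m = "moll N 0"
    let ?\<phi> = "\<lambda>z. \<theta> n (fst z) * \<eta> (snd z)"
    have ms: "smooth ?m" by (rule smooth_moll)
    have m0: "?m r = 0" if "r \<notin> {0..1 / N}" for r
      using that by (intro moll_outside N) auto
    have z1: "?m r = 0" "\<theta> n r = 0" if "r > 1" for r
    proof -
      have "r > 1 / N" using N(2) that by linarith
      then show "?m r = 0" "\<theta> n r = 0" using m0[of r] \<theta>0[of r n] by (auto simp: N_def)
    qed
    obtain Km where Km: "\<And>r. \<bar>?m r\<bar> \<le> Km" using smooth_bounded[OF ms m0] by blast
    obtain Kt where Kt: "\<And>r. \<bar>\<theta> n r\<bar> \<le> Kt" using smooth_bounded[OF \<theta>s \<theta>0] by blast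
    have i1: "set_integrable lborel (?A \<times> {0<..<L}) (\<lambda>z. u z * (?m (fst z) * \<eta> (snd z)))"
    proof (rule set_integrable_mult_bounded[OF u_integrable, where K = "Km * K"])
      show "(\<lambda>z. ?m (fst z) * \<eta> (snd z)) \<in> borel_measurable lborel"
        by (intro borel_measurable_times borel_measurable_fst_snd smooth_borel ms \<eta>)
      show "\<bar>?m (fst z) * \<eta> (snd z)\<bar> \<le> Km * K" for z
        unfolding abs_mult by (intro mult_mono) (use Km[of "fst z"] K[of "snd z"] in auto)
    qed simp
    have i2: "set_integrable lborel (?A \<times> {0<..<L}) (\<lambda>z. \<kappa>1\<^sup>2 * uxx z * (\<theta> n (fst z) * deriv (deriv \<eta>) (snd z)))"
    proof (rule set_integrable_mult_bounded[OF set_integrable_mult_right m(2), where K = "Kt * K2"])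
      show "\<bar>\<theta> n (fst z) * deriv (deriv \<eta>) (snd z)\<bar> \<le> Kt * K2" for z
        unfolding abs_mult by (intro mult_mono) (use Kt[of "fst z"] K2[of "snd z"] in auto)
    qed (use uxx_integrable[of 0] in auto)
    have i3: "set_integrable lborel (?A \<times> {0<..<L}) (\<lambda>z. h z * (\<theta> n (fst z) * \<eta> (snd z)))"
    proof (rule set_integrable_mult_bounded[OF h_integrable m(1), where K = "Kt * K"])
      show "\<bar>\<theta> n (fst z) * \<eta> (snd z)\<bar> \<le> Kt * K" for z
        unfolding abs_mult by (intro mult_mono) (use Kt[of "fst z"] K[of "snd z"] in auto)
    qed simp
    note pd = pd_t_prod[OF \<theta>s] pd_x_prod[OF \<eta>(1)] pd_t_prod[OF smooth_deriv[OF \<theta>s]]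
      pd_x_prod[OF \<eta>d(1)]
    have "test_fun ?\<phi>" by (rule test_fun_prod[OF \<theta>s \<eta>(1) \<theta>0 \<eta>(2)])
    moreover have "\<forall>t. pd_x ?\<phi> (t, 0) = 0 \<and> pd_x ?\<phi> (t, L) = 0"
      using out[of 0] out[of L] ab by (simp add: pd)
    ultimately have w: "(LINT z:strip L|lborel.
           u z * pd_t (pd_t ?\<phi>) z + \<kappa>1\<^sup>2 * uxx z * pd_x (pd_x ?\<phi>) z + h z * ?\<phi> z)
        - (LINT x:{0<..<L}|lborel. v1 * ?\<phi> (0, x))
        + (LINT x:{0<..<L}|lborel. v0 * pd_t ?\<phi> (0, x)) = 0"
      by (rule weak)
    let ?F = "\<lambda>z. u z * (?m (fst z) * \<eta> (snd z)) + (\<kappa>1\<^sup>2 * uxx z * (\<theta> n (fst z) * deriv (deriv \<eta>) (snd z))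
        + h z * (\<theta> n (fst z) * \<eta> (snd z)))"
    have "indicator (strip L) z *\<^sub>R (u z * pd_t (pd_t ?\<phi>) z + \<kappa>1\<^sup>2 * uxx z * pd_x (pd_x ?\<phi>) z + h z * ?\<phi> z)
        = indicator (strip L) z *\<^sub>R ?F z" for z
      using \<theta>2[of "fst z" n] by (auto simp: pd indicator_def strip_def mem_Times_iff N_def)
    then have "(LINT z:strip L|lborel.
           u z * pd_t (pd_t ?\<phi>) z + \<kappa>1\<^sup>2 * uxx z * pd_x (pd_x ?\<phi>) z + h z * ?\<phi> z)
        = (LINT z:strip L|lborel. ?F z)"
      by (simp only: set_lebesgue_integral_def)
    also have "\<dots> = (LINT z:?A \<times> {0<..<L}|lborel. ?F z)"
      by (rule LINT_strip_cut) (use z1 in auto)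
    also have "\<dots> = (LINT z:?A \<times> {0<..<L}|lborel. u z * (?m (fst z) * \<eta> (snd z))) + (?f n + ?h n)"
      by (simp only: set_integral_add(2)[OF i1 set_integral_add(1)[OF i2 i3]] set_integral_add(2)[OF i2 i3])
    also have "(LINT z:?A \<times> {0<..<L}|lborel. u z * (?m (fst z) * \<eta> (snd z))) = ?g n"
    proof -
      have "(\<integral>x. u (r, x) * (?m r * \<eta> x) \<partial>X) = (\<integral>x. u (r, x) * \<eta> x \<partial>X) * ?m r" for r
      proof -
        have "(\<integral>x. u (r, x) * (?m r * \<eta> x) \<partial>X) = (\<integral>x. u (r, x) * \<eta> x * ?m r \<partial>X)" by (simp add: mult_ac)
        then show ?thesis by simp
      qed
      then show ?thesis using strip_Fubini(2)[OF i1] by (simp add: N_def)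
    qed
    finally have F1: "(LINT z:strip L|lborel.
           u z * pd_t (pd_t ?\<phi>) z + \<kappa>1\<^sup>2 * uxx z * pd_x (pd_x ?\<phi>) z + h z * ?\<phi> z)
        = ?g n + (?f n + ?h n)" .
    have F2: "(LINT x:{0<..<L}|lborel. v0 * pd_t ?\<phi> (0, x)) = - v0 * J"
    proof -
      have "(LINT x:{0<..<L}|lborel. v0 * pd_t ?\<phi> (0, x)) = (LINT x:{0<..<L}|lborel. (- v0) * \<eta> x)"
        by (simp add: pd \<theta>z)
      also have "\<dots> = - v0 * J" unfolding set_integral_mult_right J_def integral_space_measure ..
      finally show ?thesis .
    qed
    have F3: "(LINT x:{0<..<L}|lborel. v1 * ?\<phi> (0, x)) = v1 * (c / real (Suc n)) * J"
      by (simp add: \<theta>z J_def integral_space_measure)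
    show ?thesis using w unfolding F1 F2 F3 by linarith
  qed
  have c1: "continuous_on {0..} (\<lambda>r. \<integral>x. u (r, x) * \<eta> x \<partial>X)" by (intro param_cont smooth_cont \<eta>)
  have "?g \<longlonglongrightarrow> (\<integral>x. u (0, x) * \<eta> x \<partial>X)"
    by (rule moll_tendsto[OF c1]) auto
  have \<theta>lim: "(\<lambda>n. \<theta> n r) \<longlonglongrightarrow> 0" "\<bar>\<theta> n r\<bar> \<le> 2" if "r > 0" for n r
  proof -
    have e: "\<bar>\<theta> n r\<bar> \<le> 2 / real (Suc n)" for n using \<theta>err[of r n] that by simp
    show "(\<lambda>n. \<theta> n r) \<longlonglongrightarrow> 0"
    proof (rule Lim_null_comparison)
      show "eventually (\<lambda>n. norm (\<theta> n r) \<le> 2 / real (Suc n)) sequentially" using e by simp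
      show "(\<lambda>n. 2 / real (Suc n)) \<longlonglongrightarrow> 0" by real_asymp
    qed
    have "2 / real (Suc n) \<le> 2" by (simp add: divide_le_eq)
    then show "\<bar>\<theta> n r\<bar> \<le> 2" using e[of n] by linarith
  qed
  have "?f \<longlonglongrightarrow> (LINT z:?A \<times> {0<..<L}|lborel. \<kappa>1\<^sup>2 * uxx z * 0)"
  proof (rule set_integral_dominated_convergence[OF set_integrable_mult_right m(2), where K = "2 * K2"])
    show "(\<lambda>n. \<theta> n (fst z) * deriv (deriv \<eta>) (snd z)) \<longlonglongrightarrow> 0" if "z \<in> ?A \<times> {0<..<L}" for z
      by (rule tendsto_mult_left_zero, rule \<theta>lim(1)) (use that in auto)
    show "\<bar>\<theta> n (fst z) * deriv (deriv \<eta>) (snd z)\<bar> \<le> 2 * K2" if "z \<in> ?A \<times> {0<..<L}" for n z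
      unfolding abs_mult by (intro mult_mono) (use \<theta>lim(2)[of "fst z" n] K2[of "snd z"] that in auto)
  qed (use uxx_integrable[of 0] in auto)
  moreover have "?h \<longlonglongrightarrow> (LINT z:?A \<times> {0<..<L}|lborel. h z * 0)"
  proof (rule set_integral_dominated_convergence[OF h_integrable m(1), where K = "2 * K"])
    show "(\<lambda>n. \<theta> n (fst z) * \<eta> (snd z)) \<longlonglongrightarrow> 0" if "z \<in> ?A \<times> {0<..<L}" for z
      by (rule tendsto_mult_left_zero, rule \<theta>lim(1)) (use that in auto)
    show "\<bar>\<theta> n (fst z) * \<eta> (snd z)\<bar> \<le> 2 * K" if "z \<in> ?A \<times> {0<..<L}" for n z
      unfolding abs_mult by (intro mult_mono) (use \<theta>lim(2)[of "fst z" n] K[of "snd z"] that in auto)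
  qed auto
  moreover have "(\<lambda>n. c / real (Suc n)) \<longlonglongrightarrow> 0" by real_asymp
  ultimately have "(\<lambda>n. ?g n + (?f n + ?h n) - v1 * (c / real (Suc n)) * J - v0 * J)
      \<longlonglongrightarrow> (\<integral>x. u (0, x) * \<eta> x \<partial>X) + ((LINT z:?A \<times> {0<..<L}|lborel. \<kappa>1\<^sup>2 * uxx z * 0)
        + (LINT z:?A \<times> {0<..<L}|lborel. h z * 0)) - v1 * 0 * J - v0 * J"
    using \<open>?g \<longlonglongrightarrow> _\<close> by (intro tendsto_add tendsto_diff tendsto_mult tendsto_const)
  then show ?thesis unfolding id by (simp add: LIMSEQ_const_iff J_def)
qed

lemma initial_value:
  assumes "x \<in> {0..L}" shows "u (0, x) = v0"
proof -
  have c: "continuous_on {0..L} (\<lambda>x. u (0, x) - v0)"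
    by (intro continuous_intros slice_cont) simp
  have "AE x in X. u (0, x) - v0 = 0"
  proof (rule AE_eq_0_of_smooth_tests)
    show "set_integrable lborel {0<..<L} (\<lambda>x. u (0, x) - v0)"
      using continuous_space_measure(2)[OF c] by (simp add: integrable_space_measure)
    fix a b \<eta> assume ab: "0 < a" "a \<le> b" "b < L" and \<eta>: "smooth \<eta>" "\<And>x. x \<notin> {a..b} \<Longrightarrow> \<eta> x = (0::real)"
    have "integrable X (\<lambda>x. u (0, x) * \<eta> x)" "integrable X \<eta>"
      by (intro continuous_space_measure(2) continuous_on_mult slice_cont smooth_cont \<eta>; simp)+
    then show "(LINT x:{0<..<L}|lborel. (u (0, x) - v0) * \<eta> x) = 0"
      using initial_smooth[OF ab \<eta>]
      unfolding integral_space_measure[symmetric] by (simp add: left_diff_distrib)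
  qed
  then have "AE x in X. (u (0, x) - v0)\<^sup>2 = 0" by eventually_elim simp
  then have "(\<integral>x. (u (0, x) - v0)\<^sup>2 \<partial>X) = 0" by (simp add: integral_eq_zero_AE)
  then show ?thesis
    using zero_of_integral_square[OF L c assms] by simp
qed

section \<open>Regularity of the mean and its velocity\<close>

lemma force_part_bound:
  assumes "0 \<le> s" "s \<le> t" and g: "g \<in> borel_measurable borel" "\<And>r. r \<in> {s<..t} \<Longrightarrow> \<bar>g r\<bar> \<le> K"
  shows "set_integrable lborel {s<..t} (\<lambda>r. force r * g r)"
    and "\<bar>LINT r:{s<..t}|lborel. force r * g r\<bar> \<le> \<kappa>\<^sup>2 * K * (t - s)"
proof -
  have [measurable]: "(\<lambda>r. indicator {s<..t} r *\<^sub>R force r) \<in> borel_measurable lborel"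
    using force_integrable[OF assms(1), of t] by (simp add: set_integrable_def)
  have [measurable]: "g \<in> borel_measurable lborel" using g(1) by simp
  have b: "AE r in lborel. r \<in> {s<..t} \<longrightarrow> \<bar>force r * g r\<bar> \<le> \<kappa>\<^sup>2 * K"
    using force_bound
  proof eventually_elim
    case (elim r)
    then show ?case using assms(1) g(2)[of r] by (auto simp: abs_mult intro!: mult_mono)
  qed
  show i: "set_integrable lborel {s<..t} (\<lambda>r. force r * g r)"
    unfolding set_integrable_def
  proof (rule integrableI_bounded_set[where A = "{s<..t}" and B = "\<kappa>\<^sup>2 * K"])
    have "(\<lambda>r. (indicator {s<..t} r *\<^sub>R force r) * g r) \<in> borel_measurable lborel" by measurable
    then show "(\<lambda>r. indicator {s<..t} r *\<^sub>R (force r * g r)) \<in> borel_measurable lborel"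
      by (simp add: mult.assoc)
    show "AE r in lborel. r \<in> {s<..t} \<longrightarrow> norm (indicator {s<..t} r *\<^sub>R (force r * g r)) \<le> \<kappa>\<^sup>2 * K"
      using b by eventually_elim auto
  qed (use finite_time in auto)
  have "\<bar>LINT r:{s<..t}|lborel. force r * g r\<bar> \<le> (LINT r:{s<..t}|lborel. \<bar>force r * g r\<bar>)"
    using set_integral_norm_bound[OF i] by simp
  also have "\<dots> \<le> (LINT r:{s<..t}|lborel. \<kappa>\<^sup>2 * K)"
    by (rule set_integral_mono_AE[OF set_integrable_abs[OF i]])
       (use b assms in \<open>auto simp: set_integrable_def\<close>)
  also have "\<dots> = \<kappa>\<^sup>2 * K * (t - s)"
    using assms by (simp add: set_lebesgue_integral_def)
  finally show "\<bar>LINT r:{s<..t}|lborel. force r * g r\<bar> \<le> \<kappa>\<^sup>2 * K * (t - s)" .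
qed

lemma force_split:
  assumes "0 \<le> s" "s \<le> t" and g: "g \<in> borel_measurable borel" "\<And>r. r \<in> {0<..t} \<Longrightarrow> \<bar>g r\<bar> \<le> K"
  shows "(LINT r:{0<..t}|lborel. force r * g r)
    = (LINT r:{0<..s}|lborel. force r * g r) + (LINT r:{s<..t}|lborel. force r * g r)"
proof -
  have "(LINT r:{0<..s} \<union> {s<..t}|lborel. force r * g r)
    = (LINT r:{0<..s}|lborel. force r * g r) + (LINT r:{s<..t}|lborel. force r * g r)"
    by (rule set_integral_Un) (use assms in \<open>auto intro!: force_part_bound(1)[where K = K]\<close>)
  moreover have "{0<..s} \<union> {s<..t} = {0<..t}" using assms by auto
  ultimately show ?thesis by simp
qed

lemma vel_diff:
  assumes "0 \<le> s" "s \<le> t"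
  shows "vel t - vel s = - (LINT r:{s<..t}|lborel. force r)"
  using force_split[OF assms, of "\<lambda>_. 1" 1] by (simp add: vel_def)

lemma vel_lipschitz:
  assumes "0 \<le> s" "0 \<le> t"
  shows "\<bar>vel t - vel s\<bar> \<le> \<kappa>\<^sup>2 * \<bar>t - s\<bar>"
proof -
  have *: "\<bar>vel t - vel s\<bar> \<le> \<kappa>\<^sup>2 * (t - s)" if "0 \<le> s" "s \<le> t" for s t
    using force_part_bound(2)[OF that, of "\<lambda>_. 1" 1] vel_diff[OF that] by simp
  show ?thesis
    using *[of s t] *[of t s] assms by (cases "s \<le> t") (auto simp: abs_minus_commute)
qed

lemma vel_cont: "continuous_on {0..} vel"
proof (rule continuous_onI)
  fix s e :: real assume s: "s \<in> {0..}" and e: "e > 0"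
  have "dist (vel t) (vel s) < e" if "t \<in> {0..}" "dist t s < e / (\<kappa>\<^sup>2 + 1)" for t
  proof -
    have "dist (vel t) (vel s) \<le> \<kappa>\<^sup>2 * dist t s" using vel_lipschitz s that by (simp add: dist_real_def)
    also have "\<dots> \<le> (\<kappa>\<^sup>2 + 1) * dist t s" by (intro mult_right_mono) auto
    also have "\<dots> < e" using that by (simp add: field_simps add_pos_nonneg)
    finally show ?thesis .
  qed
  then show "\<exists>d>0. \<forall>x'\<in>{0..}. dist x' s < d \<longrightarrow> dist (vel x') (vel s) \<le> e"
    using e by (intro exI[of _ "e / (\<kappa>\<^sup>2 + 1)"]) (auto simp: less_imp_le add_nonneg_pos)
qed

lemma mean_taylor:
  assumes "0 \<le> s" "0 \<le> t"
  shows "\<bar>mean t - mean s - vel s * (t - s)\<bar> \<le> 2 * \<kappa>\<^sup>2 * (t - s)\<^sup>2"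
proof -
  have *: "\<bar>mean t - mean s - vel s * (t - s)\<bar> \<le> \<kappa>\<^sup>2 * (t - s)\<^sup>2" if st: "0 \<le> s" "s \<le> t" for s t
  proof -
    have m[measurable]: "(\<lambda>r. c - r) \<in> borel_measurable borel" for c :: real by measurable
    have "(LINT r:{0<..t}|lborel. force r * (t - r))
        = (LINT r:{0<..s}|lborel. force r * (t - r)) + (LINT r:{s<..t}|lborel. force r * (t - r))"
      by (rule force_split[OF st m, where K = t]) auto
    moreover have "(LINT r:{0<..s}|lborel. force r * (t - r))
        = (LINT r:{0<..s}|lborel. force r * (s - r)) + (LINT r:{0<..s}|lborel. force r) * (t - s)"
    proof -
      have "(LINT r:{0<..s}|lborel. force r * (s - r) + force r * (t - s))
          = (LINT r:{0<..s}|lborel. force r * (s - r)) + (LINT r:{0<..s}|lborel. force r * (t - s))"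
      proof (rule set_integral_add)
        show "set_integrable lborel {0<..s} (\<lambda>r. force r * (s - r))"
          by (rule force_part_bound(1)[OF _ _ m, where K = s]) (use st in auto)
        show "set_integrable lborel {0<..s} (\<lambda>r. force r * (t - s))"
          using force_integrable[of 0 s] by simp
      qed
      moreover have "(\<lambda>r. force r * (s - r) + force r * (t - s)) = (\<lambda>r. force r * (t - r))"
        by (auto simp: algebra_simps)
      ultimately show ?thesis by simp
    qed
    ultimately have "mean t - mean s - vel s * (t - s) = - (LINT r:{s<..t}|lborel. force r * (t - r))"
      using st mean_identity[of s] mean_identity[of t] by (simp add: vel_def algebra_simps)
    moreover have "\<bar>LINT r:{s<..t}|lborel. force r * (t - r)\<bar> \<le> \<kappa>\<^sup>2 * (t - s) * (t - s)"
      by (rule force_part_bound(2)[OF st m]) auto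
    ultimately show ?thesis by (simp add: power2_eq_square mult.assoc)
  qed
  show ?thesis
  proof (cases "s \<le> t")
    case True
    have "0 \<le> \<kappa>\<^sup>2 * (t - s)\<^sup>2" by simp
    then show ?thesis using *[OF assms(1) True] by linarith
  next
    case False
    \<comment> \<open>For t < s the forward estimate starts at \<open>t\<close>; replacing
      \<open>vel t\<close> by \<open>vel s\<close> costs another
      \<open>\<kappa>\<^sup>2 * (t - s)\<^sup>2\<close>, whence the factor 2.\<close>
    then have "\<bar>mean s - mean t - vel t * (s - t)\<bar> \<le> \<kappa>\<^sup>2 * (s - t)\<^sup>2" using * assms by simp
    moreover have "\<bar>(vel t - vel s) * (s - t)\<bar> \<le> \<kappa>\<^sup>2 * \<bar>t - s\<bar> * \<bar>s - t\<bar>"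
      unfolding abs_mult by (intro mult_right_mono vel_lipschitz assms) auto
    moreover have "\<kappa>\<^sup>2 * \<bar>t - s\<bar> * \<bar>s - t\<bar> = \<kappa>\<^sup>2 * (t - s)\<^sup>2"
      by (simp add: power2_eq_square abs_minus_commute[of s t] mult.assoc)
    moreover have "mean t - mean s - vel s * (t - s)
        = - (mean s - mean t - vel t * (s - t)) - (vel t - vel s) * (s - t)"
      by (simp add: algebra_simps)
    ultimately show ?thesis unfolding power2_commute[of s t] by linarith
  qed
qed

lemma mean_has_deriv:
  assumes t: "t \<ge> 0"
  shows "(mean has_real_derivative vel t) (at t within {0..})"
proof -
  have "((\<lambda>s. (mean s - mean t) / (s - t) - vel t) \<longlongrightarrow> 0) (at t within {0..})"
  proof (rule Lim_null_comparison)
    show "\<forall>\<^sub>F s in at t within {0..}. norm ((mean s - mean t) / (s - t) - vel t) \<le> 2 * \<kappa>\<^sup>2 * \<bar>s - t\<bar>"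
      unfolding eventually_at_topological
    proof (intro exI[of _ UNIV] conjI ballI impI)
      fix s :: real assume s: "s \<noteq> t" "s \<in> {0..}"
      have "norm ((mean s - mean t) / (s - t) - vel t) = \<bar>mean s - mean t - vel t * (s - t)\<bar> / \<bar>s - t\<bar>"
        using s by (simp add: abs_divide[symmetric] diff_divide_distrib)
      also have "\<dots> \<le> 2 * \<kappa>\<^sup>2 * (s - t)\<^sup>2 / \<bar>s - t\<bar>"
        using mean_taylor[OF t, of s] s by (intro divide_right_mono) auto
      also have "\<dots> = 2 * \<kappa>\<^sup>2 * \<bar>s - t\<bar>"
      proof -
        have sq: "(s - t)\<^sup>2 = \<bar>s - t\<bar> * \<bar>s - t\<bar>" by (simp add: power2_eq_square)
        have "2 * \<kappa>\<^sup>2 * (a * a) / a = 2 * \<kappa>\<^sup>2 * a" if "a \<noteq> 0" for a using that by simp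
        from this[of "\<bar>s - t\<bar>"] show ?thesis unfolding sq using s by linarith
      qed
      finally show "norm ((mean s - mean t) / (s - t) - vel t) \<le> 2 * \<kappa>\<^sup>2 * \<bar>s - t\<bar>" .
    qed auto
    show "((\<lambda>s. 2 * \<kappa>\<^sup>2 * \<bar>s - t\<bar>) \<longlongrightarrow> 0) (at t within {0..})"
      by (auto intro!: tendsto_eq_intros)
  qed
  then show ?thesis by (simp add: has_field_derivative_iff LIM_zero_iff)
qed

end

subsection \<open>Taylor remainders of the potential\<close>

text \<open>The second derivative of the potential off the kinks, with value 0 at the kinks by
  convention.\<close>

definition ddPot :: "real \<Rightarrow> real \<Rightarrow> real" where
  "ddPot k m = (if \<bar>m\<bar> < 1 then k\<^sup>2 else 0)"

lemma dPot_bound: "\<bar>dPot k m\<bar> \<le> k\<^sup>2"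
  using mult_left_mono[of "\<bar>m\<bar>" 1 "k\<^sup>2"] by (auto simp: dPot_def abs_mult)

lemma dPot_borel: "dPot k \<in> borel_measurable borel"
  unfolding dPot_def by measurable

lemma dPot_isCont:
  assumes "\<bar>m\<bar> \<noteq> 1" shows "isCont (dPot k) m"
proof (cases "\<bar>m\<bar> < 1")
  case True
  have "eventually (\<lambda>r. dPot k r = k\<^sup>2 * r) (nhds m)"
    unfolding eventually_nhds
    by (rule exI[of _ "{-1<..<1}"]) (use True in \<open>auto simp: dPot_def\<close>)
  moreover have "isCont (\<lambda>r. k\<^sup>2 * r) m" by simp
  ultimately show ?thesis by (simp add: isCont_cong)
next
  case False
  have "eventually (\<lambda>r. dPot k r = 0) (nhds m)"
    unfolding eventually_nhds
    by (rule exI[of _ "- {-1..1}"]) (use False assms in \<open>auto simp: dPot_def\<close>)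
  moreover have "isCont (\<lambda>r. 0 :: real) m" by simp
  ultimately show ?thesis by (simp add: isCont_cong)
qed

text \<open>Away from the kinks the potential is quadratic, so the Taylor remainders below vanish unless
  \<open>r\<close> is at least as far from \<open>m\<close> as the nearest kink.\<close>

lemma subdiff_Pot_remainder:
  assumes h: "h \<in> subdiff_Pot k r" and d: "0 < d" "d \<le> \<bar>\<bar>m\<bar> - 1\<bar>"
  shows "\<bar>h - dPot k m - ddPot k m * (r - m)\<bar> \<le> 3 * k\<^sup>2 * (r - m)\<^sup>2 / d\<^sup>2"
proof (cases "\<bar>r - m\<bar> < d")
  case True
  have "h - dPot k m - ddPot k m * (r - m) = 0"
  proof (cases "\<bar>m\<bar> < 1")
    case True
    then have "\<bar>r\<bar> < 1" using \<open>\<bar>r - m\<bar> < d\<close> d by linarith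
    then show ?thesis using True subdiff_Pot_cases(1)[OF h] by (simp add: dPot_def ddPot_def algebra_simps)
  next
    case False
    then have "\<bar>r\<bar> > 1" using \<open>\<bar>r - m\<bar> < d\<close> d by linarith
    then show ?thesis using False subdiff_Pot_cases(2)[OF h] by (simp add: dPot_def ddPot_def)
  qed
  then show ?thesis by simp
next
  case False
  \<comment> \<open>Now q \<ge> 1, and each of the three terms is at most
    \<open>k\<^sup>2 * q\<^sup>2\<close>. For the linear term with \<bar>m\<bar> < 1 this uses that
    the distance to the kinks, hence \<open>d\<close>, is at most 1.\<close>
  define q where "q = \<bar>r - m\<bar> / d"
  have q: "q \<ge> 1" using False d by (simp add: q_def)
  have q2: "q \<le> q\<^sup>2" "1 \<le> q\<^sup>2" using q by (auto simp: power2_eq_square intro: order_trans mult_le_cancel_left1[THEN iffD2])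
  have e: "\<bar>ddPot k m * (r - m)\<bar> \<le> k\<^sup>2 * q"
  proof (cases "\<bar>m\<bar> < 1")
    case True
    then have "d \<le> 1" using d by linarith
    then have "\<bar>r - m\<bar> \<le> q" using d unfolding q_def by (simp add: pos_le_divide_eq mult_left_le)
    then show ?thesis using True by (simp add: ddPot_def abs_mult mult_left_mono)
  qed (use q in \<open>simp add: ddPot_def\<close>)
  have k: "k\<^sup>2 \<le> k\<^sup>2 * q\<^sup>2" "k\<^sup>2 * q \<le> k\<^sup>2 * q\<^sup>2"
    using mult_left_mono[OF q2(2), of "k\<^sup>2"] mult_left_mono[OF q2(1), of "k\<^sup>2"] by auto
  have "\<bar>h - dPot k m - ddPot k m * (r - m)\<bar> \<le> 3 * (k\<^sup>2 * q\<^sup>2)"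
    using e k subdiff_Pot_cases(3)[OF h] dPot_bound[of k m] by linarith
  also have "\<dots> = 3 * k\<^sup>2 * (r - m)\<^sup>2 / d\<^sup>2" by (simp add: q_def power_divide)
  finally show ?thesis .
qed

text \<open>One-sided: \<open>Pot\<close> falls below its tangent at \<open>m\<close> only if
  \<open>r\<close> is at distance at least \<open>d\<close>, and then by at most
  \<open>k\<^sup>2 * \<bar>r - m\<bar>\<close>, which is at most
  \<open>k\<^sup>2 * (r - m)\<^sup>2 / d\<close>. The power 1 / d, against 1 / d^2 for the force, is
  what leaves a small factor in \<open>local_extension\<close>.\<close>

lemma Pot_remainder:
  assumes d: "0 < d" "d \<le> \<bar>\<bar>m\<bar> - 1\<bar>"
  shows "Pot k m - Pot k r + dPot k m * (r - m) \<le> k\<^sup>2 * (r - m)\<^sup>2 / d"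
proof -
  have pos: "0 \<le> k\<^sup>2 * (r - m)\<^sup>2 / d" using d by simp
  have quad: "k\<^sup>2 * m\<^sup>2 / 2 - k\<^sup>2 * r\<^sup>2 / 2 + k\<^sup>2 * m * (r - m) = - (k\<^sup>2 * (r - m)\<^sup>2 / 2)"
    by (simp add: power2_eq_square field_simps)
  have big: "k\<^sup>2 * \<bar>r - m\<bar> \<le> k\<^sup>2 * (r - m)\<^sup>2 / d" if "\<bar>r - m\<bar> \<ge> d"
  proof -
    have "\<bar>r - m\<bar> * d \<le> \<bar>r - m\<bar> * \<bar>r - m\<bar>" using that by (intro mult_left_mono) auto
    then have "\<bar>r - m\<bar> \<le> (r - m)\<^sup>2 / d" using d by (simp add: pos_le_divide_eq power2_eq_square)
    then have "k\<^sup>2 * \<bar>r - m\<bar> \<le> k\<^sup>2 * ((r - m)\<^sup>2 / d)" by (rule mult_left_mono) simp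
    then show ?thesis by simp
  qed
  show ?thesis
  proof (cases "\<bar>m\<bar> < 1")
    case True
    show ?thesis
    proof (cases "\<bar>r\<bar> \<le> 1")
      case True
      have "0 \<le> k\<^sup>2 * (r - m)\<^sup>2 / 2" by simp
      moreover have "Pot k m - Pot k r + dPot k m * (r - m) = - (k\<^sup>2 * (r - m)\<^sup>2 / 2)"
        using True \<open>\<bar>m\<bar> < 1\<close> quad by (simp add: Pot_def dPot_def)
      ultimately show ?thesis using pos by linarith
    next
      case False
      have "m\<^sup>2 \<le> 1" using True by (simp add: abs_square_le_1)
      then have "k\<^sup>2 * m\<^sup>2 \<le> k\<^sup>2 * 1" by (rule mult_left_mono) simp
      moreover have "k\<^sup>2 * m * (r - m) \<le> k\<^sup>2 * \<bar>r - m\<bar>"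
      proof -
        have "m * (r - m) \<le> \<bar>m\<bar> * \<bar>r - m\<bar>" by (metis abs_ge_self abs_mult)
        also have "\<dots> \<le> 1 * \<bar>r - m\<bar>" using True by (intro mult_right_mono) auto
        finally have "k\<^sup>2 * (m * (r - m)) \<le> k\<^sup>2 * \<bar>r - m\<bar>" by (intro mult_left_mono) auto
        then show ?thesis by (simp add: mult.assoc)
      qed
      moreover have "\<bar>r - m\<bar> \<ge> d" using d True False by linarith
      ultimately show ?thesis using big True False by (simp add: Pot_def dPot_def)
    qed
  next
    case False
    then have m: "\<bar>m\<bar> > 1" using d by linarith
    show ?thesis
    proof (cases "\<bar>r\<bar> \<le> 1")
      case True
      have "1 - r\<^sup>2 \<le> 2 * \<bar>r - m\<bar>"
      proof -
        have "0 \<le> (1 - \<bar>r\<bar>)\<^sup>2" by simp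
        then have "1 - r\<^sup>2 \<le> 2 * (1 - \<bar>r\<bar>)" by (simp add: power2_eq_square algebra_simps)
        also have "\<dots> \<le> 2 * \<bar>r - m\<bar>"
          using m abs_triangle_ineq2[of m r] by (simp add: abs_minus_commute)
        finally show ?thesis .
      qed
      then have "k\<^sup>2 * (1 - r\<^sup>2) \<le> k\<^sup>2 * (2 * \<bar>r - m\<bar>)" by (rule mult_left_mono) simp
      moreover have "\<bar>r - m\<bar> \<ge> d" using d True m by linarith
      ultimately show ?thesis using big True m by (simp add: Pot_def dPot_def algebra_simps)
    qed (use m pos in \<open>simp add: Pot_def dPot_def\<close>)
  qed
qed

section \<open>Splitting the energy into mean and deviation\<close>

context beam
begin

lemma measure_X [simp]: "measure X {0<..<L} = L"
  by (rule measure_space_measure[OF L])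

definition dev :: "real \<Rightarrow> real" where
  "dev t = (\<integral>x. (u (t, x) - mean t)\<^sup>2 \<partial>X)"

text \<open>Centred at \<open>vel t\<close>, which is defined at every time; by
  \<open>ut_mean\<close> it is the unnormalised spatial variance of \<open>ut\<close> for almost
  every t > 0.\<close>

definition vdev :: "real \<Rightarrow> real" where
  "vdev t = (\<integral>x. (ut (t, x) - vel t)\<^sup>2 \<partial>X)"

text \<open>The initial energy per unit length.\<close>

definition e0 :: real where
  "e0 = v1\<^sup>2 / 2 + Pot \<kappa> v0"

lemma slice_integrable: "t \<ge> 0 \<Longrightarrow> integrable X (\<lambda>x. u (t, x))"
  by (rule continuous_space_measure(2)[OF slice_cont])

lemma integral_slice: "(\<integral>x. u (t, x) \<partial>X) = L * mean t"
  using L by (simp add: mean_def)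

lemma deviation_slice:
  assumes t: "t \<ge> 0"
  shows "continuous_on {0..L} (\<lambda>x. u (t, x) - mean t)"
    and "integrable X (\<lambda>x. u (t, x) - mean t)" "integrable X (\<lambda>x. (u (t, x) - mean t)\<^sup>2)"
    and "(\<integral>x. u (t, x) - mean t \<partial>X) = 0"
proof -
  show c: "continuous_on {0..L} (\<lambda>x. u (t, x) - mean t)" by (intro continuous_intros slice_cont t)
  then show "integrable X (\<lambda>x. u (t, x) - mean t)" "integrable X (\<lambda>x. (u (t, x) - mean t)\<^sup>2)"
    by (auto intro!: continuous_space_measure(2) continuous_on_power)
  show "(\<integral>x. u (t, x) - mean t \<partial>X) = 0"
    using slice_integrable[OF t] by (simp add: integral_slice)
qed

lemma mean_0: "mean 0 = v0" and vel_0: "vel 0 = v1"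
  using mean_identity[of 0] by (simp_all add: vel_def set_lebesgue_integral_def)

lemma ut_mean_interval:
  assumes "0 \<le> c" "c \<le> d"
  shows "(LINT r:{c<..d}|lborel. (\<integral>x. ut (r, x) \<partial>X) - L * vel r) = 0"
proof -
  have cv: "continuous_on {c..d} vel" by (rule continuous_on_subset[OF vel_cont]) (use assms in auto)
  have i1: "set_integrable lborel {c<..d} (\<lambda>r. \<integral>x. ut (r, x) \<partial>X)"
    using u_increment(2)[OF assms continuous_on_const[of _ 1]] by simp
  have i2': "set_integrable lborel {c..d} vel" by (rule borel_integrable_atLeastAtMost'[OF cv])
  then have i2: "set_integrable lborel {c<..d} vel" by (rule set_integrable_subset) auto
  have "(LINT r:{c<..d}|lborel. vel r) = (LINT r:{c..d}|lborel. vel r)"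
  proof (rule set_integral_cong_set[symmetric])
    show "set_borel_measurable lborel {c<..d} vel" "set_borel_measurable lborel {c..d} vel"
      using i2 i2' by (auto simp: set_integrable_def set_borel_measurable_def)
    show "AE r in lborel. r \<in> {c<..d} \<longleftrightarrow> r \<in> {c..d}"
      using AE_lborel_singleton[of c] by eventually_elim auto
  qed
  also have "\<dots> = mean d - mean c"
    unfolding set_lebesgue_integral_def
  proof (rule integral_FTC_atLeastAtMost[OF assms(2) _ cv])
    fix r assume "c \<le> r" "r \<le> d"
    then show "(mean has_vector_derivative vel r) (at r within {c..d})"
      using has_field_derivative_subset[OF mean_has_deriv[of r], of "{c..d}"] assms
      by (auto simp: has_real_derivative_iff_has_vector_derivative)
  qed
  finally have a: "(LINT r:{c<..d}|lborel. vel r) = mean d - mean c" .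
  have b: "(LINT r:{c<..d}|lborel. \<integral>x. ut (r, x) \<partial>X) = L * mean d - L * mean c"
    using u_increment(1)[OF assms continuous_on_const[of _ 1]] slice_integrable assms
    by (simp add: integral_slice)
  have c: "(LINT r:{c<..d}|lborel. (\<integral>x. ut (r, x) \<partial>X) - L * vel r)
      = (LINT r:{c<..d}|lborel. \<integral>x. ut (r, x) \<partial>X) - L * (LINT r:{c<..d}|lborel. vel r)"
    using set_integral_diff(2)[OF i1 set_integrable_mult_right[where a = L, OF i2]] by simp
  show ?thesis unfolding c a b by (simp add: right_diff_distrib)
qed

text \<open>Over each interval (c,d] both sides integrate to L (mean d - mean c): the left by
  \<open>u_increment\<close> with weight 1, the right because \<open>vel\<close> is the derivative
  of \<open>mean\<close>.\<close>

lemma ut_mean: "AE t in lborel. t > 0 \<longrightarrow> (\<integral>x. ut (t, x) \<partial>X) = L * vel t"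
proof -
  let ?f = "\<lambda>r. (\<integral>x. ut (r, x) \<partial>X) - L * vel r"
  have "AE t in lborel. t \<in> {0<..<real n} \<longrightarrow> ?f t = 0" for n
  proof (rule AE_eq_0_of_interval_integrals)
    have "set_integrable lborel {0<..real n} (\<lambda>r. \<integral>x. ut (r, x) \<partial>X)"
      using u_increment(2)[OF _ _ continuous_on_const[of _ 1], of 0 "real n"] by simp
    moreover have "set_integrable lborel {0..real n} vel"
      by (rule borel_integrable_atLeastAtMost'[OF continuous_on_subset[OF vel_cont]]) auto
    ultimately show "set_integrable lborel {0<..<real n} ?f"
      by (intro set_integral_diff set_integrable_mult_right) (auto elim!: set_integrable_subset)
    show "(LINT r:{c<..d}|lborel. ?f r) = 0" if "0 < c" "c < d" for c d
      by (rule ut_mean_interval) (use that in auto)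
  qed
  then have "AE t in lborel. \<forall>n::nat. t \<in> {0<..<real n} \<longrightarrow> ?f t = 0"
    unfolding AE_all_countable by blast
  then show ?thesis
  proof eventually_elim
    case (elim t)
    obtain n where "t < real n" using reals_Archimedean2 by blast
    then show ?case using elim by auto
  qed
qed

text \<open>The last clause is the energy inequality after the variance identity has split the
  kinetic energy into the part of the mean and half of \<open>vdev\<close>.\<close>

lemma ut_slice:
  "AE t in lborel. t > 0 \<longrightarrow> integrable X (\<lambda>x. (ut (t, x))\<^sup>2) \<and> integrable X (\<lambda>x. ut (t, x))
    \<and> (\<integral>x. ut (t, x) \<partial>X) = L * vel t \<and> vdev t = (\<integral>x. (ut (t, x))\<^sup>2 \<partial>X) - L * (vel t)\<^sup>2
    \<and> vdev t / 2 + (\<integral>x. Pot \<kappa> (u (t, x)) \<partial>X) \<le> L * (e0 - (vel t)\<^sup>2 / 2)"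
proof -
  obtain M where "AE t in lborel. t > 0 \<longrightarrow>
      integrable X (\<lambda>x. (ut (t, x))\<^sup>2) \<and> (\<integral>x. (ut (t, x))\<^sup>2 \<partial>X) \<le> M"
    using ut_L2 by blast
  then show ?thesis using ut_mean energy
  proof eventually_elim
    case (elim t)
    show ?case
    proof
      assume t: "t > 0"
      have i2: "integrable X (\<lambda>x. (ut (t, x))\<^sup>2)" using elim t by blast
      have i1: "integrable X (\<lambda>x. ut (t, x))" by (rule ut_slice_integrable[OF t i2])
      have mn: "(\<integral>x. ut (t, x) \<partial>X) = L * vel t" using elim t by blast
      have ip: "integrable X (\<lambda>x. Pot \<kappa> (u (t, x)))"
        using t by (intro continuous_space_measure(2) continuous_on_compose2[OF continuous_Pot[of UNIV]] slice_cont) auto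
      have "vdev t = (\<integral>x. (ut (t, x))\<^sup>2 - 2 * vel t * ut (t, x) + (vel t)\<^sup>2 \<partial>X)"
        unfolding vdev_def by (intro Bochner_Integration.integral_cong) (auto simp: power2_eq_square algebra_simps)
      also have "\<dots> = (\<integral>x. (ut (t, x))\<^sup>2 \<partial>X) - 2 * vel t * (L * vel t) + (vel t)\<^sup>2 * L"
        using i1 i2 mn integral_X_const[of "(vel t)\<^sup>2"] by simp
      finally have v: "vdev t = (\<integral>x. (ut (t, x))\<^sup>2 \<partial>X) - L * (vel t)\<^sup>2"
        by (simp add: power2_eq_square)
      have "(\<integral>x. (ut (t, x))\<^sup>2 / 2 + Pot \<kappa> (u (t, x)) \<partial>X) \<le> L * e0"
        using elim t unfolding e0_def by blast
      then have "(\<integral>x. (ut (t, x))\<^sup>2 \<partial>X) / 2 + (\<integral>x. Pot \<kappa> (u (t, x)) \<partial>X) \<le> L * e0"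
        using i2 ip by simp
      then have "vdev t / 2 + (\<integral>x. Pot \<kappa> (u (t, x)) \<partial>X) \<le> L * (e0 - (vel t)\<^sup>2 / 2)"
        using v by (simp add: algebra_simps)
      then show "integrable X (\<lambda>x. (ut (t, x))\<^sup>2) \<and> integrable X (\<lambda>x. ut (t, x))
        \<and> (\<integral>x. ut (t, x) \<partial>X) = L * vel t \<and> vdev t = (\<integral>x. (ut (t, x))\<^sup>2 \<partial>X) - L * (vel t)\<^sup>2
        \<and> vdev t / 2 + (\<integral>x. Pot \<kappa> (u (t, x)) \<partial>X) \<le> L * (e0 - (vel t)\<^sup>2 / 2)"
        using i1 i2 mn v by blast
    qed
  qed
qed

lemma vdev_nonneg: "vdev t \<ge> 0" and dev_nonneg: "dev t \<ge> 0"
  by (simp_all add: vdev_def dev_def)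

text \<open>A Poincare inequality in time. The increment from the flat state is tested with the
  deviation z at time \<open>t\<close> itself, which gives \<open>dev t\<close> as a time integral
  of products of \<open>ut\<close> and z. Young's inequality with weight \<tau> = t - T bounds that
  integral by \<tau>^2 M / 2 + dev t / 2, and the last term is absorbed.\<close>

lemma dev_bound:
  assumes t: "0 \<le> T" "T < t" and c: "\<And>x. x \<in> {0..L} \<Longrightarrow> u (T, x) = c"
    and M: "AE r in lborel. r \<in> {T<..t} \<longrightarrow> vdev r \<le> M"
  shows "dev t \<le> (t - T)\<^sup>2 * M"
proof -
  define z where "z x = u (t, x) - mean t" for x
  define \<tau> where "\<tau> = t - T"
  have \<tau>: "\<tau> > 0" using t by (simp add: \<tau>_def)
  have zc: "continuous_on {0..L} z" and zi: "integrable X z" "integrable X (\<lambda>x. (z x)\<^sup>2)"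
    and z0: "(\<integral>x. z x \<partial>X) = 0"
    unfolding z_def using deviation_slice[of t] t by auto
  have "(\<integral>x. (u (t, x) - u (T, x)) * z x \<partial>X) = (\<integral>x. (z x)\<^sup>2 + (mean t - c) * z x \<partial>X)"
    by (intro Bochner_Integration.integral_cong) (auto simp: c z_def power2_eq_square algebra_simps)
  also have "\<dots> = (\<integral>x. (z x)\<^sup>2 \<partial>X)" using zi z0 by simp
  also have "\<dots> = dev t" by (simp add: dev_def z_def)
  finally have 1: "dev t = (LINT r:{T<..t}|lborel. \<integral>x. ut (r, x) * z x \<partial>X)"
    using u_increment(1)[OF t(1) less_imp_le[OF t(2)] zc] by simp
  also have "\<dots> \<le> (LINT r:{T<..t}|lborel. \<tau> / 2 * M + dev t / (2 * \<tau>))"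
  proof (rule set_integral_mono_AE)
    show "set_integrable lborel {T<..t} (\<lambda>r. \<integral>x. ut (r, x) * z x \<partial>X)"
      by (rule u_increment(2)[OF t(1) less_imp_le[OF t(2)] zc])
    show "set_integrable lborel {T<..t} (\<lambda>r. \<tau> / 2 * M + dev t / (2 * \<tau>))"
      using t by (simp add: set_integrable_def)
    show "AE r\<in>{T<..t} in lborel. (\<integral>x. ut (r, x) * z x \<partial>X) \<le> \<tau> / 2 * M + dev t / (2 * \<tau>)"
      using M ut_slice
    proof eventually_elim
      case (elim r)
      show ?case
      proof
        assume r: "r \<in> {T<..t}"
        then have r0: "r > 0" using t by auto
        have i: "integrable X (\<lambda>x. (ut (r, x))\<^sup>2)" "integrable X (\<lambda>x. ut (r, x))"
          using elim r0 by auto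
        have iv: "integrable X (\<lambda>x. (ut (r, x) - vel r)\<^sup>2)"
        proof -
          have "integrable X (\<lambda>x. (ut (r, x))\<^sup>2 - 2 * vel r * ut (r, x) + (vel r)\<^sup>2)" using i by simp
          then show ?thesis by (simp add: power2_diff algebra_simps)
        qed
        \<comment> \<open>Since z has mean zero, the term with \<open>vel r\<close> disappears on
          integration and only the deviation of the velocity counts.\<close>
        have pt: "ut (r, x) * z x \<le> \<tau> / 2 * (ut (r, x) - vel r)\<^sup>2 + (z x)\<^sup>2 / (2 * \<tau>) + vel r * z x" for x
        proof -
          have "0 \<le> (\<tau> * (ut (r, x) - vel r) - z x)\<^sup>2 / (2 * \<tau>)" using \<tau> by simp
          also have "\<dots> = \<tau> / 2 * (ut (r, x) - vel r)\<^sup>2 + (z x)\<^sup>2 / (2 * \<tau>) - (ut (r, x) - vel r) * z x"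
            using \<tau> by (simp add: power2_eq_square field_simps)
          finally show ?thesis by (simp add: algebra_simps)
        qed
        have "(\<integral>x. ut (r, x) * z x \<partial>X)
            \<le> (\<integral>x. \<tau> / 2 * (ut (r, x) - vel r)\<^sup>2 + (z x)\<^sup>2 / (2 * \<tau>) + vel r * z x \<partial>X)"
        proof (rule integral_mono_AE)
          have b: "\<bar>ut (r, x) * z x\<bar> \<le> (ut (r, x))\<^sup>2 + (z x)\<^sup>2" for x
          proof -
            have "2 * (\<bar>ut (r, x)\<bar> * \<bar>z x\<bar>) \<le> (ut (r, x))\<^sup>2 + (z x)\<^sup>2"
              using sum_squares_bound[of "\<bar>ut (r, x)\<bar>" "\<bar>z x\<bar>"] by (simp add: mult.assoc)
            moreover have "0 \<le> \<bar>ut (r, x)\<bar> * \<bar>z x\<bar>" by simp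
            ultimately show ?thesis unfolding abs_mult by linarith
          qed
          have iz: "integrable X (\<lambda>x. (ut (r, x))\<^sup>2 + (z x)\<^sup>2)" using i zi by simp
          show "integrable X (\<lambda>x. ut (r, x) * z x)"
            by (rule Bochner_Integration.integrable_bound[OF iz])
               (use b i zi in \<open>auto intro!: borel_measurable_times intro: borel_measurable_integrable\<close>)
        qed (use iv zi pt in auto)
        also have "\<dots> = \<tau> / 2 * vdev r + dev t / (2 * \<tau>)"
        proof -
          have "dev t = (\<integral>x. (z x)\<^sup>2 \<partial>X)" by (simp add: dev_def z_def)
          then show ?thesis using iv zi z0 by (simp add: vdev_def)
        qed
        also have "\<dots> \<le> \<tau> / 2 * M + dev t / (2 * \<tau>)"
          using elim r \<tau> by (auto intro!: mult_left_mono)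
        finally show "(\<integral>x. ut (r, x) * z x \<partial>X) \<le> \<tau> / 2 * M + dev t / (2 * \<tau>)" .
      qed
    qed
  qed
  also have "\<dots> = \<tau> * (\<tau> / 2 * M + dev t / (2 * \<tau>))"
    using t by (simp add: set_lebesgue_integral_def \<tau>_def)
  also have "\<dots> = \<tau>\<^sup>2 * M / 2 + dev t / 2"
    using \<tau> by (simp add: power2_eq_square algebra_simps)
  finally show ?thesis by (simp add: \<tau>_def)
qed

text \<open>The first-order term of the expansion about \<open>mean t\<close> is a constant times
  the deviation, which integrates to zero; the second-order remainder is
  \<open>subdiff_Pot_remainder\<close>.\<close>

lemma force_remainder:
  "AE t in lborel. t > 0 \<longrightarrow> (\<forall>d>0. d \<le> \<bar>\<bar>mean t\<bar> - 1\<bar> \<longrightarrow>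
     \<bar>force t - dPot \<kappa> (mean t)\<bar> \<le> 3 * \<kappa>\<^sup>2 / d\<^sup>2 * dev t / L)"
  using h_slice_AE
proof eventually_elim
  case (elim t)
  show ?case
  proof (intro impI allI)
    fix d assume t: "t > 0" and d: "d > 0" "d \<le> \<bar>\<bar>mean t\<bar> - 1\<bar>"
    define z where "z x = u (t, x) - mean t" for x
    have zi: "integrable X z" "integrable X (\<lambda>x. (z x)\<^sup>2)"
      and z0: "(\<integral>x. z x \<partial>X) = 0"
      unfolding z_def using deviation_slice[of t] t by auto
    have hi: "integrable X (\<lambda>x. h (t, x))" using h_slice_integrable t elim by blast
    let ?r = "\<lambda>x. h (t, x) - dPot \<kappa> (mean t) - ddPot \<kappa> (mean t) * z x"
    have "L * (force t - dPot \<kappa> (mean t)) = (\<integral>x. ?r x \<partial>X)"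
      using hi zi z0 integral_X_const[of "dPot \<kappa> (mean t)"] L by (simp add: force_def algebra_simps)
    then have "L * \<bar>force t - dPot \<kappa> (mean t)\<bar> = \<bar>\<integral>x. ?r x \<partial>X\<bar>"
      using L by (metis abs_mult abs_of_pos)
    also have "\<dots> \<le> (\<integral>x. \<bar>?r x\<bar> \<partial>X)" by (rule integral_abs_bound)
    also have "\<dots> \<le> (\<integral>x. 3 * \<kappa>\<^sup>2 * (z x)\<^sup>2 / d\<^sup>2 \<partial>X)"
    proof (rule integral_mono_AE)
      show "AE x in X. \<bar>?r x\<bar> \<le> 3 * \<kappa>\<^sup>2 * (z x)\<^sup>2 / d\<^sup>2"
        using elim t subdiff_Pot_remainder[OF _ d] unfolding z_def by (auto elim!: eventually_mono)
    qed (use hi zi in auto)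
    also have "\<dots> = 3 * \<kappa>\<^sup>2 / d\<^sup>2 * dev t" by (simp add: dev_def z_def)
    finally have F: "L * \<bar>force t - dPot \<kappa> (mean t)\<bar> \<le> 3 * \<kappa>\<^sup>2 / d\<^sup>2 * dev t" .
    show "\<bar>force t - dPot \<kappa> (mean t)\<bar> \<le> 3 * \<kappa>\<^sup>2 / d\<^sup>2 * dev t / L"
      by (rule mult_imp_le_div_pos[OF L], subst mult.commute, rule F)
  qed
qed

text \<open>Adding \<open>dPot\<close> times the deviation does not change the integral, so
  \<open>Pot_remainder\<close> applies under it.\<close>

lemma Pot_mean_le:
  assumes t: "t \<ge> 0" and d: "d > 0" "d \<le> \<bar>\<bar>mean t\<bar> - 1\<bar>"
  shows "L * Pot \<kappa> (mean t) - (\<integral>x. Pot \<kappa> (u (t, x)) \<partial>X) \<le> \<kappa>\<^sup>2 / d * dev t"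
proof -
  define z where "z x = u (t, x) - mean t" for x
  have zi: "integrable X z" "integrable X (\<lambda>x. (z x)\<^sup>2)"
    and z0: "(\<integral>x. z x \<partial>X) = 0"
    unfolding z_def using deviation_slice[of t] t by auto
  have ip: "integrable X (\<lambda>x. Pot \<kappa> (u (t, x)))"
    using t by (intro continuous_space_measure(2) continuous_on_compose2[OF continuous_Pot[of UNIV]] slice_cont) auto
  have "L * Pot \<kappa> (mean t) - (\<integral>x. Pot \<kappa> (u (t, x)) \<partial>X)
      = (\<integral>x. Pot \<kappa> (mean t) - Pot \<kappa> (u (t, x)) + dPot \<kappa> (mean t) * z x \<partial>X)"
    using ip zi z0 integral_X_const[of "Pot \<kappa> (mean t)"] by simp
  also have "\<dots> \<le> (\<integral>x. \<kappa>\<^sup>2 * (z x)\<^sup>2 / d \<partial>X)"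
  proof (rule integral_mono)
    show "Pot \<kappa> (mean t) - Pot \<kappa> (u (t, x)) + dPot \<kappa> (mean t) * z x \<le> \<kappa>\<^sup>2 * (z x)\<^sup>2 / d" for x
      using Pot_remainder[OF d] by (simp add: z_def)
  qed (use ip zi in simp_all)
  also have "\<dots> = \<kappa>\<^sup>2 / d * dev t" by (simp add: dev_def z_def)
  finally show ?thesis .
qed

end

subsection \<open>Persistence of flatness\<close>

context beam
begin

lemma mean_const:
  assumes "\<And>x. x \<in> {0..L} \<Longrightarrow> u (t, x) = c" shows "mean t = c"
proof -
  have "(\<integral>x. u (t, x) \<partial>X) = (\<integral>x. c \<partial>X)"
    by (intro Bochner_Integration.integral_cong) (use assms in auto)
  then show ?thesis using L by (simp add: mean_def)
qed

text \<open>If the beam is flat at time \<open>T\<close> and its mean moves with nonzero velocity, then \<open>mean t\<close> leaves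
  the kinks of the potential at a linear rate.  The energy inequality then turns a bound \<open>M\<close> on the
  squared velocity deviation \<open>vdev\<close> into the bound \<open>M / 2\<close> on a time interval independent of \<open>M\<close>.\<close>

lemma local_extension:
  assumes T: "T \<ge> 0" and c: "\<And>x. x \<in> {0..L} \<Longrightarrow> u (T, x) = c"
    and q: "vel T \<noteq> 0" and en: "(vel T)\<^sup>2 / 2 + Pot \<kappa> c = e0"
  shows "\<exists>\<delta>>0. \<forall>t\<in>{T..T + \<delta>}. (\<forall>x\<in>{0..L}. u (t, x) = mean t) \<and> (vel t)\<^sup>2 / 2 + Pot \<kappa> (mean t) = e0"
proof -
  define a where "a = \<bar>vel T\<bar>"
  have a: "a > 0" using q by (simp add: a_def)
  have mT: "mean T = c" by (rule mean_const[OF c])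
  \<comment> \<open>\<open>force_remainder\<close> with d = a s / 2 and dev \<le> s^2 M gives an
    error of at most K1 M in the force, uniformly in the elapsed time s.\<close>
  define K1 where "K1 = 12 * \<kappa>\<^sup>2 / (a\<^sup>2 * L)"
  \<comment> \<open>The coefficient of M s in the final bound on vdev / 2: the first part collects
    the errors of velocity and flat energy, the second is the potential deficit from
    \<open>Pot_mean_le\<close> with d = a s / 2.\<close>
  define K2 where "K2 = L * ((a + 2 * \<kappa>\<^sup>2) * K1) + 2 * \<kappa>\<^sup>2 / a"
  have K1: "K1 \<ge> 0" using a L by (simp add: K1_def)
  have K2: "K2 \<ge> 0" using a L K1 by (simp add: K2_def)
  \<comment> \<open>Off the kinks the time span is limited by the distance to them; starting on a
    kink this limit is void, and 1 is a dummy.\<close>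
  define g where "g = (if \<bar>c\<bar> = 1 then 1 else \<bar>\<bar>c\<bar> - 1\<bar> / (2 * a))"
  have g: "g > 0" using a by (auto simp: g_def)
  \<comment> \<open>In order: the elapsed time is at most 1; the Taylor error is at most half the
    linear displacement; the mean stays within 1 of a kink it starts from, away from the other one;
    it does not reach a kink it does not start from; the bound on \<open>vdev\<close> is halved. The
    summands 1 keep the denominators positive.\<close>
  define \<delta> where "\<delta> = min 1 (min (a / (4 * \<kappa>\<^sup>2 + 1)) (min (1 / (2 * a)) (min g (1 / (4 * K2 + 1)))))"
  have \<delta>: "\<delta> > 0" using a g K2 by (simp add: \<delta>_def add_nonneg_pos)
  have \<delta>1: "\<delta> \<le> 1" by (simp add: \<delta>_def)
  have \<delta>2: "4 * \<kappa>\<^sup>2 * \<delta> \<le> a"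
  proof -
    have "\<delta> \<le> a / (4 * \<kappa>\<^sup>2 + 1)" by (simp add: \<delta>_def)
    then have "\<delta> * (4 * \<kappa>\<^sup>2 + 1) \<le> a" by (subst (asm) pos_le_divide_eq) (auto simp: add_nonneg_pos)
    then show ?thesis using \<delta> by (simp add: algebra_simps)
  qed
  have \<delta>3: "2 * a * \<delta> \<le> 1"
  proof -
    have "\<delta> \<le> 1 / (2 * a)" by (simp add: \<delta>_def)
    then show ?thesis using a by (simp add: pos_le_divide_eq mult.commute)
  qed
  have \<delta>4: "2 * a * \<delta> \<le> \<bar>\<bar>c\<bar> - 1\<bar>" if "\<bar>c\<bar> \<noteq> 1"
  proof -
    have "\<delta> \<le> g" by (simp add: \<delta>_def)
    then have "\<delta> \<le> \<bar>\<bar>c\<bar> - 1\<bar> / (2 * a)" using that by (simp add: g_def)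
    then show ?thesis using a by (simp add: pos_le_divide_eq mult.commute)
  qed
  have \<delta>5: "4 * K2 * \<delta> \<le> 1"
  proof -
    have "\<delta> \<le> 1 / (4 * K2 + 1)" by (simp add: \<delta>_def)
    then have "\<delta> * (4 * K2 + 1) \<le> 1" using K2 by (subst (asm) pos_le_divide_eq) auto
    then show ?thesis using \<delta> by (simp add: algebra_simps)
  qed
  \<comment> \<open>The displacement lies between 1/2 and 3/2 of a (t - T). On a kink the lower
    bound decides; off the kinks at least 2 a (t - T) was available, and 3/2 of a (t - T) is used
    up.\<close>
  have gap: "a * (t - T) / 2 \<le> \<bar>\<bar>mean t\<bar> - 1\<bar>" if t: "T < t" "t \<le> T + \<delta>" for t
  proof -
    define \<tau> where "\<tau> = t - T"
    have \<tau>: "\<tau> > 0" "\<tau> \<le> \<delta>" using t by (auto simp: \<tau>_def)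
    have "\<bar>mean t - c - vel T * \<tau>\<bar> \<le> 2 * \<kappa>\<^sup>2 * \<tau>\<^sup>2"
      using mean_taylor[of T t] T t mT by (simp add: \<tau>_def)
    also have "2 * \<kappa>\<^sup>2 * \<tau>\<^sup>2 = (2 * \<kappa>\<^sup>2 * \<tau>) * \<tau>" by (simp add: power2_eq_square)
    also have "\<dots> \<le> (a / 2) * \<tau>"
    proof (rule mult_right_mono)
      have "4 * \<kappa>\<^sup>2 * \<tau> \<le> 4 * \<kappa>\<^sup>2 * \<delta>" using \<tau> by (intro mult_left_mono) auto
      then show "2 * \<kappa>\<^sup>2 * \<tau> \<le> a / 2" using \<delta>2 by linarith
    qed (use \<tau> in simp)
    finally have 1: "\<bar>mean t - c - vel T * \<tau>\<bar> \<le> a * \<tau> / 2" by simp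
    have 2: "\<bar>vel T * \<tau>\<bar> = a * \<tau>" using \<tau> by (simp add: a_def abs_mult)
    have 3: "a * \<tau> / 2 \<le> \<bar>mean t - c\<bar>" "\<bar>mean t - c\<bar> \<le> 3 * (a * \<tau>) / 2" using 1 2 by linarith+
    have 4: "a * \<tau> \<le> a * \<delta>" using \<tau> a by (intro mult_left_mono) auto
    have "a * \<tau> / 2 \<le> \<bar>\<bar>mean t\<bar> - 1\<bar>"
    proof (cases "\<bar>c\<bar> = 1")
      case True
      have "\<bar>mean t - c\<bar> \<le> 1" using 3 4 \<delta>3 by linarith
      then show ?thesis using 3 True by linarith
    next
      case False
      show ?thesis using 3 4 \<delta>4[OF False] by linarith
    qed
    then show ?thesis by (simp add: \<tau>_def)
  qed
  \<comment> \<open>The force on a beam flat at height \<open>mean r\<close>. Clipping at time 0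
    makes it measurable on the whole line; its value at \<open>T\<close>, where the mean may sit on
    a kink, does not affect integrals.\<close>
  define \<phi> where "\<phi> r = dPot \<kappa> (mean (max r 0))" for r
  have \<phi>b: "\<bar>\<phi> r\<bar> \<le> \<kappa>\<^sup>2" for r by (simp add: \<phi>_def dPot_bound)
  have mc: "continuous_on UNIV (\<lambda>r. mean (max r 0))"
    by (rule continuous_on_compose2[OF mean_cont]) (auto intro!: continuous_intros)
  have \<phi>m: "\<phi> \<in> borel_measurable borel"
    unfolding \<phi>_def using measurable_compose[OF borel_measurable_continuous_onI[OF mc] dPot_borel] .
  have \<phi>i: "set_integrable lborel {s..t} \<phi>" for s t
    using set_integrable_mult_bounded[OF borel_integrable_atLeastAtMost'[OF continuous_on_const[of "{s..t}" 1]] _ \<phi>b]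
      \<phi>m by simp
  \<comment> \<open>The velocity driven by the flat force \<open>\<phi>\<close>, compared below with
    the true \<open>vel\<close>. Unlike \<open>vel\<close> it has a classical derivative at every
    time inside the interval, because \<open>\<phi>\<close> is continuous off the kinks.\<close>
  define w where "w t = vel T - integral {T..t} \<phi>" for t
  have \<phi>h: "\<phi> integrable_on {s..t}" for s t using set_borel_integral_eq_integral(1)[OF \<phi>i] .
  have \<phi>c: "isCont \<phi> t" if t: "T < t" "t \<le> T + \<delta>" for t
  proof -
    have "a * (t - T) > 0" using a t by simp
    then have "\<bar>mean (max t 0)\<bar> \<noteq> 1" using gap[OF t] t T by (auto simp: max_def)
    then have "isCont (dPot \<kappa>) (mean (max t 0))" by (rule dPot_isCont)
    moreover have "isCont (\<lambda>r. mean (max r 0)) t" using mc by (simp add: continuous_on_eq_continuous_at)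
    ultimately show ?thesis unfolding \<phi>_def by (rule isCont_o2[rotated])
  qed
  have wcont: "continuous_on {T..T + \<delta>} w"
    unfolding w_def by (intro continuous_intros indefinite_integral_continuous_1 \<phi>h)
  have wbound: "\<bar>w t - vel T\<bar> \<le> \<kappa>\<^sup>2 * (t - T)" if "T \<le> t" for t
  proof -
    have "norm (integral {T..t} \<phi>) \<le> integral {T..t} (\<lambda>_. \<kappa>\<^sup>2)"
      by (rule integral_norm_bound_integral[OF \<phi>h]) (use \<phi>b in auto)
    then show ?thesis using that by (simp add: w_def mult.commute)
  qed
  have wder: "(w has_real_derivative - \<phi> t) (at t)" if t: "T < t" "t < T + \<delta>" for t
  proof -
    have "((\<lambda>s. integral {T..s} \<phi>) has_vector_derivative \<phi> t) (at t within {T..T + \<delta>})"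
      using integral_has_vector_derivative_continuous_at[OF \<phi>h[of T "T + \<delta>"], of t "{}"] \<phi>c[of t] t
      by (auto intro: continuous_at_imp_continuous_at_within)
    then have "((\<lambda>s. integral {T..s} \<phi>) has_real_derivative \<phi> t) (at t)"
      using t at_within_interior[of t "{T..T + \<delta>}"]
      by (simp add: has_real_derivative_iff_has_vector_derivative)
    from DERIV_diff[OF DERIV_const[of "vel T"] this] show ?thesis by (simp add: w_def[abs_def])
  qed
  have mder: "(mean has_real_derivative vel t) (at t)" if t: "T < t" for t
    using mean_has_deriv[of t] at_within_interior[of t "{0..}"] t T by simp
  \<comment> \<open>The flat energy with \<open>w\<close> in place of \<open>vel\<close>. Had the
    mean velocity \<open>w\<close>, it would be conserved; as it is, the derivative carries the
    factor \<open>vel t - w t\<close>.\<close>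
  define F where "F t = (w t)\<^sup>2 / 2 + Pot \<kappa> (mean t)" for t
  have FT: "F T = e0" using en mT by (simp add: F_def w_def)
  have Fc: "continuous_on {T..T + \<delta>} F"
    unfolding F_def
    by (intro continuous_intros wcont continuous_on_compose2[OF continuous_Pot[of UNIV]]
        continuous_on_subset[OF mean_cont]) (use T in auto)
  have Fder: "(F has_real_derivative \<phi> t * (vel t - w t)) (at t)" if t: "T < t" "t < T + \<delta>" for t
  proof -
    have "a * (t - T) > 0" using a t by simp
    then have "\<bar>mean t\<bar> \<noteq> 1" using gap[of t] t by auto
    from DERIV_chain2[OF Pot_has_deriv[OF this] mder[OF t(1)]]
    have "((\<lambda>t. Pot \<kappa> (mean t)) has_real_derivative dPot \<kappa> (mean t) * vel t) (at t)" .
    moreover have "((\<lambda>t. (w t)\<^sup>2 / 2) has_real_derivative w t * (- \<phi> t)) (at t)"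
      by (rule derivative_eq_intros wder[OF t] | simp)+
    ultimately have "((\<lambda>t. (w t)\<^sup>2 / 2 + Pot \<kappa> (mean t)) has_real_derivative
        w t * (- \<phi> t) + dPot \<kappa> (mean t) * vel t) (at t)" by (intro DERIV_add)
    moreover have "dPot \<kappa> (mean t) = \<phi> t" using t T by (simp add: \<phi>_def)
    ultimately show ?thesis by (simp add: F_def[abs_def] algebra_simps)
  qed
  define P where "P M \<longleftrightarrow> (AE r in lborel. r \<in> {T<..T + \<delta>} \<longrightarrow> vdev r \<le> M)" for M
  have devM: "dev t \<le> (t - T)\<^sup>2 * M" if "P M" "T < t" "t \<le> T + \<delta>" for M t
  proof (rule dev_bound[OF T that(2) c])
    show "AE r in lborel. r \<in> {T<..t} \<longrightarrow> vdev r \<le> M"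
      using that(1) unfolding P_def by eventually_elim (use that in auto)
  qed
  \<comment> \<open>In the force error the square of the elapsed time in \<open>dev\<close> cancels
    against d^2, so the integrand is bounded up to time \<open>T\<close>, even if the mean starts on
    a kink.\<close>
  have kM: "\<bar>vel t - w t\<bar> \<le> K1 * M * (t - T)" if M: "P M" and t: "T < t" "t \<le> T + \<delta>" for M t
  proof -
    have f: "set_integrable lborel {T<..t} force" by (rule force_integrable[OF T])
    have p: "set_integrable lborel {T<..t} \<phi>" by (rule set_integrable_subset[OF \<phi>i[of T t]]) auto
    have "(LINT r:{T<..t}|lborel. \<phi> r) = (LINT r:{T..t}|lborel. \<phi> r)"
    proof (rule set_integral_cong_set[symmetric])
      show "set_borel_measurable lborel {T<..t} \<phi>" "set_borel_measurable lborel {T..t} \<phi>"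
        using p \<phi>i by (auto simp: set_integrable_def set_borel_measurable_def)
      show "AE r in lborel. r \<in> {T<..t} \<longleftrightarrow> r \<in> {T..t}"
        using AE_lborel_singleton[of T] by eventually_elim auto
    qed
    then have "(LINT r:{T<..t}|lborel. \<phi> r) = integral {T..t} \<phi>"
      using set_borel_integral_eq_integral(2)[OF \<phi>i] by simp
    then have eq: "vel t - w t = - (LINT r:{T<..t}|lborel. force r - \<phi> r)"
      using vel_diff[OF T less_imp_le[OF t(1)]] set_integral_diff(2)[OF f p] by (simp add: w_def)
    have d: "set_integrable lborel {T<..t} (\<lambda>r. force r - \<phi> r)" using f p by (rule set_integral_diff(1))
    have "\<bar>LINT r:{T<..t}|lborel. force r - \<phi> r\<bar> \<le> (LINT r:{T<..t}|lborel. \<bar>force r - \<phi> r\<bar>)"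
      using set_integral_norm_bound[OF d] by simp
    also have "\<dots> \<le> (LINT r:{T<..t}|lborel. K1 * M)"
    proof (rule set_integral_mono_AE[OF set_integrable_abs[OF d]])
      show "set_integrable lborel {T<..t} (\<lambda>r. K1 * M)" using t by (simp add: set_integrable_def)
      show "AE r\<in>{T<..t} in lborel. \<bar>force r - \<phi> r\<bar> \<le> K1 * M"
        using force_remainder
      proof eventually_elim
        case (elim r)
        show ?case
        proof
          assume r: "r \<in> {T<..t}"
          define d where "d = a * (r - T) / 2"
          have d: "d > 0" using r a by (simp add: d_def)
          have dg: "d \<le> \<bar>\<bar>mean r\<bar> - 1\<bar>" using gap[of r] r t by (simp add: d_def)
          have "\<bar>force r - \<phi> r\<bar> \<le> 3 * \<kappa>\<^sup>2 / d\<^sup>2 * dev r / L"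
            using elim d dg r T by (auto simp: \<phi>_def max_def)
          also have "\<dots> \<le> 3 * \<kappa>\<^sup>2 / d\<^sup>2 * ((r - T)\<^sup>2 * M) / L"
            using devM[OF M, of r] r t L by (intro divide_right_mono mult_left_mono) auto
          also have "\<dots> = K1 * M"
          proof -
            have "3 * \<kappa>\<^sup>2 / (a * s / 2)\<^sup>2 * (s\<^sup>2 * M) / L = K1 * M" if "s > 0" for s
              using that a L by (simp add: K1_def power2_eq_square field_simps)
            then show ?thesis using r by (simp add: d_def)
          qed
          finally show "\<bar>force r - \<phi> r\<bar> \<le> K1 * M" .
        qed
      qed
    qed
    also have "\<dots> = K1 * M * (t - T)" using t by (simp add: set_lebesgue_integral_def)
    finally show ?thesis using eq by simp
  qed
  have FM: "\<bar>F t - e0\<bar> \<le> \<kappa>\<^sup>2 * (K1 * M * (t - T))" if M: "P M" "M \<ge> 0" and t: "T < t" "t \<le> T + \<delta>" for M t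
  proof -
    have "\<exists>l z. T < z \<and> z < t \<and> (F has_real_derivative l) (at z) \<and> F t - F T = (t - T) * l"
    proof (rule MVT[OF t(1)])
      show "continuous_on {T..t} F" by (rule continuous_on_subset[OF Fc]) (use t in auto)
      show "F differentiable (at x)" if "T < x" "x < t" for x
        using Fder[of x] that t unfolding real_differentiable_def by auto
    qed
    then obtain l z where z: "T < z" "z < t" "(F has_real_derivative l) (at z)" "F t - F T = (t - T) * l"
      by blast
    then have l: "l = \<phi> z * (vel z - w z)" using Fder[of z] t DERIV_unique by fastforce
    have "\<bar>F t - e0\<bar> = (t - T) * (\<bar>\<phi> z\<bar> * \<bar>vel z - w z\<bar>)"
      using z(4) FT l t by (simp add: abs_mult)
    also have "\<dots> \<le> 1 * (\<kappa>\<^sup>2 * (K1 * M * (t - T)))"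
    proof (rule mult_mono)
      show "t - T \<le> 1" using t \<delta>1 by linarith
      have "\<bar>vel z - w z\<bar> \<le> K1 * M * (z - T)" using kM[OF M(1), of z] z t by auto
      also have "\<dots> \<le> K1 * M * (t - T)" using z K1 M by (intro mult_left_mono) auto
      finally show "\<bar>\<phi> z\<bar> * \<bar>vel z - w z\<bar> \<le> \<kappa>\<^sup>2 * (K1 * M * (t - T))"
        by (intro mult_mono \<phi>b) auto
    qed auto
    finally show ?thesis by simp
  qed
  \<comment> \<open>The energy inequality leaves for vdev / 2 only the mismatch between e0 and the
    flat energy plus the potential deficit, both of order M (t - T). As the constants do not involve
    M, one \<delta> serves all iterations.\<close>
  have halve: "P (M / 2)" if M: "P M" "M \<ge> 0" for M
    unfolding P_def using ut_slice
  proof eventually_elim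
    case (elim t)
    show ?case
    proof
      assume tt: "t \<in> {T<..T + \<delta>}"
      then have t: "T < t" "t \<le> T + \<delta>" "t > 0" using T by auto
      define \<tau> where "\<tau> = t - T"
      have \<tau>: "\<tau> > 0" "\<tau> \<le> \<delta>" using t by (auto simp: \<tau>_def)
      have v: "vdev t / 2 + (\<integral>x. Pot \<kappa> (u (t, x)) \<partial>X) \<le> L * (e0 - (vel t)\<^sup>2 / 2)"
        using elim t by blast
      have k: "\<bar>vel t - w t\<bar> \<le> K1 * M * \<tau>" using kM[OF M(1) t(1,2)] by (simp add: \<tau>_def)
      have w: "\<bar>w t\<bar> \<le> a + \<kappa>\<^sup>2"
      proof -
        have "\<kappa>\<^sup>2 * (t - T) \<le> \<kappa>\<^sup>2 * 1" using t \<delta>1 by (intro mult_left_mono) auto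
        then show ?thesis using wbound[of t] t unfolding a_def by linarith
      qed
      have "\<bar>w t\<bar> * \<bar>vel t - w t\<bar> \<le> (a + \<kappa>\<^sup>2) * (K1 * M * \<tau>)"
        by (intro mult_mono w k) (use a in auto)
      moreover have "- (w t * (vel t - w t)) \<le> \<bar>w t\<bar> * \<bar>vel t - w t\<bar>"
        by (metis abs_ge_minus_self abs_mult)
      \<comment> \<open>Expansion about \<open>w t\<close>; the final square has the favourable sign
        and is discarded.\<close>
      moreover have "(vel t)\<^sup>2 / 2 = (w t)\<^sup>2 / 2 + w t * (vel t - w t) + (vel t - w t)\<^sup>2 / 2"
        by (simp add: power2_eq_square field_simps)
      moreover have "(vel t - w t)\<^sup>2 / 2 \<ge> 0" by simp
      moreover have "\<bar>F t - e0\<bar> \<le> \<kappa>\<^sup>2 * (K1 * M * \<tau>)" using FM[OF M t(1,2)] by (simp add: \<tau>_def)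
      ultimately have "e0 - (vel t)\<^sup>2 / 2 - Pot \<kappa> (mean t) \<le> (a + \<kappa>\<^sup>2) * (K1 * M * \<tau>) + \<kappa>\<^sup>2 * (K1 * M * \<tau>)"
        unfolding F_def by linarith
      then have "L * (e0 - (vel t)\<^sup>2 / 2 - Pot \<kappa> (mean t)) \<le> L * ((a + \<kappa>\<^sup>2) * (K1 * M * \<tau>) + \<kappa>\<^sup>2 * (K1 * M * \<tau>))"
        using L by (intro mult_left_mono) auto
      then have 1: "L * (e0 - (vel t)\<^sup>2 / 2) - L * Pot \<kappa> (mean t) \<le> L * ((a + 2 * \<kappa>\<^sup>2) * K1) * (M * \<tau>)"
        by (simp add: algebra_simps)
      have d: "a * \<tau> / 2 > 0" using a \<tau> by simp
      have "L * Pot \<kappa> (mean t) - (\<integral>x. Pot \<kappa> (u (t, x)) \<partial>X) \<le> \<kappa>\<^sup>2 / (a * \<tau> / 2) * dev t"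
        using Pot_mean_le[OF _ d] gap[OF t(1,2)] t by (simp add: \<tau>_def)
      also have "\<dots> \<le> \<kappa>\<^sup>2 / (a * \<tau> / 2) * (\<tau>\<^sup>2 * M)"
        using devM[OF M(1) t(1,2)] d by (intro mult_left_mono) (auto simp: \<tau>_def)
      also have "\<dots> = 2 * \<kappa>\<^sup>2 / a * (M * \<tau>)"
        using a \<tau> by (simp add: power2_eq_square field_simps)
      finally have "vdev t / 2 \<le> K2 * (M * \<tau>)"
        using v 1 unfolding K2_def by (simp add: distrib_right)
      also have "\<dots> \<le> K2 * (M * \<delta>)" using K2 M \<tau> by (intro mult_left_mono) auto
      also have "\<dots> = (4 * K2 * \<delta>) * M / 4" by simp
      also have "\<dots> \<le> 1 * M / 4" using \<delta>5 M by (intro divide_right_mono mult_right_mono) auto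
      finally show "vdev t \<le> M / 2" by simp
    qed
  qed
  have e0: "e0 \<ge> 0" unfolding e0_def using Pot_nonneg[of \<kappa> v0] by simp
  \<comment> \<open>The energy inequality alone supplies the bound from which the halving
    starts.\<close>
  have "P (2 * L * e0)"
    unfolding P_def using ut_slice
  proof eventually_elim
    case (elim t)
    show ?case
    proof
      assume "t \<in> {T<..T + \<delta>}"
      then have "vdev t / 2 + (\<integral>x. Pot \<kappa> (u (t, x)) \<partial>X) \<le> L * (e0 - (vel t)\<^sup>2 / 2)" using elim T by auto
      moreover have "0 \<le> (\<integral>x. Pot \<kappa> (u (t, x)) \<partial>X)" by (simp add: Pot_nonneg)
      moreover have "L * (e0 - (vel t)\<^sup>2 / 2) \<le> L * e0" using L by simp
      ultimately show "vdev t \<le> 2 * L * e0" by linarith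
    qed
  qed
  then have Pn: "P (2 * L * e0 / 2 ^ n)" for n
  proof (induction n)
    case (Suc n)
    then show ?case using halve[of "2 * L * e0 / 2 ^ n"] L e0 by (simp add: field_simps)
  qed simp
  have P0: "P 0"
  proof -
    have "AE r in lborel. \<forall>n. r \<in> {T<..T + \<delta>} \<longrightarrow> vdev r \<le> 2 * L * e0 / 2 ^ n"
      using Pn unfolding P_def AE_all_countable by blast
    then show ?thesis unfolding P_def
    proof eventually_elim
      case (elim r)
      have "(\<lambda>n. 2 * L * e0 / 2 ^ n) \<longlonglongrightarrow> 0" by real_asymp
      then show ?case using elim LIMSEQ_le_const by blast
    qed
  qed
  have "(\<forall>x\<in>{0..L}. u (t, x) = mean t) \<and> (vel t)\<^sup>2 / 2 + Pot \<kappa> (mean t) = e0" if "t \<in> {T..T + \<delta>}" for t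
  proof (cases "t = T")
    case True
    then show ?thesis using c mT en by simp
  next
    case False
    then have t: "T < t" "t \<le> T + \<delta>" "t \<ge> 0" using that T by auto
    have "dev t = 0" using devM[OF P0 t(1,2)] dev_nonneg[of t] by simp
    then have "u (t, x) = mean t" if "x \<in> {0..L}" for x
      using zero_of_integral_square[OF L _ that, of "\<lambda>x. u (t, x) - mean t"] t
      by (simp add: dev_def continuous_on_diff slice_cont)
    moreover have "vel t = w t" using kM[OF P0 t(1,2)] by simp
    moreover have "F t = e0" using FM[OF P0 _ t(1,2)] by simp
    ultimately show ?thesis by (simp add: F_def)
  qed
  then show ?thesis using \<delta> by blast
qed

end

subsection \<open>The detached regime\<close>

lemma AE_interval_witness:
  fixes a b :: real
  assumes "a < b" "AE t in lborel. t \<in> {a<..<b} \<longrightarrow> Q t"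
  shows "\<exists>t\<in>{a<..<b}. Q t"
proof (rule ccontr)
  assume "\<not> ?thesis"
  then have "AE t in lborel. t \<notin> {a<..<b}" using assms(2) by (auto elim!: eventually_mono)
  then have "{a<..<b} \<in> null_sets lborel" using AE_iff_null_sets[of "{a<..<b}" lborel] by simp
  then show False using assms(1) by (simp add: null_sets_def)
qed

text \<open>Differentiating twice makes B times both the sine and the cosine vanish at one point,
  and these have no common zero.\<close>

lemma cos_const_imp_zero:
  fixes B \<nu> \<psi> k :: real
  assumes ab: "a < b" and \<nu>: "\<nu> > 0" and k: "\<And>t. t \<in> {a<..<b} \<Longrightarrow> B * cos (\<nu> * t + \<psi>) = k"
  shows "B = 0"
proof -
  have s: "B * \<nu> * sin (\<nu> * t + \<psi>) = 0" if t: "t \<in> {a<..<b}" for t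
  proof -
    have "((\<lambda>t. B * cos (\<nu> * t + \<psi>)) has_real_derivative - (B * \<nu> * sin (\<nu> * t + \<psi>))) (at t)"
      by (auto intro!: derivative_eq_intros)
    moreover have "((\<lambda>t. B * cos (\<nu> * t + \<psi>)) has_real_derivative 0) (at t)"
      by (rule has_field_derivative_transform_within_open[of "\<lambda>_. k" _ _ "{a<..<b}"]) (use t k in auto)
    ultimately show ?thesis using DERIV_unique by fastforce
  qed
  define t where "t = (a + b) / 2"
  have t: "t \<in> {a<..<b}" using ab by (simp add: t_def)
  have "((\<lambda>t. B * \<nu> * sin (\<nu> * t + \<psi>)) has_real_derivative B * \<nu> * \<nu> * cos (\<nu> * t + \<psi>)) (at t)"
    by (auto intro!: derivative_eq_intros)
  moreover have "((\<lambda>t. B * \<nu> * sin (\<nu> * t + \<psi>)) has_real_derivative 0) (at t)"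
    by (rule has_field_derivative_transform_within_open[of "\<lambda>_. 0" _ _ "{a<..<b}"]) (use t s in auto)
  ultimately have "B * \<nu> * \<nu> * cos (\<nu> * t + \<psi>) = 0" using DERIV_unique by blast
  then show ?thesis
    using s[OF t] \<nu> sin_zero_norm_cos_one[of "\<nu> * t + \<psi>"] by auto
qed

lemma integral_neumann_mode:
  assumes L: "L > 0" and n: "n \<ge> 1"
  shows "(\<integral>x. neumann_mode L n x \<partial>space_measure L) = 0"
proof -
  let ?c = "sqrt (2 / L)"
  have c: "continuous_on {0..L} (neumann_mode L n)"
    unfolding neumann_mode_def using n L by (auto intro!: continuous_intros)
  have "((\<lambda>x. ?c * cos (real n * pi * x / L)) has_integral
      ?c * (L / (real n * pi)) * sin (real n * pi * L / L) - ?c * (L / (real n * pi)) * sin (real n * pi * 0 / L)) {0..L}"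
  proof (rule fundamental_theorem_of_calculus)
    fix x assume "x \<in> {0..L}"
    have "((\<lambda>x. ?c * (L / (real n * pi)) * sin (real n * pi * x / L)) has_real_derivative
        ?c * cos (real n * pi * x / L)) (at x within {0..L})"
      using L n by (auto intro!: derivative_eq_intros simp: field_simps)
    then show "((\<lambda>x. ?c * (L / (real n * pi)) * sin (real n * pi * x / L)) has_vector_derivative
        ?c * cos (real n * pi * x / L)) (at x within {0..L})"
      by (simp add: has_real_derivative_iff_has_vector_derivative)
  qed (use L in simp)
  then have "(neumann_mode L n has_integral 0) {0..L}"
    using L n by (simp add: neumann_mode_def[abs_def])
  then show ?thesis
    unfolding integral_space_measure_eq_integral[OF c] by (rule integral_unique)
qed

context beam
begin

text \<open>Continuation: the good times form a closed set containing 0, and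
  \<open>local_extension\<close> carries goodness beyond the infimum of the bad ones. The potential
  never exceeds \<open>\<kappa>\<^sup>2 / 2\<close>, so exact energy balance keeps the velocity
  nonzero.\<close>

lemma flat_forever:
  assumes e: "e0 > \<kappa>\<^sup>2 / 2" and t: "t \<ge> 0"
  shows "\<forall>x\<in>{0..L}. u (t, x) = mean t"
proof -
  \<comment> \<open>Energy balance is carried along with flatness, because it provides the nonzero
    velocity from which the next extension starts.\<close>
  define Q where "Q s \<longleftrightarrow> (\<forall>x\<in>{0..L}. u (s, x) = mean s) \<and> (vel s)\<^sup>2 / 2 + Pot \<kappa> (mean s) = e0" for s
  have Q0: "Q 0" unfolding Q_def using initial_value by (simp add: mean_0 vel_0 e0_def)
  have closed: "closed {s \<in> {0..}. Q s}"
  proof -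
    have uc: "continuous_on {0..} (\<lambda>s. u (s, x) - mean s)" if "x \<in> {0..L}" for x
      by (intro continuous_on_diff mean_cont continuous_on_compose2[OF u_cont])
         (use that in \<open>auto intro!: continuous_intros\<close>)
    have ec: "continuous_on {0..} (\<lambda>s. (vel s)\<^sup>2 / 2 + Pot \<kappa> (mean s))"
      by (intro continuous_intros vel_cont continuous_on_compose2[OF continuous_Pot[of UNIV] mean_cont]) auto
    have "closed ({s \<in> {0..}. (vel s)\<^sup>2 / 2 + Pot \<kappa> (mean s) = e0}
        \<inter> (\<Inter>x\<in>{0..L}. {s \<in> {0..}. u (s, x) - mean s = 0}))"
      by (intro closed_Int closed_INT ballI continuous_closed_preimage_constant ec uc) auto
    moreover have "{s \<in> {0..}. Q s} = {s \<in> {0..}. (vel s)\<^sup>2 / 2 + Pot \<kappa> (mean s) = e0}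
        \<inter> (\<Inter>x\<in>{0..L}. {s \<in> {0..}. u (s, x) - mean s = 0})"
      by (auto simp: Q_def)
    ultimately show ?thesis by simp
  qed
  have "Q t"
  proof (rule ccontr)
    assume "\<not> Q t"
    define B where "B = {s. 0 \<le> s \<and> \<not> Q s}"
    have B: "B \<noteq> {}" "bdd_below B" using \<open>\<not> Q t\<close> t by (auto simp: B_def intro!: bdd_belowI[of _ 0])
    define i where "i = Inf B"
    have i0: "i \<ge> 0" unfolding i_def using B by (intro cInf_greatest) (auto simp: B_def)
    have below: "Q s" if "0 \<le> s" "s < i" for s
      using that cInf_lower[OF _ B(2), of s] by (auto simp: B_def i_def)
    have Qi: "Q i"
    proof (cases "i = 0")
      case False
      then have "i \<in> closure {0..<i}" using i0 by (simp add: closure_atLeastLessThan)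
      also have "\<dots> \<subseteq> {s \<in> {0..}. Q s}"
        by (rule closure_minimal[OF _ closed]) (use below in auto)
      finally show ?thesis by simp
    qed (use Q0 in simp)
    have v: "vel i \<noteq> 0"
    proof
      assume "vel i = 0"
      then have "Pot \<kappa> (mean i) = e0" using Qi by (simp add: Q_def)
      then show False using e Pot_le[of \<kappa> "mean i"] by simp
    qed
    obtain \<delta> where \<delta>: "\<delta> > 0" "\<forall>s\<in>{i..i + \<delta>}. Q s"
      using local_extension[OF i0 _ v, of "mean i"] Qi unfolding Q_def by blast
    have "i + \<delta> \<le> Inf B"
    proof (rule cInf_greatest[OF B(1)])
      fix s assume "s \<in> B"
      then show "i + \<delta> \<le> s" using below[of s] \<delta>(2) by (force simp: B_def)
    qed
    then show False using \<delta> by (simp add: i_def)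
  qed
  then show ?thesis by (simp add: Q_def)
qed

lemma mode_coeff_eq: "mode_coeff L u n t = (\<integral>x. u (t, x) * neumann_mode L n x \<partial>X)"
  by (simp add: mode_coeff_def integral_space_measure)

lemma mode_coeff_0: "mode_coeff L u 0 t = sqrt L * mean t"
proof -
  have "mode_coeff L u 0 t = L * mean t / sqrt L"
    unfolding mode_coeff_eq by (simp add: neumann_mode_def integral_slice)
  also have "\<dots> = sqrt L * mean t" using L by (simp add: real_div_sqrt field_simps)
  finally show ?thesis .
qed

lemma vel_detached:
  assumes a: "0 \<le> a" and t: "t \<in> {a<..<b}"
    and m: "\<And>t. t \<in> {a<..<b} \<Longrightarrow> mode_coeff L u 0 t = C0 + C1 * t"
  shows "vel t = C1 / sqrt L"
proof -
  have eq: "mean s = (C0 + C1 * s) / sqrt L" if "s \<in> {a<..<b}" for s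
    using m[OF that] L unfolding mode_coeff_0 by (simp add: field_simps)
  have "((\<lambda>s. C0 + C1 * s) has_real_derivative C1) (at t)"
    by (auto intro!: derivative_eq_intros)
  then have "((\<lambda>s. (C0 + C1 * s) / sqrt L) has_real_derivative C1 / sqrt L) (at t)"
    by (rule DERIV_cdivide)
  then have "(mean has_real_derivative C1 / sqrt L) (at t)"
    by (rule has_field_derivative_transform_within_open[of _ _ _ "{a<..<b}"]) (use t eq in auto)
  moreover have "(mean has_real_derivative vel t) (at t)"
    using mean_has_deriv[of t] at_within_interior[of t "{0..}"] t a by simp
  ultimately show ?thesis by (rule DERIV_unique[symmetric])
qed

lemma detached_energy:
  assumes a: "0 \<le> a"
    and u1: "\<And>t x. t \<in> {a<..<b} \<Longrightarrow> x \<in> {0..L} \<Longrightarrow> \<bar>u (t, x)\<bar> > 1"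
    and m: "\<And>t. t \<in> {a<..<b} \<Longrightarrow> mode_coeff L u 0 t = C0 + C1 * t"
  shows "AE t in lborel. t \<in> {a<..<b} \<longrightarrow> vdev t + C1\<^sup>2 \<le> 2 * L * (e0 - \<kappa>\<^sup>2 / 2)"
  using ut_slice
proof eventually_elim
  case (elim t)
  show ?case
  proof
    assume t: "t \<in> {a<..<b}"
    have "(\<integral>x. Pot \<kappa> (u (t, x)) \<partial>X) = (\<integral>x. \<kappa>\<^sup>2 / 2 \<partial>X)"
    proof (intro Bochner_Integration.integral_cong refl)
      fix x assume "x \<in> space X"
      then have "\<bar>u (t, x)\<bar> > 1" using u1[OF t, of x] by simp
      then show "Pot \<kappa> (u (t, x)) = \<kappa>\<^sup>2 / 2" by (simp add: Pot_def)
    qed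
    also have "\<dots> = \<kappa>\<^sup>2 / 2 * L" by (rule integral_X_const)
    finally have "vdev t / 2 + \<kappa>\<^sup>2 / 2 * L \<le> L * (e0 - (vel t)\<^sup>2 / 2)" using elim t a by auto
    moreover have "(vel t)\<^sup>2 = C1\<^sup>2 / L"
      using vel_detached[OF a t m] L by (simp add: power_divide)
    ultimately show "vdev t + C1\<^sup>2 \<le> 2 * L * (e0 - \<kappa>\<^sup>2 / 2)"
      using L by (simp add: algebra_simps)
  qed
qed

lemma C1_bound:
  assumes ab: "0 \<le> a" "a < b"
    and u1: "\<And>t x. t \<in> {a<..<b} \<Longrightarrow> x \<in> {0..L} \<Longrightarrow> \<bar>u (t, x)\<bar> > 1"
    and m: "\<And>t. t \<in> {a<..<b} \<Longrightarrow> mode_coeff L u 0 t = C0 + C1 * t"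
  shows "C1\<^sup>2 \<le> 2 * L * (e0 - \<kappa>\<^sup>2 / 2)"
proof -
  obtain t where "vdev t + C1\<^sup>2 \<le> 2 * L * (e0 - \<kappa>\<^sup>2 / 2)"
    using AE_interval_witness[OF ab(2) detached_energy[OF ab(1) u1 m]] by blast
  then show ?thesis using vdev_nonneg[of t] by linarith
qed

text \<open>Above the energy threshold the mode vanishes by flatness; otherwise \<open>ut\<close>
  vanishes almost everywhere on the interval and the mode is constant in time. A cosine of positive
  frequency is constant on an interval only with amplitude zero.\<close>

lemma mode_amplitude_zero:
  assumes ab: "0 \<le> a" "a < b"
    and u1: "\<And>t x. t \<in> {a<..<b} \<Longrightarrow> x \<in> {0..L} \<Longrightarrow> \<bar>u (t, x)\<bar> > 1"
    and m: "\<And>t. t \<in> {a<..<b} \<Longrightarrow> mode_coeff L u 0 t = C0 + C1 * t"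
    and n: "n \<ge> 1" and \<nu>: "\<nu> > 0"
    and mn: "\<And>t. t \<in> {a<..<b} \<Longrightarrow> mode_coeff L u n t = B * cos (\<nu> * t + \<psi>)"
  shows "B = 0"
proof -
  have nc: "continuous_on {0..L} (neumann_mode L n)"
    unfolding neumann_mode_def using n L by (auto intro!: continuous_intros)
  have "\<exists>k. \<forall>t\<in>{a<..<b}. mode_coeff L u n t = k"
  proof (cases "e0 > \<kappa>\<^sup>2 / 2")
    case True
    have "mode_coeff L u n t = 0" if t: "t \<in> {a<..<b}" for t
    proof -
      have "\<forall>x\<in>{0..L}. u (t, x) = mean t" using flat_forever[OF True] t ab by auto
      then have "mode_coeff L u n t = (\<integral>x. mean t * neumann_mode L n x \<partial>X)"
        unfolding mode_coeff_eq by (intro Bochner_Integration.integral_cong) auto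
      then show ?thesis using integral_neumann_mode[OF L n] by simp
    qed
    then show ?thesis by blast
  next
    case False
    have C: "C1\<^sup>2 \<le> 2 * L * (e0 - \<kappa>\<^sup>2 / 2)" by (rule C1_bound[OF ab u1 m])
    moreover have "2 * L * (e0 - \<kappa>\<^sup>2 / 2) \<le> 0" using False L by (intro mult_nonneg_nonpos) auto
    ultimately have "C1\<^sup>2 \<le> 0" and le0: "2 * L * (e0 - \<kappa>\<^sup>2 / 2) \<le> 0" by linarith+
    then have C1: "C1 = 0" by simp
    have de: "AE t in lborel. t \<in> {a<..<b} \<longrightarrow> vdev t + C1\<^sup>2 \<le> 2 * L * (e0 - \<kappa>\<^sup>2 / 2)"
      by (rule detached_energy[OF ab(1) u1 m])
    have utz: "AE t in lborel. t \<in> {a<..<b} \<longrightarrow> (\<integral>x. ut (t, x) * neumann_mode L n x \<partial>X) = 0"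
      using ut_slice de
    proof eventually_elim
      case (elim t)
      show ?case
      proof
        assume t: "t \<in> {a<..<b}"
        then have "vdev t \<le> 0" using elim C1 le0 by auto
        then have "vdev t = 0" using vdev_nonneg[of t] by simp
        moreover have "vel t = 0" using vel_detached[OF ab(1) t m] C1 by simp
        ultimately have "(\<integral>x. (ut (t, x))\<^sup>2 \<partial>X) = 0" "integrable X (\<lambda>x. (ut (t, x))\<^sup>2)"
          using elim t ab by auto
        then have "AE x in X. (ut (t, x))\<^sup>2 = 0" by (subst (asm) integral_nonneg_eq_0_iff_AE) auto
        then have "AE x in X. ut (t, x) * neumann_mode L n x = 0" by eventually_elim simp
        then show "(\<integral>x. ut (t, x) * neumann_mode L n x \<partial>X) = 0" by (rule integral_eq_zero_AE)
      qed
    qed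
    have const: "mode_coeff L u n t = mode_coeff L u n s" if st: "s \<in> {a<..<b}" "t \<in> {a<..<b}" "s \<le> t" for s t
    proof -
      have i: "integrable X (\<lambda>x. u (r, x) * neumann_mode L n x)" if "r \<ge> 0" for r
        by (rule continuous_space_measure(2)[OF continuous_on_mult[OF slice_cont[OF that] nc]])
      have "mode_coeff L u n t - mode_coeff L u n s = (\<integral>x. (u (t, x) - u (s, x)) * neumann_mode L n x \<partial>X)"
        unfolding mode_coeff_eq using i[of t] i[of s] st ab by (simp add: left_diff_distrib)
      also have "\<dots> = (LINT r:{s<..t}|lborel. \<integral>x. ut (r, x) * neumann_mode L n x \<partial>X)"
        by (rule u_increment(1)[OF _ st(3) nc]) (use st ab in auto)
      also have "\<dots> = 0"
        unfolding set_lebesgue_integral_def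
      proof (rule integral_eq_zero_AE)
        show "AE r in lborel. indicator {s<..t} r *\<^sub>R (\<integral>x. ut (r, x) * neumann_mode L n x \<partial>X) = 0"
          using utz by eventually_elim (use st in \<open>auto simp: indicator_def\<close>)
      qed
      finally show ?thesis by simp
    qed
    have "mode_coeff L u n t = mode_coeff L u n ((a + b) / 2)" if "t \<in> {a<..<b}" for t
      using const[of t "(a + b) / 2"] const[of "(a + b) / 2" t] that by (cases "t \<le> (a + b) / 2") auto
    then show ?thesis by blast
  qed
  then obtain k where "\<And>t. t \<in> {a<..<b} \<Longrightarrow> mode_coeff L u n t = k" by blast
  then have "B * cos (\<nu> * t + \<psi>) = k" if "t \<in> {a<..<b}" for t using mn[OF that] that by simp
  then show ?thesis by (rule cos_const_imp_zero[OF ab(2) \<nu>])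
qed

end

section \<open>From dissipative solutions to the locale \<open>beam\<close>\<close>

lemma L2_integrable:
  assumes "L > 0" "L2 L w" shows "integrable (space_measure L) w" "integrable (space_measure L) (\<lambda>x. (w x)\<^sup>2)"
proof -
  have "w \<in> borel_measurable (space_measure L)"
    using assms(2) unfolding L2_def space_measure_def set_borel_measurable_def
    by (subst borel_measurable_restrict_space_iff) auto
  moreover show "integrable (space_measure L) (\<lambda>x. (w x)\<^sup>2)"
    using assms(2) by (simp add: L2_def integrable_space_measure)
  ultimately show "integrable (space_measure L) w" using L2_space_measure_integrable(1)[OF assms(1)] by blast
qed

text \<open>The derivative of a test function supported inside (0,L) integrates to zero. Applied
  twice, this makes every weak second derivative of constant data vanish almost everywhere.\<close>

lemma weak_deriv_const:
  assumes L: "L > 0" and w: "weak_deriv L v w" "L2 L w" and v: "L2 L v" "AE x in space_measure L. v x = c"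
  shows "AE x in space_measure L. w x = 0"
proof (rule AE_eq_0_of_smooth_tests)
  show "set_integrable lborel {0<..<L} w"
    using L2_integrable(1)[OF L w(2)] by (simp add: integrable_space_measure)
  fix a b \<eta> assume ab: "0 < a" "a \<le> b" "b < L" and \<eta>: "smooth \<eta>" "\<And>x. x \<notin> {a..b} \<Longrightarrow> \<eta> x = (0::real)"
  note t = test_fun1_smooth[OF \<eta>]
  have "closure {x. \<eta> x \<noteq> 0} \<subseteq> {0<..<L}" using t(2) ab by force
  then have "(LINT x:{0<..<L}|lborel. v x * deriv \<eta> x) = - (LINT x:{0<..<L}|lborel. w x * \<eta> x)"
    using w(1) t(1) unfolding weak_deriv_def by blast
  moreover have "(LINT x:{0<..<L}|lborel. v x * deriv \<eta> x) = 0"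
  proof -
    have dc: "continuous_on {0..L} (deriv \<eta>)" by (intro smooth_cont smooth_deriv \<eta>)
    have dm: "deriv \<eta> \<in> borel_measurable (space_measure L)"
      by (rule continuous_space_measure(1)[OF dc])
    have vm: "v \<in> borel_measurable (space_measure L)"
      using L2_integrable(1)[OF L v(1)] by (rule borel_measurable_integrable)
    have "(\<integral>x. v x * deriv \<eta> x \<partial>space_measure L) = (\<integral>x. c * deriv \<eta> x \<partial>space_measure L)"
      by (rule integral_cong_AE) (use v(2) dm vm in \<open>auto elim: eventually_mono\<close>)
    also have "\<dots> = c * integral {0..L} (deriv \<eta>)"
      by (simp only: integral_mult_right_zero integral_space_measure_eq_integral[OF dc])
    also have "integral {0..L} (deriv \<eta>) = \<eta> L - \<eta> 0"
    proof (rule integral_unique, rule fundamental_theorem_of_calculus)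
      show "(\<eta> has_vector_derivative deriv \<eta> x) (at x within {0..L})" for x
        using has_field_derivative_at_within[OF smooth_has_deriv[OF \<eta>(1)]]
        by (simp add: has_real_derivative_iff_has_vector_derivative)
    qed (use L in simp)
    also have "\<dots> = 0" using \<eta>(2)[of L] \<eta>(2)[of 0] ab by auto
    finally show ?thesis by (simp add: integral_space_measure)
  qed
  ultimately show "(LINT x:{0<..<L}|lborel. w x * \<eta> x) = 0" by simp
qed

text \<open>Constant data carry no bending energy, so the right side of the energy inequality is
  explicit; on the left the bending term is nonnegative and may be dropped.\<close>

lemma dissipative_solution_beam:
  assumes L: "L > 0" and d: "dissipative_solution L \<kappa>1 \<kappa>2 (\<lambda>x. v0) (\<lambda>x. v1) u"
  shows "\<exists>ut uxx h. beam L \<kappa>1 \<kappa>2 v0 v1 u ut uxx h"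
proof -
  obtain ut uxx v0' v0'' where H: "H2 L (\<lambda>x. v0) v0' v0''"
    and uc: "continuous_on ({0..} \<times> {0..L}) u"
    and ut: "weak_dt L u ut" and Lt: "Linf_L2 {0<..} L ut" and Lx: "Linf_L2 {0<..} L uxx"
    and ws: "weak_solution L \<kappa>1 \<kappa>2 (\<lambda>x. v0) (\<lambda>x. v1) u uxx"
    and en: "AE t in lborel. t > 0 \<longrightarrow>
           energy L \<kappa>1 \<kappa>2 (\<lambda>x. u (t, x)) (\<lambda>x. ut (t, x)) (\<lambda>x. uxx (t, x))
           \<le> energy L \<kappa>1 \<kappa>2 (\<lambda>x. v0) (\<lambda>x. v1) v0''"
    using d unfolding dissipative_solution_def by blast
  obtain h where h: "set_borel_measurable lborel (strip L) h"
    "AE z in lborel. z \<in> strip L \<longrightarrow> h z \<in> subdiff_Pot \<kappa>2 (u z)"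
    "\<And>\<phi>. test_fun \<phi> \<Longrightarrow> \<forall>t. pd_x \<phi> (t, 0) = 0 \<and> pd_x \<phi> (t, L) = 0 \<Longrightarrow>
           (LINT z:strip L|lborel.
              u z * pd_t (pd_t \<phi>) z + \<kappa>1\<^sup>2 * uxx z * pd_x (pd_x \<phi>) z + h z * \<phi> z)
           - (LINT x:{0<..<L}|lborel. v1 * \<phi> (0, x))
           + (LINT x:{0<..<L}|lborel. v0 * pd_t \<phi> (0, x)) = 0"
    using ws unfolding weak_solution_def by blast
  let ?X = "space_measure L"
  have v': "AE x in ?X. v0' x = 0"
    using weak_deriv_const[OF L, of "\<lambda>x. v0" v0' v0] H by (simp add: H2_def)
  have v'': "AE x in ?X. v0'' x = 0"
    using weak_deriv_const[OF L, of v0' v0'' 0] H v' by (simp add: H2_def)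
  have "energy L \<kappa>1 \<kappa>2 (\<lambda>x. v0) (\<lambda>x. v1) v0'' = (\<integral>x. (v1\<^sup>2 + \<kappa>1\<^sup>2 * (v0'' x)\<^sup>2) / 2 + Pot \<kappa>2 v0 \<partial>?X)"
    by (simp add: energy_def integral_space_measure)
  also have "\<dots> = (\<integral>x. v1\<^sup>2 / 2 + Pot \<kappa>2 v0 \<partial>?X)"
  proof (rule integral_cong_AE)
    have "v0'' \<in> borel_measurable ?X"
      using L2_integrable(1)[OF L, of v0''] H by (auto simp: H2_def intro: borel_measurable_integrable)
    then show "(\<lambda>x. (v1\<^sup>2 + \<kappa>1\<^sup>2 * (v0'' x)\<^sup>2) / 2 + Pot \<kappa>2 v0) \<in> borel_measurable ?X" by measurable
    show "AE x in ?X. (v1\<^sup>2 + \<kappa>1\<^sup>2 * (v0'' x)\<^sup>2) / 2 + Pot \<kappa>2 v0 = v1\<^sup>2 / 2 + Pot \<kappa>2 v0"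
      using v'' by eventually_elim simp
  qed simp
  also have "\<dots> = L * (v1\<^sup>2 / 2 + Pot \<kappa>2 v0)" using measure_space_measure[OF L] by simp
  finally have E0: "energy L \<kappa>1 \<kappa>2 (\<lambda>x. v0) (\<lambda>x. v1) v0'' = L * (v1\<^sup>2 / 2 + Pot \<kappa>2 v0)" .
  have sq: "AE t in lborel. t > 0 \<longrightarrow> integrable ?X (\<lambda>x. (w (t, x))\<^sup>2)" if "Linf_L2 {0<..} L w" for w
    using that by (auto simp: Linf_L2_def integrable_space_measure elim!: eventually_mono)
  have "AE t in lborel. t > 0 \<longrightarrow>
      (\<integral>x. (ut (t, x))\<^sup>2 / 2 + Pot \<kappa>2 (u (t, x)) \<partial>?X) \<le> L * (v1\<^sup>2 / 2 + Pot \<kappa>2 v0)"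
    using en sq[OF Lt] sq[OF Lx]
  proof eventually_elim
    case (elim t)
    show ?case
    proof
      assume t: "t > 0"
      have "continuous_on {0..L} (\<lambda>x. u (t, x))"
        by (rule continuous_on_compose2[OF uc]) (use t in \<open>auto intro!: continuous_intros\<close>)
      then have p: "integrable ?X (\<lambda>x. Pot \<kappa>2 (u (t, x)))"
        by (intro continuous_space_measure(2) continuous_on_compose2[OF continuous_Pot[of UNIV]]) auto
      have "(\<integral>x. (ut (t, x))\<^sup>2 / 2 + Pot \<kappa>2 (u (t, x)) \<partial>?X)
          \<le> (\<integral>x. ((ut (t, x))\<^sup>2 + \<kappa>1\<^sup>2 * (uxx (t, x))\<^sup>2) / 2 + Pot \<kappa>2 (u (t, x)) \<partial>?X)"
        by (rule integral_mono) (use p elim t in auto)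
      also have "\<dots> = energy L \<kappa>1 \<kappa>2 (\<lambda>x. u (t, x)) (\<lambda>x. ut (t, x)) (\<lambda>x. uxx (t, x))"
        by (simp add: energy_def integral_space_measure)
      also have "\<dots> \<le> L * (v1\<^sup>2 / 2 + Pot \<kappa>2 v0)" using elim t E0 by simp
      finally show "(\<integral>x. (ut (t, x))\<^sup>2 / 2 + Pot \<kappa>2 (u (t, x)) \<partial>?X) \<le> L * (v1\<^sup>2 / 2 + Pot \<kappa>2 v0)" .
    qed
  qed
  then have "beam L \<kappa>1 \<kappa>2 v0 v1 u ut uxx h"
    by unfold_locales (use L uc Lt Lx h ut in auto)
  then show ?thesis by blast
qed

theorem corollary2p1:
  fixes L \<kappa>1 \<kappa>2 v0 v1 tb A0 \<phi>0 C0 C1 :: real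
    and u :: "real \<times> real \<Rightarrow> real" and B \<psi> :: "nat \<Rightarrow> real"
  assumes "L > 0" and "\<kappa>1 > 0" and "\<kappa>2 \<noteq> 0"
    and "dissipative_solution L \<kappa>1 \<kappa>2 (\<lambda>x. v0) (\<lambda>x. v1) u"
    and "\<bar>v0\<bar> < 1"
    and "tb > 0" and "\<forall>x\<in>{0..L}. \<bar>u (tb, x)\<bar> > 1"
    and "A0 \<ge> 0" and "v0 = A0 * cos \<phi>0 / sqrt L" and "v1 = - A0 * \<bar>\<kappa>2\<bar> * sin \<phi>0 / sqrt L"
    and "detached_coeffs L \<kappa>1 u tb C0 C1 B \<psi>"
    and "\<not> C1_closed_strip L u"
  shows "\<bar>C1\<bar> \<le> \<bar>\<kappa>2\<bar> * sqrt (A0\<^sup>2 - L) \<and>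
    (\<exists>C>0. \<forall>n>1. B n \<le> C * real n powr (-5/2))"
proof -
  obtain ut uxx h where "beam L \<kappa>1 \<kappa>2 v0 v1 u ut uxx h"
    using dissipative_solution_beam[OF assms(1,4)] by blast
  then interpret beam L \<kappa>1 \<kappa>2 v0 v1 u ut uxx h .
  obtain a b where ab: "0 \<le> a" "a < tb" "tb < b"
    and d: "\<And>t. t \<in> {a<..<b} \<Longrightarrow> (\<forall>x\<in>{0..L}. \<bar>u (t, x)\<bar> > 1) \<and> mode_coeff L u 0 t = C0 + C1 * t \<and>
      (\<forall>n\<ge>1. mode_coeff L u n t = B n * cos (frequency L \<kappa>1 n * t + \<psi> n))"
    using assms(11) unfolding detached_coeffs_def by blast
  have a_b: "a < b" using ab by simp
  have u1: "\<bar>u (t, x)\<bar> > 1" if "t \<in> {a<..<b}" "x \<in> {0..L}" for t x using d that by blast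
  have m: "mode_coeff L u 0 t = C0 + C1 * t" if "t \<in> {a<..<b}" for t using d that by blast
  \<comment> \<open>Since \<bar>v0\<bar> < 1 the data lie in the quadratic part of the potential,
    where the total initial energy is \<open>\<kappa>2\<^sup>2 * A0\<^sup>2 / 2\<close>.\<close>
  have e: "2 * L * (e0 - \<kappa>2\<^sup>2 / 2) = \<kappa>2\<^sup>2 * (A0\<^sup>2 - L)"
  proof -
    have "Pot \<kappa>2 v0 = \<kappa>2\<^sup>2 * v0\<^sup>2 / 2" using assms(5) by (simp add: Pot_def)
    then have "2 * L * e0 = L * v1\<^sup>2 + \<kappa>2\<^sup>2 * (L * v0\<^sup>2)"
      unfolding e0_def by (simp add: field_simps)
    also have "L * v1\<^sup>2 = A0\<^sup>2 * \<kappa>2\<^sup>2 * (sin \<phi>0)\<^sup>2"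
      using assms(1) unfolding assms(10) by (simp add: power_divide power_mult_distrib)
    also have "L * v0\<^sup>2 = A0\<^sup>2 * (cos \<phi>0)\<^sup>2"
      using assms(1) unfolding assms(9) by (simp add: power_divide power_mult_distrib)
    also have "A0\<^sup>2 * \<kappa>2\<^sup>2 * (sin \<phi>0)\<^sup>2 + \<kappa>2\<^sup>2 * (A0\<^sup>2 * (cos \<phi>0)\<^sup>2)
        = \<kappa>2\<^sup>2 * A0\<^sup>2 * ((sin \<phi>0)\<^sup>2 + (cos \<phi>0)\<^sup>2)"
      by (simp only: distrib_left mult_ac)
    finally have "2 * L * e0 = \<kappa>2\<^sup>2 * A0\<^sup>2" by simp
    then show ?thesis by (simp add: algebra_simps)
  qed
  have "C1\<^sup>2 \<le> \<kappa>2\<^sup>2 * (A0\<^sup>2 - L)" using C1_bound[OF ab(1) a_b u1 m] unfolding e .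
  \<comment> \<open>\<open>sqrt\<close> is monotone on all reals, so the sign of A0^2 - L requires
    no case distinction; its nonnegativity is implied by the previous line.\<close>
  then have "sqrt (C1\<^sup>2) \<le> sqrt (\<kappa>2\<^sup>2 * (A0\<^sup>2 - L))" by (rule real_sqrt_le_mono)
  then have "\<bar>C1\<bar> \<le> \<bar>\<kappa>2\<bar> * sqrt (A0\<^sup>2 - L)" by (simp add: real_sqrt_mult)
  moreover have "B n = 0" if "n > 1" for n
  proof (rule mode_amplitude_zero[OF ab(1) a_b u1 m])
    show "n \<ge> 1" using that by simp
    show "frequency L \<kappa>1 n > 0" using that assms(1,2) by (simp add: frequency_def)
    show "mode_coeff L u n t = B n * cos (frequency L \<kappa>1 n * t + \<psi> n)" if "t \<in> {a<..<b}" for t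
      using d[OF that] \<open>n > 1\<close> by simp
  qed
  then have "\<forall>n>1. B n \<le> 1 * real n powr (-5/2)" by simp
  ultimately show ?thesis using zero_less_one by blast
qed

end
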